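(* Consider density estimation on $[0,1]$: given a probability density $\pi$ with respect to a finite measure $\nu$ on $[0,1]$, one observes $X_1,\dots,X_n\mid\pi\stackrel{iid}{\sim}\pi$, and the prior on $\pi$ is the law of $$\pi(x)=\frac{e^{W(x)}}{\int_{[0,1]}e^{W(y)}\,d\nu(y)},\qquad x\in[0,1],$$ where $W$ is an $\alpha$-regular $p$-exponential random element in $C[0,1]$, $\alpha>0$, $p\in[1,2]$. Assume $w_0=\log\pi_0\in B^\beta_{\infty\infty}$, $\beta>0$, and denote by $P^n_0$ the distribution of $(X_1,\dots,X_n)$ when $X_i\stackrel{iid}{\sim}\pi_0$. Let $$\rho_n^{\alpha,\beta,p}=\begin{cases}n^{-\frac{\beta}{1+2\beta+p(\alpha-\beta)}},&\beta\le\alpha,\\ n^{-\frac{\alpha}{1+2\alpha}},&\beta>\alpha,\end{cases}\qquad \tilde\rho_n^{\alpha,\beta,p}=\begin{cases}n^{\frac{(2-p)(1-2\alpha)}{8\alpha}-\frac{p\beta}{2(1+2\beta+p(\alpha-\beta))}},&\beta\le\alpha,\\ n^{\frac{2-p-8\alpha^2}{8\alpha(1+2\alpha)}},&\beta>\alpha.\end{cases}$$ Then for $M$ large enough, as $n\to\infty$, $$\Pi_n\left(\pi:d_H(\pi,\pi_0)>M(\rho_n^{\alpha,\beta,p}\vee\tilde\rho_n^{\alpha,\beta,p})\mid X_1,\dots,X_n\right)\to0\quad\text{in }P_0^n\text{-probability}.$$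
   Context: $\Pi_n(\cdot\mid X_1,\dots,X_n)$ is the posterior distribution on $\pi$, and $d_H(\pi,\pi')=\left(\int(\sqrt{\pi}-\sqrt{\pi'})^2d\nu\right)^{1/2}$ is the Hellinger distance. Let $\{\psi_{kl}:k\in\mathbb{N}_0,\ l=1,\dots,2^k\}$ be an orthonormal wavelet basis of $L_2[0,1]$ of Cohen–Daubechies–Vial type, consisting of $S$-Hölder continuous functions for some $S>\max\{\alpha,\beta\}$, which is a Schauder basis of $C[0,1]$ and such that there are constants $C_1,C_2>0$ with: $|\psi_{kl}(x)-\psi_{kl}(y)|\le C_12^{\frac k2+k\vartheta}|x-y|^\vartheta$ for $\vartheta\le S\wedge1$; and $\|\sum_{l=1}^{2^k}u_{kl}\psi_{kl}\|_{L_\infty}\le C_22^{\frac k2}\sup_{1\le l\le2^k}|u_{kl}|$ for all coefficients. For $0<s<S$, $u=\sum_{k,l}u_{kl}\psi_{kl}$ belongs to $B^s_{\infty\infty}$ iff $\|u\|_{B^s_{\infty\infty}}=\sup_{k\ge0,1\le l\le2^k}2^{k(\frac12+s)}|u_{kl}|<\infty$. An $\alpha$-regular $p$-exponential random element in $C[0,1]$ is $W=\sum_{k=0}^\infty\sum_{l=1}^{2^k}2^{-(\frac12+\alpha)k}\xi_{kl}\psi_{kl}$, where $\xi_{kl}$ are i.i.d. real random variables with density proportional to $\exp(-|x|^p/p)$. $a\vee b=\max\{a,b\}$. *)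

theory Defs
  imports "HOL-Probability.Probability" "HOL-Library.Discrete_Functions"
begin

section \<open>Wavelet bases of the unit interval\<close>

text \<open>A doubly indexed system \<open>\<psi> k l\<close> is used for \<open>k \<in> {0, 1, \<dots>}\<close> and \<open>l \<in> {1..2^k}\<close>, and only
  its values on \<open>{0..1}\<close> matter. \<open>wav_seq \<psi>\<close> lists the system level by level: the pair
  \<open>(k, l)\<close> gets the number \<open>2^k - 1 + (l - 1)\<close>.\<close>

definition wav_seq :: "(nat \<Rightarrow> nat \<Rightarrow> real \<Rightarrow> real) \<Rightarrow> nat \<Rightarrow> real \<Rightarrow> real" where
  "wav_seq \<psi> n = \<psi> (floor_log (Suc n)) (Suc n - 2 ^ floor_log (Suc n) + 1)"

definition inner01 :: "(real \<Rightarrow> real) \<Rightarrow> (real \<Rightarrow> real) \<Rightarrow> real" where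
  "inner01 f g = set_lebesgue_integral lborel {0..1} (\<lambda>x. f x * g x)"

definition orthonormal_basis_L2 :: "(nat \<Rightarrow> real \<Rightarrow> real) \<Rightarrow> bool" where
  "orthonormal_basis_L2 e \<longleftrightarrow>
     (\<forall>m n. inner01 (e m) (e n) = (if m = n then 1 else 0)) \<and>
     (\<forall>f \<in> borel_measurable lborel. set_integrable lborel {0..1} (\<lambda>x. (f x)\<^sup>2) \<longrightarrow>
        (\<lambda>N. set_lebesgue_integral lborel {0..1}
                (\<lambda>x. (f x - (\<Sum>n<N. inner01 f (e n) * e n x))\<^sup>2)) \<longlonglongrightarrow> 0)"

definition schauder_basis_C01 :: "(nat \<Rightarrow> real \<Rightarrow> real) \<Rightarrow> bool" where
  "schauder_basis_C01 e \<longleftrightarrow>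
     (\<forall>n. continuous_on {0..1} (e n)) \<and>
     (\<forall>f. continuous_on {0..1} f \<longrightarrow>
        (\<exists>!a :: nat \<Rightarrow> real. uniform_limit {0..1} (\<lambda>N x. \<Sum>n<N. a n * e n x) f sequentially))"

text \<open>For \<open>S > 1\<close> the literal estimate \<open>\<bar>f x - f y\<bar> \<le> C * \<bar>x - y\<bar> powr S\<close> would only allow
  constants. As usual, \<open>S\<close>-Hoelder continuity means: with \<open>m\<close> the largest integer strictly below
  \<open>S\<close>, the function is \<open>m\<close> times differentiable (one-sidedly at the end points) and its \<open>m\<close>-th
  derivative is Hoelder continuous of exponent \<open>S - m \<in> (0, 1]\<close>.\<close>

definition holder_continuous01 :: "real \<Rightarrow> (real \<Rightarrow> real) \<Rightarrow> bool" where
  "holder_continuous01 S f \<longleftrightarrow>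
     (let m = nat (\<lceil>S\<rceil> - 1) in
      \<exists>(D :: nat \<Rightarrow> real \<Rightarrow> real) C.
        (\<forall>x\<in>{0..1}. D 0 x = f x) \<and>
        (\<forall>j<m. \<forall>x\<in>{0..1}. (D j has_real_derivative D (Suc j) x) (at x within {0..1})) \<and>
        (\<forall>x\<in>{0..1}. \<forall>y\<in>{0..1}. \<bar>D m x - D m y\<bar> \<le> C * \<bar>x - y\<bar> powr (S - real m)))"

text \<open>The properties of \<open>S\<close>-regular wavelet bases of Cohen--Daubechies--Vial type. The exponents
  \<open>\<theta>\<close> of the single-wavelet Hoelder estimate are positive.\<close>

definition CDV_wavelet_basis :: "real \<Rightarrow> (nat \<Rightarrow> nat \<Rightarrow> real \<Rightarrow> real) \<Rightarrow> bool" where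
  "CDV_wavelet_basis S \<psi> \<longleftrightarrow>
     orthonormal_basis_L2 (wav_seq \<psi>) \<and>
     schauder_basis_C01 (wav_seq \<psi>) \<and>
     (\<forall>k. \<forall>l\<in>{1..2^k}. holder_continuous01 S (\<psi> k l)) \<and>
     (\<exists>C1>0. \<forall>k. \<forall>l\<in>{1..2^k}. \<forall>\<theta>. 0 < \<theta> \<and> \<theta> \<le> min S 1 \<longrightarrow>
        (\<forall>x\<in>{0..1}. \<forall>y\<in>{0..1}.
           \<bar>\<psi> k l x - \<psi> k l y\<bar> \<le> C1 * 2 powr (real k / 2 + real k * \<theta>) * \<bar>x - y\<bar> powr \<theta>)) \<and>
     (\<exists>C2>0. \<forall>k. \<forall>u :: nat \<Rightarrow> real. \<forall>x\<in>{0..1}.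
        \<bar>\<Sum>l=1..2^k. u l * \<psi> k l x\<bar> \<le> C2 * 2 powr (real k / 2) * (MAX l\<in>{1..2^k}. \<bar>u l\<bar>))"

text \<open>For \<open>s > 0\<close> every wavelet series with finite norm converges uniformly, so the elements of the
  Besov space are continuous functions. They are taken as honest functions, not as Lebesgue classes,
  because they are evaluated under dominating measures that may be singular.\<close>

definition besov_norm :: "(nat \<Rightarrow> nat \<Rightarrow> real \<Rightarrow> real) \<Rightarrow> real \<Rightarrow> (real \<Rightarrow> real) \<Rightarrow> ereal" where
  "besov_norm \<psi> s u =
     (SUP (k, l) \<in> (SIGMA k:UNIV. {1..2^k}).
        ereal (2 powr (real k * (1/2 + s)) * \<bar>inner01 u (\<psi> k l)\<bar>))"

definition besov_space :: "(nat \<Rightarrow> nat \<Rightarrow> real \<Rightarrow> real) \<Rightarrow> real \<Rightarrow> (real \<Rightarrow> real) set" where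
  "besov_space \<psi> s = {u. continuous_on {0..1} u \<and> besov_norm \<psi> s u < \<infinity>}"


section \<open>p-exponential random elements\<close>

definition p_exponential_density :: "real \<Rightarrow> real \<Rightarrow> real" where
  "p_exponential_density p x =
     exp (- (\<bar>x\<bar> powr p / p)) / (\<integral>y. exp (- (\<bar>y\<bar> powr p / p)) \<partial>lborel)"

text \<open>The measurable space \<open>C[0,1]\<close>, with functions extensional on \<open>{0..1}\<close>. The trace of the product
  sigma-algebra on the continuous functions is the Borel sigma-algebra of the supremum norm.\<close>

definition C01 :: "(real \<Rightarrow> real) measure" where
  "C01 = restrict_space (\<Pi>\<^sub>M x\<in>{0..1}. borel) {f. continuous_on {0..1} f}"

definition p_exponential_element ::
  "'a measure \<Rightarrow> real \<Rightarrow> real \<Rightarrow> (nat \<Rightarrow> nat \<Rightarrow> real \<Rightarrow> real) \<Rightarrow> ('a \<Rightarrow> real \<Rightarrow> real) \<Rightarrow> bool" where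
  "p_exponential_element P \<alpha> p \<psi> W \<longleftrightarrow>
     prob_space P \<and> W \<in> P \<rightarrow>\<^sub>M C01 \<and>
     (\<exists>\<xi> :: nat \<Rightarrow> nat \<Rightarrow> 'a \<Rightarrow> real.
        prob_space.indep_vars P (\<lambda>_. borel) (\<lambda>(k, l). \<xi> k l) (SIGMA k:UNIV. {1..2^k}) \<and>
        (\<forall>k. \<forall>l\<in>{1..2^k}.
           distributed P lborel (\<xi> k l) (\<lambda>x. ennreal (p_exponential_density p x))) \<and>
        (AE \<omega> in P. uniform_limit {0..1}
           (\<lambda>K x. \<Sum>k<K. \<Sum>l=1..2^k. 2 powr (- (1/2 + \<alpha>) * real k) * \<xi> k l \<omega> * \<psi> k l x)
           (W \<omega>) sequentially))"


section \<open>Density estimation\<close>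

definition density_prior ::
  "'a measure \<Rightarrow> real measure \<Rightarrow> ('a \<Rightarrow> real \<Rightarrow> real) \<Rightarrow> (real \<Rightarrow> real) measure" where
  "density_prior P \<nu> W =
     distr P C01 (\<lambda>\<omega>. \<lambda>x\<in>{0..1}. exp (W \<omega> x) / (\<integral>y. exp (W \<omega> y) \<partial>\<nu>))"

definition likelihood :: "nat \<Rightarrow> (nat \<Rightarrow> real) \<Rightarrow> (real \<Rightarrow> real) \<Rightarrow> real" where
  "likelihood n X f = (\<Prod>i\<in>{1..n}. f (X i))"

text \<open>The version of the posterior given by Bayes' formula.\<close>

definition posterior ::
  "(real \<Rightarrow> real) measure \<Rightarrow> nat \<Rightarrow> (nat \<Rightarrow> real) \<Rightarrow> (real \<Rightarrow> real) measure" where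
  "posterior Q n X =
     density Q (\<lambda>f. ennreal (likelihood n X f) / (\<integral>\<^sup>+g. ennreal (likelihood n X g) \<partial>Q))"

definition sample_distribution :: "real measure \<Rightarrow> (real \<Rightarrow> real) \<Rightarrow> nat \<Rightarrow> (nat \<Rightarrow> real) measure" where
  "sample_distribution \<nu> f n = (\<Pi>\<^sub>M i\<in>{1..n}. density \<nu> (\<lambda>x. ennreal (f x)))"

definition hellinger :: "real measure \<Rightarrow> (real \<Rightarrow> real) \<Rightarrow> (real \<Rightarrow> real) \<Rightarrow> real" where
  "hellinger \<nu> f g = sqrt (\<integral>x. (sqrt (f x) - sqrt (g x))\<^sup>2 \<partial>\<nu>)"

definition rho :: "real \<Rightarrow> real \<Rightarrow> real \<Rightarrow> nat \<Rightarrow> real" where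
  "rho \<alpha> \<beta> p n =
     (if \<beta> \<le> \<alpha> then real n powr (- (\<beta> / (1 + 2 * \<beta> + p * (\<alpha> - \<beta>))))
      else real n powr (- (\<alpha> / (1 + 2 * \<alpha>))))"

definition rho_tilde :: "real \<Rightarrow> real \<Rightarrow> real \<Rightarrow> nat \<Rightarrow> real" where
  "rho_tilde \<alpha> \<beta> p n =
     (if \<beta> \<le> \<alpha> then
        real n powr ((2 - p) * (1 - 2 * \<alpha>) / (8 * \<alpha>)
                     - p * \<beta> / (2 * (1 + 2 * \<beta> + p * (\<alpha> - \<beta>))))
      else real n powr ((2 - p - 8 * \<alpha>\<^sup>2) / (8 * \<alpha> * (1 + 2 * \<alpha>))))"

end

theory Submission
  imports Defs "HOL-Real_Asymp.Real_Asymp"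
begin

text \<open>
  Both rates depend on \<open>\<beta>\<close> only through \<open>b = min \<alpha> \<beta>\<close>, and the posterior contracts already at rate
  \<open>\<rho>\<close>. Let \<open>2\<^sup>J\<close> be of order \<open>n powr (1 / m)\<close> with \<open>m = 1 + 2 b + p (\<alpha> - b)\<close>, so that \<open>2 powr (- b J)\<close> is of order \<open>\<rho>\<close> and
  \<open>n \<rho>\<^sup>2\<close> dominates \<open>2\<^sup>J\<close>. The coordinates \<open>\<xi>\<^sub>k\<^sub>l\<close> are rounded to multiples of thresholds \<open>\<tau>\<^sub>k\<close> chosen such
  that rounding moves \<open>W\<close> by \<open>O(\<rho>)\<close> in supremum norm. No sieve and no entropy bound are needed:
  since the prior is a product measure, the sum of \<open>sqrt (\<Pi> A)\<close> over the cells \<open>A\<close> is a product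
  of one-dimensional sums, and it is at most \<open>exp (O (2\<^sup>J))\<close>. If a cell contains a density at Hellinger
  distance \<open>d > M \<rho>\<close> from \<open>\<pi>\<^sub>0\<close>, then with \<open>T\<close> the square root of its likelihood ratio, the
  integral \<open>L A\<close> of the likelihood ratio over the cell satisfies
  \<open>sqrt (L A) \<le> s T + L A / (s T)\<close> with \<open>s = sqrt (\<Pi> A)\<close>, which has mean at most
  \<open>2 s exp (- n d\<^sup>2 / 4)\<close>. The denominator of the posterior is at least \<open>exp (- O (n \<rho>\<^sup>2))\<close> because
  small balls have prior mass \<open>exp (- O (n \<rho>\<^sup>2))\<close> and the inverse likelihood ratio has mean
  \<open>exp (O (n \<rho>\<^sup>2))\<close> on them.
\<close>

section \<open>Sums over resolution levels\<close>

text \<open>The number \<open>m\<close> comes from a balance. In the scale of \<open>\<xi>\<close>,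
  a coefficient of \<open>ln \<pi>0\<close> at level \<open>k\<close> may have the order
  \<open>2 powr ((\<alpha> - b) * k)\<close>, and centring a p-exponential variable there costs its
  p-th power in the log-probability. So a ball of radius of order \<open>2 powr (- b * J)\<close>
  costs an exponent of order \<open>2 powr (J * (1 + p * (\<alpha> - b)))\<close>. Equating this
  with \<open>n * 2 powr (- 2 * b * J)\<close> gives \<open>2 ^ J = n powr (1 / m)\<close>.

  The obstacle is that there are infinitely many coordinates and, as \<open>p\<close> may be 1, only
  exponential tails. Beyond \<open>J\<close> the thresholds must grow so fast that nearly all
  coordinates round to 0 and each one-dimensional sum is 1 plus a doubly exponentially small term,
  yet slowly enough for the supremum norm errors to be summable. The damping
  \<open>\<beta> / 2 * \<bar>k - J\<bar>\<close> in \<open>threshold\<close> achieves both.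
  Weighting cells by the square root of their prior mass, instead of counting them, makes remote
  cells cheap, so the range of the rounding indices can be arbitrarily large at no cost.\<close>

lemma sum_around_le:
  fixes a b :: "nat \<Rightarrow> real"
  assumes a: "summable a" "\<And>i. 0 \<le> a i" and b: "summable b" "\<And>i. 0 \<le> b i"
  shows "(\<Sum>k<N. if k \<le> J then a (J - k) else b (k - J)) \<le> suminf a + suminf b"
proof -
  have "(\<Sum>k<N. if k \<le> J then a (J - k) else b (k - J)) \<le>
      (\<Sum>k<N. (if k \<le> J then a (J - k) else 0) + (if J < k then b (k - J) else 0))"
    by (intro sum_mono) auto
  also have "\<dots> = (\<Sum>k\<in>{k. k < N \<and> k \<le> J}. a (J - k)) + (\<Sum>k\<in>{k. k < N \<and> J < k}. b (k - J))"
    unfolding sum.distrib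
    by (intro arg_cong2[where f = "(+)"] sum.mono_neutral_cong_right) auto
  also have "(\<Sum>k\<in>{k. k < N \<and> k \<le> J}. a (J - k)) = sum a ((\<lambda>k. J - k) ` {k. k < N \<and> k \<le> J})"
    by (subst sum.reindex) (auto simp: inj_on_def)
  also have "\<dots> \<le> suminf a"
    by (rule sum_le_suminf) (use a in auto)
  also have "(\<Sum>k\<in>{k. k < N \<and> J < k}. b (k - J)) = sum b ((\<lambda>k. k - J) ` {k. k < N \<and> J < k})"
    by (subst sum.reindex) (auto simp: inj_on_def)
  also have "\<dots> \<le> suminf b"
    by (rule sum_le_suminf) (use b in auto)
  finally show ?thesis by simp
qed

lemma summable_exp_neg_powr:
  fixes c :: real
  assumes "0 < c"
  shows "summable (\<lambda>i::nat. 2 ^ i * exp (- (2 powr (c * real i)) / 4))"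
proof (rule summable_comparison_test_bigo)
  show "summable (\<lambda>i::nat. norm ((1/2) ^ i :: real))" by (simp add: summable_geometric)
  show "(\<lambda>i::nat. 2 ^ i * exp (- (2 powr (c * real i)) / 4)) \<in> O(\<lambda>i. (1/2) ^ i)"
    using assms by real_asymp
qed

text \<open>Adds up the exponents of all coordinates, \<open>2 ^ k\<close> of them at level
  \<open>k\<close>. Below \<open>J\<close> the cost is linear in \<open>J - k\<close>, like the
  logarithm of a reciprocal threshold, and the weights \<open>2 ^ k\<close> bring the total to order
  \<open>2 ^ J\<close>. Above \<open>J\<close> the doubly exponential decay beats
  \<open>2 ^ (k - J)\<close>. The factor \<open>E\<close> is 1 for the cells and
  \<open>2 powr (p * (\<alpha> - \<beta>) * J)\<close> for small balls; the 1/4 is dictated by the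
  cell weights in \<open>coordinate_cells\<close>.\<close>

lemma level_sum_bound:
  fixes c :: real
  assumes "0 < c"
  obtains C where "0 < C" and "\<And>J N E h. 1 \<le> E \<Longrightarrow>
      (\<And>k. k \<le> J \<Longrightarrow> h k \<le> E * (1 + real (J - k))) \<Longrightarrow>
      (\<And>k. J < k \<Longrightarrow> h k \<le> exp (- (2 powr (c * real (k - J))) / 4)) \<Longrightarrow>
      (\<Sum>k<N. 2 ^ k * h k) \<le> C * 2 ^ J * E"
proof
  define a where "a i = (1 + real i) / 2 ^ i" for i :: nat
  define b where "b i = 2 ^ i * exp (- (2 powr (c * real i)) / 4)" for i :: nat
  have a: "summable a" "\<And>i. 0 \<le> a i"
    using sums_summable[OF geometric_deriv_sums[of "1/2::real"]]
    by (auto simp: a_def[abs_def] divide_simps power_one_over)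
  have b: "summable b" "\<And>i. 0 \<le> b i"
    unfolding b_def[abs_def] using summable_exp_neg_powr[OF assms] by auto
  show "0 < suminf a + suminf b"
    by (intro add_pos_nonneg suminf_pos2[where i = 0] suminf_nonneg a b) (simp add: a_def)
  fix J N :: nat and E :: real and h :: "nat \<Rightarrow> real"
  assume E: "1 \<le> E" and h1: "\<And>k. k \<le> J \<Longrightarrow> h k \<le> E * (1 + real (J - k))"
    and h2: "\<And>k. J < k \<Longrightarrow> h k \<le> exp (- (2 powr (c * real (k - J))) / 4)"
  have "(\<Sum>k<N. 2 ^ k * h k) \<le> (\<Sum>k<N. (2 ^ J * E) * (if k \<le> J then a (J - k) else b (k - J)))"
  proof (intro sum_mono)
    fix k
    show "2 ^ k * h k \<le> (2 ^ J * E) * (if k \<le> J then a (J - k) else b (k - J))"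
    proof (cases "k \<le> J")
      case True
      then have "(2::real) ^ J = 2 ^ k * 2 ^ (J - k)" by (simp flip: power_add)
      then show ?thesis using True h1[OF True] by (simp add: a_def mult_ac)
    next
      case False
      then have "(2::real) ^ k = 2 ^ J * 2 ^ (k - J)" by (simp flip: power_add)
      moreover have "exp (- (2 powr (c * real (k - J))) / 4) \<le> E * exp (- (2 powr (c * real (k - J))) / 4)"
        using mult_right_mono[OF E, of "exp (- (2 powr (c * real (k - J))) / 4)"] by simp
      then have "h k \<le> E * exp (- (2 powr (c * real (k - J))) / 4)"
        using h2[of k] False by linarith
      ultimately show ?thesis using False by (simp add: b_def mult_ac)
    qed
  qed
  also have "\<dots> \<le> (2 ^ J * E) * (suminf a + suminf b)"
    unfolding sum_distrib_left[symmetric]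
    by (intro mult_left_mono sum_around_le a b) (use E in auto)
  finally show "(\<Sum>k<N. 2 ^ k * h k) \<le> (suminf a + suminf b) * 2 ^ J * E" by (simp add: mult_ac)
qed

lemma geometric_level_sum_bound:
  fixes c :: real
  assumes "0 < c"
  obtains C where "0 < C" and
    "\<And>J N. (\<Sum>k<N. 2 powr (- c * \<bar>real k - real J\<bar>)) \<le> C"
proof
  define a where "a i = (2 powr (- c)) ^ i" for i :: nat
  have lt: "2 powr (- c) < 1" using assms by (simp add: powr_less_one)
  have a: "summable a" "\<And>i. 0 \<le> a i"
    unfolding a_def[abs_def] using lt by (auto intro!: summable_geometric)
  show "0 < suminf a + suminf a"
    by (intro add_pos_nonneg suminf_pos2[where i = 0] suminf_nonneg a) (simp add: a_def)
  fix J N :: nat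
  have "(\<Sum>k<N. 2 powr (- c * \<bar>real k - real J\<bar>)) = (\<Sum>k<N. if k \<le> J then a (J - k) else a (k - J))"
    by (intro sum.cong) (auto simp: a_def powr_power of_nat_diff abs_if algebra_simps)
  also have "\<dots> \<le> suminf a + suminf a" by (rule sum_around_le[OF a a])
  finally show "(\<Sum>k<N. 2 powr (- c * \<bar>real k - real J\<bar>)) \<le> suminf a + suminf a" .
qed

section \<open>The p-exponential distribution\<close>

text \<open>A weak form of Young's inequality, which reduces the tails for all
  \<open>p \<ge> 1\<close> to exponential ones. Linearise the second factor of
  \<open>y powr p = y * exp ((p - 1) * ln y)\<close> and use
  \<open>y * ln y \<ge> y - 1\<close>.\<close>

lemma abs_le_powr_div:
  fixes p x :: real
  assumes "1 \<le> p"
  shows "\<bar>x\<bar> - 1 \<le> \<bar>x\<bar> powr p / p"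
proof (cases "\<bar>x\<bar> \<le> 1")
  case False
  define y where "y = \<bar>x\<bar>"
  have y: "1 < y" using False by (simp add: y_def)
  have "1 - 1 / y \<le> ln y" using ln_le_minus_one[of "1 / y"] y by (simp add: ln_div)
  then have "y - 1 \<le> y * ln y" using y mult_left_mono[of "1 - 1 / y" "ln y" y] by (simp add: algebra_simps)
  then have "(p - 1) * (y - 1) \<le> (p - 1) * (y * ln y)" using assms by (intro mult_left_mono) auto
  then have "p * (y - 1) \<le> y * (1 + (p - 1) * ln y)" by (simp add: algebra_simps)
  also have "\<dots> \<le> y * exp ((p - 1) * ln y)" using y by (intro mult_left_mono exp_ge_add_one_self) auto
  also have "\<dots> = y powr p" using y by (simp add: powr_def left_diff_distrib exp_diff)
  finally show ?thesis using assms by (simp add: y_def field_simps)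
next
  case True
  have "0 \<le> \<bar>x\<bar> powr p / p" using assms by simp
  then show ?thesis using True by linarith
qed

definition p_exponential_normalizer :: "real \<Rightarrow> real" where
  "p_exponential_normalizer p = (\<integral>y. exp (- (\<bar>y\<bar> powr p / p)) \<partial>lborel)"

lemma p_exponential_density_eq:
  "p_exponential_density p x = exp (- (\<bar>x\<bar> powr p / p)) / p_exponential_normalizer p"
  by (simp add: p_exponential_density_def p_exponential_normalizer_def)

text \<open>No integrability proof is required: if the integral had the value 0, by divergence or
  otherwise, division by zero would make the density identically 0, and no random variable has such
  a density.\<close>

lemma p_exponential_normalizer_pos:
  assumes "prob_space P" "distributed P lborel X (\<lambda>x. ennreal (p_exponential_density p x))"
  shows "0 < p_exponential_normalizer p"
proof -
  interpret prob_space P by fact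
  have "0 \<le> p_exponential_normalizer p"
    unfolding p_exponential_normalizer_def by (intro Bochner_Integration.integral_nonneg) auto
  moreover have "p_exponential_normalizer p \<noteq> 0"
  proof
    assume 0: "p_exponential_normalizer p = 0"
    have "emeasure P (X -` UNIV \<inter> space P) = 0"
      using distributed_emeasure[OF assms(2), of UNIV] by (simp add: p_exponential_density_eq 0)
    then show False by (simp add: emeasure_space_1)
  qed
  ultimately show ?thesis by simp
qed

lemma nn_integral_exp_neg_abs_tail:
  "(\<integral>\<^sup>+x. ennreal (exp (- \<bar>x\<bar>)) * indicator {x. t \<le> \<bar>x\<bar>} x \<partial>lborel) \<le> ennreal (2 * exp (- t))"
proof -
  have *: "(\<integral>\<^sup>+x. ennreal (exp (- x)) * indicator {t..} x \<partial>lborel) = ennreal (exp (- t))"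
  proof -
    have "((\<lambda>x::real. - exp (- x)) \<longlongrightarrow> 0) at_top" by real_asymp
    moreover have "((\<lambda>x. - exp (- x)) has_real_derivative exp (- x)) (at x)" for x :: real
      by (auto intro!: derivative_eq_intros)
    ultimately show ?thesis
      using nn_integral_FTC_atLeast[of "\<lambda>x. exp (- x)" t "\<lambda>x. - exp (- x)" 0] by simp
  qed
  have "(\<integral>\<^sup>+x. ennreal (exp (- \<bar>x\<bar>)) * indicator {x. t \<le> \<bar>x\<bar>} x \<partial>lborel) \<le>
      (\<integral>\<^sup>+x. ennreal (exp (- x)) * indicator {t..} x + ennreal (exp (- (- x))) * indicator {t..} (- x) \<partial>lborel)"
    by (intro nn_integral_mono) (auto simp: indicator_def abs_if)
  also have "\<dots> = (\<integral>\<^sup>+x. ennreal (exp (- x)) * indicator {t..} x \<partial>lborel) +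
      (\<integral>\<^sup>+x. ennreal (exp (- (- x))) * indicator {t..} (- x) \<partial>lborel)"
    by (rule nn_integral_add) auto
  also have "(\<integral>\<^sup>+x. ennreal (exp (- (- x))) * indicator {t..} (- x) \<partial>lborel) =
      (\<integral>\<^sup>+x. ennreal (exp (- x)) * indicator {t..} x \<partial>lborel)"
    by (subst (2) nn_integral_real_affine[where c = "-1" and t = 0]) auto
  finally show ?thesis unfolding * by (simp flip: ennreal_plus)
qed

lemma p_exponential_tail:
  assumes "1 \<le> p" and P: "prob_space P" and X: "distributed P lborel X (\<lambda>x. ennreal (p_exponential_density p x))"
  shows "measure P {\<omega> \<in> space P. t \<le> \<bar>X \<omega>\<bar>} \<le> 2 * exp 1 / p_exponential_normalizer p * exp (- t)"
proof -
  interpret prob_space P by fact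
  define Z where "Z = p_exponential_normalizer p"
  have Z: "0 < Z" unfolding Z_def by (rule p_exponential_normalizer_pos[OF P X])
  have "emeasure P (X -` {x. t \<le> \<bar>x\<bar>} \<inter> space P)
      = (\<integral>\<^sup>+x. ennreal (p_exponential_density p x) * indicator {x. t \<le> \<bar>x\<bar>} x \<partial>lborel)"
    by (rule distributed_emeasure[OF X]) simp
  also have "\<dots> \<le> (\<integral>\<^sup>+x. ennreal (exp 1 / Z) * (ennreal (exp (- \<bar>x\<bar>)) * indicator {x. t \<le> \<bar>x\<bar>} x) \<partial>lborel)"
  proof (intro nn_integral_mono)
    fix x :: real
    have "exp (- (\<bar>x\<bar> powr p / p)) \<le> exp (1 - \<bar>x\<bar>)"
      using abs_le_powr_div[OF assms(1), of x] by simp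
    then have "p_exponential_density p x \<le> exp 1 / Z * exp (- \<bar>x\<bar>)"
      using Z by (simp add: p_exponential_density_eq Z_def divide_right_mono flip: exp_add)
    then show "ennreal (p_exponential_density p x) * indicator {x. t \<le> \<bar>x\<bar>} x
        \<le> ennreal (exp 1 / Z) * (ennreal (exp (- \<bar>x\<bar>)) * indicator {x. t \<le> \<bar>x\<bar>} x)"
      using Z by (simp add: ennreal_leI mult_right_mono flip: ennreal_mult mult.assoc)
  qed
  also have "\<dots> = ennreal (exp 1 / Z) * (\<integral>\<^sup>+x. ennreal (exp (- \<bar>x\<bar>)) * indicator {x. t \<le> \<bar>x\<bar>} x \<partial>lborel)"
    by (rule nn_integral_cmult) auto
  also have "\<dots> \<le> ennreal (exp 1 / Z) * ennreal (2 * exp (- t))"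
    by (intro mult_left_mono nn_integral_exp_neg_abs_tail) auto
  also have "\<dots> = ennreal (2 * exp 1 / Z * exp (- t))" using Z by (simp flip: ennreal_mult)
  finally have "ennreal (measure P (X -` {x. t \<le> \<bar>x\<bar>} \<inter> space P)) \<le> ennreal (2 * exp 1 / Z * exp (- t))"
    by (simp add: emeasure_eq_measure)
  moreover have "X -` {x. t \<le> \<bar>x\<bar>} \<inter> space P = {\<omega> \<in> space P. t \<le> \<bar>X \<omega>\<bar>}" by auto
  ultimately show ?thesis using Z by (simp add: Z_def)
qed

text \<open>On an interval of length \<open>2 powr (- l) \<le> 1\<close> starting at
  \<open>a\<close>, the density is at least its value at \<open>\<bar>a\<bar> + 1\<close>. The
  length contributes \<open>l\<close> to the exponent and the location
  \<open>\<bar>a\<bar> powr p\<close>. The radius is written as a power of 2 because summation over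
  levels wants a cost linear in \<open>l\<close>.\<close>

lemma p_exponential_interval:
  assumes "1 \<le> p" and P: "prob_space P" and X: "distributed P lborel X (\<lambda>x. ennreal (p_exponential_density p x))"
    and "0 \<le> l" "2 powr (- l) \<le> t"
  shows "exp (- ((1 + 2 powr p + \<bar>ln (p_exponential_normalizer p)\<bar>) * (1 + l + \<bar>a\<bar> powr p)))
    \<le> measure P {\<omega> \<in> space P. \<bar>X \<omega> - a\<bar> \<le> t}"
proof -
  interpret prob_space P by fact
  define Z where "Z = p_exponential_normalizer p"
  have Z: "0 < Z" unfolding Z_def by (rule p_exponential_normalizer_pos[OF P X])
  define s where "s = 2 powr (- l)"
  have s: "0 < s" "s \<le> 1" using assms by (auto simp: s_def powr_minus divide_simps intro!: ge_one_powr_ge_zero)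
  define y where "y = \<bar>a\<bar> powr p"
  have y: "0 \<le> y" by (simp add: y_def)
  define K where "K = exp (- ((\<bar>a\<bar> + 1) powr p / p)) / Z"
  have K: "0 < K" using Z by (simp add: K_def)
  have "ennreal (K * s) = (\<integral>\<^sup>+x. ennreal K * indicator {a..a + s} x \<partial>lborel)"
    using s K by (simp add: nn_integral_cmult_indicator ennreal_mult)
  also have "\<dots> \<le> (\<integral>\<^sup>+x. ennreal (p_exponential_density p x) * indicator {x. \<bar>x - a\<bar> \<le> t} x \<partial>lborel)"
  proof (intro nn_integral_mono)
    fix x
    show "ennreal K * indicator {a..a + s} x \<le> ennreal (p_exponential_density p x) * indicator {x. \<bar>x - a\<bar> \<le> t} x"
    proof (cases "x \<in> {a..a + s}")
      case True
      then have "\<bar>x\<bar> powr p \<le> (\<bar>a\<bar> + 1) powr p" using s assms by (intro powr_mono2) auto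
      then have "K \<le> p_exponential_density p x"
        using Z assms by (auto simp: K_def p_exponential_density_eq Z_def intro!: divide_right_mono)
      moreover have "\<bar>x - a\<bar> \<le> t" using True assms by (auto simp: s_def)
      ultimately show ?thesis using True by (auto intro: ennreal_leI)
    qed auto
  qed
  also have "\<dots> = emeasure P (X -` {x. \<bar>x - a\<bar> \<le> t} \<inter> space P)"
    by (rule distributed_emeasure[OF X, symmetric]) simp
  also have "X -` {x. \<bar>x - a\<bar> \<le> t} \<inter> space P = {\<omega> \<in> space P. \<bar>X \<omega> - a\<bar> \<le> t}" by auto
  finally have *: "K * s \<le> measure P {\<omega> \<in> space P. \<bar>X \<omega> - a\<bar> \<le> t}"
    by (simp add: emeasure_eq_measure)
  have "(\<bar>a\<bar> + 1) powr p \<le> (2 * max \<bar>a\<bar> 1) powr p" using assms by (intro powr_mono2) auto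
  also have "\<dots> = 2 powr p * (max \<bar>a\<bar> 1) powr p" by (simp add: powr_mult)
  also have "(max \<bar>a\<bar> 1) powr p \<le> y + 1" by (auto simp: max_def y_def)
  finally have "(\<bar>a\<bar> + 1) powr p / p \<le> 2 powr p * (y + 1) / 1"
    using assms y by (intro frac_le) auto
  moreover have "2 powr p * (y + 1) \<le> 2 powr p * (1 + l + y)" using assms by (intro mult_left_mono) auto
  ultimately have 1: "(\<bar>a\<bar> + 1) powr p / p \<le> 2 powr p * (1 + l + y)"
    unfolding div_by_1 by (rule order_trans)
  have 2: "ln Z \<le> \<bar>ln Z\<bar> * (1 + l + y)"
    using assms y mult_left_mono[of 1 "1 + l + y" "\<bar>ln Z\<bar>"] by simp
  have "l * ln 2 \<le> l * 1" using assms ln_2_less_1 by (intro mult_left_mono) auto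
  then have 3: "l * ln 2 \<le> 1 * (1 + l + y)" using y by simp
  have "(\<bar>a\<bar> + 1) powr p / p + ln Z + l * ln 2
      \<le> 2 powr p * (1 + l + y) + \<bar>ln Z\<bar> * (1 + l + y) + 1 * (1 + l + y)"
    by (intro add_mono 1 2 3)
  also have "\<dots> = (1 + 2 powr p + \<bar>ln Z\<bar>) * (1 + l + y)" by (simp add: algebra_simps)
  finally have "(\<bar>a\<bar> + 1) powr p / p + ln Z + l * ln 2 \<le> (1 + 2 powr p + \<bar>ln Z\<bar>) * (1 + l + y)" .
  then have "exp (- ((1 + 2 powr p + \<bar>ln Z\<bar>) * (1 + l + y))) \<le> exp (- ((\<bar>a\<bar> + 1) powr p / p + ln Z + l * ln 2))"
    by simp
  also have "\<dots> = K * s" using Z by (simp add: K_def s_def powr_def exp_add exp_diff exp_minus field_simps)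
  finally show ?thesis using * by (simp add: Z_def y_def)
qed

text \<open>The second bound is the one that admits infinitely many coordinates: its exponent tends
  to 0 as \<open>t\<close> grows, whereas the third costs at least a constant for each
  coordinate.\<close>

lemma p_exponential_bounds:
  assumes "1 \<le> p" and P: "prob_space P"
  obtains C where "0 < C"
    and "\<And>X t. distributed P lborel X (\<lambda>x. ennreal (p_exponential_density p x)) \<Longrightarrow>
        measure P {\<omega> \<in> space P. t \<le> \<bar>X \<omega>\<bar>} \<le> C * exp (- t)"
    and "\<And>X t. distributed P lborel X (\<lambda>x. ennreal (p_exponential_density p x)) \<Longrightarrow> 1 \<le> t \<Longrightarrow>
        exp (- (C * exp (- t))) \<le> measure P {\<omega> \<in> space P. \<bar>X \<omega>\<bar> \<le> t}"
    and "\<And>X a l t. distributed P lborel X (\<lambda>x. ennreal (p_exponential_density p x)) \<Longrightarrow>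
        0 \<le> l \<Longrightarrow> 2 powr (- l) \<le> t \<Longrightarrow>
        exp (- (C * (1 + l + \<bar>a\<bar> powr p))) \<le> measure P {\<omega> \<in> space P. \<bar>X \<omega> - a\<bar> \<le> t}"
proof -
  interpret prob_space P by fact
  define C1 where "C1 = max 1 (2 * exp 1 / p_exponential_normalizer p)"
  define C2 where "C2 = 1 + 2 powr p + \<bar>ln (p_exponential_normalizer p)\<bar>"
  have C12: "1 \<le> C1" "1 \<le> C2" by (auto simp: C1_def C2_def)
  define C where "C = max C2 (C1 * exp C2)"
  have C: "C2 \<le> C" "C1 * exp C2 \<le> C" by (auto simp: C_def)
  have "C1 * 1 \<le> C1 * exp C2" using C12 by (intro mult_left_mono) auto
  then have C': "C1 \<le> C" using C by linarith
  have tail: "measure P {\<omega> \<in> space P. t \<le> \<bar>X \<omega>\<bar>} \<le> C1 * exp (- t)"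
    if X: "distributed P lborel X (\<lambda>x. ennreal (p_exponential_density p x))" for X t
  proof -
    have "2 * exp 1 / p_exponential_normalizer p * exp (- t) \<le> C1 * exp (- t)"
      unfolding C1_def by (intro mult_right_mono) auto
    then show ?thesis using p_exponential_tail[OF assms X, of t] by linarith
  qed
  have int: "exp (- (C2 * (1 + l + \<bar>a\<bar> powr p))) \<le> measure P {\<omega> \<in> space P. \<bar>X \<omega> - a\<bar> \<le> t}"
    if X: "distributed P lborel X (\<lambda>x. ennreal (p_exponential_density p x))" and "0 \<le> l" "2 powr (- l) \<le> t"
    for X a l t
    using p_exponential_interval[OF assms X that(2,3)] by (simp add: C2_def)
  show ?thesis
  proof (rule that[of C])
    show "0 < C" using C12 C by linarith
    fix X t assume X: "distributed P lborel X (\<lambda>x. ennreal (p_exponential_density p x))"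
    show "measure P {\<omega> \<in> space P. t \<le> \<bar>X \<omega>\<bar>} \<le> C * exp (- t)"
      using C' by (intro order_trans[OF tail[OF X]] mult_right_mono) auto
    have [measurable]: "X \<in> borel_measurable P" using distributed_measurable[OF X] by simp
    show "exp (- (C * exp (- t))) \<le> measure P {\<omega> \<in> space P. \<bar>X \<omega>\<bar> \<le> t}" if "1 \<le> t"
    proof -
      define y where "y = measure P {\<omega> \<in> space P. \<bar>X \<omega>\<bar> \<le> t}"
      have "exp (- C2) \<le> measure P {\<omega> \<in> space P. \<bar>X \<omega>\<bar> \<le> 1}"
        using int[OF X, of 0 1 0] by simp
      also have "\<dots> \<le> y" unfolding y_def using that by (intro finite_measure_mono) auto
      finally have y: "exp (- C2) \<le> y" .
      have y0: "0 < y" using y by (rule less_le_trans[rotated]) simp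
      have "1 - y = measure P {\<omega> \<in> space P. \<not> \<bar>X \<omega>\<bar> \<le> t}"
        unfolding y_def by (subst prob_neg) auto
      also have "\<dots> \<le> measure P {\<omega> \<in> space P. t \<le> \<bar>X \<omega>\<bar>}" by (intro finite_measure_mono) auto
      also have "\<dots> \<le> C1 * exp (- t)" by (rule tail[OF X])
      \<comment> \<open>As \<open>- ln y \<le> (1 - y) / y\<close>, the tail bound for
        \<open>1 - y\<close> is divided by \<open>y\<close>, which is at least
        \<open>exp (- C2)\<close>. Hence the factor \<open>exp C2\<close> in
        \<open>C\<close>.\<close>
      finally have "(1 - y) / y \<le> C1 * exp (- t) / exp (- C2)"
        using y C12 by (intro frac_le) (auto simp: y_def)
      also have "\<dots> = C1 * exp C2 * exp (- t)" by (simp add: exp_minus field_simps)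
      also have "\<dots> \<le> C * exp (- t)" using C by (intro mult_right_mono) auto
      finally have "1 - 1 / y \<ge> - (C * exp (- t))" using y0 by (simp add: diff_divide_distrib)
      moreover have "1 - 1 / y \<le> ln y" using ln_le_minus_one[of "1 / y"] y0 by (simp add: ln_div)
      ultimately have "exp (- (C * exp (- t))) \<le> exp (ln y)" by (intro iffD2[OF exp_le_cancel_iff]) linarith
      also have "\<dots> = y" using y0 by simp
      finally show ?thesis by (simp add: y_def)
    qed
    fix a l assume "0 \<le> l" "2 powr (- l) \<le> t"
    note int[OF X this, of a]
    moreover have "C2 * (1 + l + \<bar>a\<bar> powr p) \<le> C * (1 + l + \<bar>a\<bar> powr p)"
      using C \<open>0 \<le> l\<close> by (intro mult_right_mono) auto
    ultimately show "exp (- (C * (1 + l + \<bar>a\<bar> powr p))) \<le> measure P {\<omega> \<in> space P. \<bar>X \<omega> - a\<bar> \<le> t}"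
      by (meson exp_le_cancel_iff neg_le_iff_le order_trans)
  qed
qed

section \<open>Coordinates of the prior\<close>

text \<open>By the supremum norm bound for a single level, changing all coordinates at level \<open>k\<close> by at
  most the threshold changes the function by \<open>O(2 powr (- \<beta> J - \<beta> / 2 * \<bar>k - J\<bar>))\<close>, which sums over
  \<open>k\<close> to \<open>O(2 powr (- \<beta> J))\<close>.\<close>

definition threshold :: "real \<Rightarrow> real \<Rightarrow> nat \<Rightarrow> nat \<Rightarrow> real" where
  "threshold \<alpha> \<beta> J k = 2 powr (\<alpha> * real k - \<beta> * real J - \<beta> / 2 * \<bar>real k - real J\<bar>)"

lemma threshold_pos: "0 < threshold \<alpha> \<beta> J k"
  by (simp add: threshold_def)

text \<open>The exponent of the threshold is \<open>(\<alpha> - \<beta>) * J - (\<alpha> + \<beta> /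
  2) * (J - k)\<close>, and \<open>\<beta> \<le> \<alpha>\<close>. In this form the threshold enters
  \<open>p_exponential_bounds\<close> with \<open>l = 2 * \<alpha> * (J - k)\<close>. The
  \<open>\<beta>\<close> of these lemmas later becomes \<open>min \<alpha> \<beta>\<close>.\<close>

lemma threshold_low:
  assumes "0 < \<beta>" "\<beta> \<le> \<alpha>" "k \<le> J"
  shows "2 powr (- (2 * \<alpha> * real (J - k))) \<le> threshold \<alpha> \<beta> J k"
proof -
  have "(\<alpha> - \<beta>) * real J \<ge> 0" "(\<alpha> - \<beta> / 2) * real (J - k) \<ge> 0" using assms by auto
  then show ?thesis using assms
    by (simp add: threshold_def of_nat_diff abs_if algebra_simps)
qed

text \<open>The first bound makes the tails doubly exponentially small in \<open>k - J\<close>, the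
  second lets the threshold absorb the coefficients of \<open>ln \<pi>0\<close>, and the third keeps
  it in the range of the central bound of \<open>p_exponential_bounds\<close>.\<close>

lemma threshold_high:
  assumes "0 < \<beta>" "\<beta> \<le> \<alpha>" "J < k"
  shows "2 powr ((\<alpha> - \<beta> / 2) * real (k - J)) \<le> threshold \<alpha> \<beta> J k"
    and "2 powr ((\<alpha> - \<beta>) * real k) \<le> threshold \<alpha> \<beta> J k"
    and "1 \<le> threshold \<alpha> \<beta> J k"
proof -
  have 1: "0 \<le> (\<alpha> - \<beta>) * real J" "0 \<le> \<beta> / 2 * (real k - real J)" "0 \<le> (\<alpha> - \<beta> / 2) * real (k - J)"
    using assms by auto
  have eq: "\<alpha> * real k - \<beta> * real J - \<beta> / 2 * \<bar>real k - real J\<bar> =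
      (\<alpha> - \<beta> / 2) * real (k - J) + (\<alpha> - \<beta>) * real J"
    "\<alpha> * real k - \<beta> * real J - \<beta> / 2 * \<bar>real k - real J\<bar> =
      (\<alpha> - \<beta>) * real k + \<beta> / 2 * (real k - real J)"
    using assms by (auto simp: of_nat_diff field_simps)
  show *: "2 powr ((\<alpha> - \<beta> / 2) * real (k - J)) \<le> threshold \<alpha> \<beta> J k"
    unfolding threshold_def using 1 eq(1) by (intro powr_mono) auto
  show "2 powr ((\<alpha> - \<beta>) * real k) \<le> threshold \<alpha> \<beta> J k"
    unfolding threshold_def using 1 eq(2) by (intro powr_mono) auto
  have "1 \<le> 2 powr ((\<alpha> - \<beta> / 2) * real (k - J))"
    using 1 by (intro ge_one_powr_ge_zero) auto
  then show "1 \<le> threshold \<alpha> \<beta> J k" using * by linarith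
qed

section \<open>Small ball probabilities under the product prior\<close>

lemma indep_levels_finite:
  fixes \<xi> :: "nat \<Rightarrow> nat \<Rightarrow> 'a \<Rightarrow> real"
  assumes P: "prob_space P"
    and ind: "prob_space.indep_vars P (\<lambda>_. borel) (\<lambda>(k, l). \<xi> k l) (SIGMA k:UNIV. {1..2^k})"
    and A: "\<And>k l. A k l \<in> sets borel"
  shows "measure P {\<omega> \<in> space P. \<forall>k\<in>{..<N}. \<forall>l\<in>{1..2^k}. \<xi> k l \<omega> \<in> A k l} =
    (\<Prod>(k, l)\<in>(SIGMA k:{..<N}. {1..2^k}). measure P {\<omega> \<in> space P. \<xi> k l \<omega> \<in> A k l})"
proof (cases "N = 0")
  case True
  then show ?thesis using prob_space.prob_space[OF P] by simp
next
  case False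
  interpret prob_space P by fact
  let ?S = "SIGMA k:{..<N}. {1..2^k :: nat}"
  \<comment> \<open>The product rule for independent variables requires a nonempty index set, hence
    the separate case \<open>N = 0\<close>.\<close>
  have "(0, 1) \<in> ?S" using False by auto
  then have ne: "?S \<noteq> {}" by blast
  have fin: "finite ?S" by auto
  have "prob (\<Inter>i\<in>?S. (case i of (k, l) \<Rightarrow> \<xi> k l) -` (case i of (k, l) \<Rightarrow> A k l) \<inter> space P) =
      (\<Prod>i\<in>?S. prob ((case i of (k, l) \<Rightarrow> \<xi> k l) -` (case i of (k, l) \<Rightarrow> A k l) \<inter> space P))"
    by (rule indep_varsD[OF ind]) (use ne fin A in auto)
  also have "(\<Inter>i\<in>?S. (case i of (k, l) \<Rightarrow> \<xi> k l) -` (case i of (k, l) \<Rightarrow> A k l) \<inter> space P)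
      = {\<omega> \<in> space P. \<forall>k\<in>{..<N}. \<forall>l\<in>{1..2^k}. \<xi> k l \<omega> \<in> A k l}"
    using ne by auto
  also have "(\<Prod>i\<in>?S. prob ((case i of (k, l) \<Rightarrow> \<xi> k l) -` (case i of (k, l) \<Rightarrow> A k l) \<inter> space P)) =
      (\<Prod>(k, l)\<in>?S. prob {\<omega> \<in> space P. \<xi> k l \<omega> \<in> A k l})"
    by (intro prod.cong refl) (auto intro!: arg_cong[where f = prob])
  finally show ?thesis .
qed

text \<open>Continuity from above along the events \<open>G N\<close>, which constrain only the
  levels below \<open>N\<close>: their probabilities are finite products, bounded below uniformly in
  \<open>N\<close>.\<close>

lemma indep_levels_lower_bound:
  fixes \<xi> :: "nat \<Rightarrow> nat \<Rightarrow> 'a \<Rightarrow> real"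
  assumes P: "prob_space P"
    and ind: "prob_space.indep_vars P (\<lambda>_. borel) (\<lambda>(k, l). \<xi> k l) (SIGMA k:UNIV. {1..2^k})"
    and A: "\<And>k l. A k l \<in> sets borel"
    and h: "\<And>k l. l \<in> {1..2^k} \<Longrightarrow> exp (- h k) \<le> measure P {\<omega> \<in> space P. \<xi> k l \<omega> \<in> A k l}"
    and S: "\<And>N. (\<Sum>k<N. 2 ^ k * h k) \<le> S"
  shows "exp (- S) \<le> measure P {\<omega> \<in> space P. \<forall>k. \<forall>l\<in>{1..2^k}. \<xi> k l \<omega> \<in> A k l}"
proof -
  interpret prob_space P by fact
  have \<xi>m: "\<xi> k l \<in> borel_measurable P" if "l \<in> {1..2^k}" for k l
    using ind that unfolding indep_vars_def by force
  define G where "G N = {\<omega> \<in> space P. \<forall>k\<in>{..<N}. \<forall>l\<in>{1..2^k}. \<xi> k l \<omega> \<in> A k l}" for N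
  have "G N \<in> events" for N
  proof -
    have "{\<omega> \<in> space P. \<xi> k l \<omega> \<in> A k l} \<in> events" if "l \<in> {1..2^k}" for k l
      using \<xi>m[OF that] A by measurable
    then have "{\<omega> \<in> space P. \<forall>k\<in>{..<N}. \<forall>l\<in>{1..2^k}. \<xi> k l \<omega> \<in> A k l} \<in> events"
      by (intro sets.sets_Collect_finite_All) auto
    then show ?thesis unfolding G_def .
  qed
  moreover have "decseq G" by (auto simp: decseq_def G_def)
  ultimately have "(\<lambda>N. prob (G N)) \<longlonglongrightarrow> prob (\<Inter>N. G N)"
    by (intro finite_Lim_measure_decseq) auto
  moreover have "exp (- S) \<le> prob (G N)" for N
  proof -
    have "exp (- S) \<le> exp (- (\<Sum>k<N. 2 ^ k * h k))" using S by simp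
    also have "(\<Sum>k<N. 2 ^ k * h k) = (\<Sum>k<N. \<Sum>l=1..2^k::nat. h k)" by simp
    also have "\<dots> = (\<Sum>(k, l)\<in>(SIGMA k:{..<N}. {1..2^k::nat}). h k)" by (subst sum.Sigma) auto
    also have "exp (- \<dots>) = (\<Prod>(k, l)\<in>(SIGMA k:{..<N}. {1..2^k::nat}). exp (- h k))"
      by (simp add: exp_sum split_beta' flip: sum_negf)
    also have "\<dots> \<le> (\<Prod>(k, l)\<in>(SIGMA k:{..<N}. {1..2^k}). measure P {\<omega> \<in> space P. \<xi> k l \<omega> \<in> A k l})"
      by (intro prod_mono) (use h in auto)
    finally show ?thesis unfolding G_def indep_levels_finite[OF P ind A] .
  qed
  ultimately have "exp (- S) \<le> prob (\<Inter>N. G N)" by (intro LIMSEQ_le_const) auto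
  also have "(\<Inter>N. G N) = {\<omega> \<in> space P. \<forall>k. \<forall>l\<in>{1..2^k}. \<xi> k l \<omega> \<in> A k l}"
    by (auto simp: G_def)
  finally show ?thesis .
qed

text \<open>Up to level \<open>J\<close> each coordinate has to follow its centre
  \<open>a k l\<close>, at a cost that produces the exponent
  \<open>p * (\<alpha> - \<beta>)\<close>. Above \<open>J\<close> it suffices that
  \<open>\<xi> k l\<close> itself stays below the threshold, since \<open>a k l\<close> is at most
  \<open>B\<close> times the threshold there; this is the origin of the radius factor
  \<open>1 + B\<close>.\<close>

lemma small_ball_probability:
  fixes \<xi> :: "nat \<Rightarrow> nat \<Rightarrow> 'a \<Rightarrow> real"
  assumes ab: "0 < \<beta>" "\<beta> \<le> \<alpha>" and p: "1 \<le> p" and P: "prob_space P"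
    and ind: "prob_space.indep_vars P (\<lambda>_. borel) (\<lambda>(k, l). \<xi> k l) (SIGMA k:UNIV. {1..2^k})"
    and dist: "\<And>k l. l \<in> {1..2^k} \<Longrightarrow> distributed P lborel (\<xi> k l) (\<lambda>x. ennreal (p_exponential_density p x))"
    and B: "0 \<le> B" "\<And>k l. l \<in> {1..2^k} \<Longrightarrow> \<bar>a k l\<bar> \<le> B * 2 powr ((\<alpha> - \<beta>) * real k)"
  obtains C where "0 < C" and "\<And>J. exp (- (C * 2 powr (real J * (1 + p * (\<alpha> - \<beta>))))) \<le>
      measure P {\<omega> \<in> space P. \<forall>k. \<forall>l\<in>{1..2^k}. \<bar>\<xi> k l \<omega> - a k l\<bar> \<le> (1 + B) * threshold \<alpha> \<beta> J k}"
proof -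
  interpret prob_space P by fact
  define c where "c = \<alpha> - \<beta> / 2"
  have c: "0 < c" using ab by (simp add: c_def)
  obtain Cs where Cs: "0 < Cs" and level: "\<And>J N E h. 1 \<le> E \<Longrightarrow>
      (\<And>k. k \<le> J \<Longrightarrow> h k \<le> E * (1 + real (J - k))) \<Longrightarrow>
      (\<And>k. J < k \<Longrightarrow> h k \<le> exp (- (2 powr (c * real (k - J))) / 4)) \<Longrightarrow>
      (\<Sum>k<N. 2 ^ k * h k) \<le> Cs * 2 ^ J * E"
    by (rule level_sum_bound[OF c]) blast
  obtain C0 where C0: "0 < C0"
    and centre: "\<And>X t. distributed P lborel X (\<lambda>x. ennreal (p_exponential_density p x)) \<Longrightarrow> 1 \<le> t \<Longrightarrow>
        exp (- (C0 * exp (- t))) \<le> prob {\<omega> \<in> space P. \<bar>X \<omega>\<bar> \<le> t}"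
    and interval: "\<And>X a l t. distributed P lborel X (\<lambda>x. ennreal (p_exponential_density p x)) \<Longrightarrow>
        0 \<le> l \<Longrightarrow> 2 powr (- l) \<le> t \<Longrightarrow>
        exp (- (C0 * (1 + l + \<bar>a\<bar> powr p))) \<le> prob {\<omega> \<in> space P. \<bar>X \<omega> - a\<bar> \<le> t}"
    by (rule p_exponential_bounds[OF p P]) blast
  define C1 where "C1 = C0 * (1 + 2 * \<alpha> + B powr p)"
  have C1: "C0 \<le> C1" "0 < C1" using C0 ab unfolding C1_def by (auto simp: mult_le_cancel_left1 intro!: mult_pos_pos add_pos_nonneg)
  show ?thesis
  proof (rule that[of "C1 * Cs"])
    show "0 < C1 * Cs" using C1 Cs by simp
    fix J
    define E where "E = 2 powr (p * (\<alpha> - \<beta>) * real J)"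
    have E: "1 \<le> E" unfolding E_def using ab p by (intro ge_one_powr_ge_zero) auto
    define h where "h k = (if k \<le> J then E * (1 + real (J - k)) else exp (- (2 powr (c * real (k - J))) / 4))" for k
    have "exp (- (C1 * (Cs * 2 ^ J * E))) \<le> measure P {\<omega> \<in> space P. \<forall>k. \<forall>l\<in>{1..2^k}.
        \<xi> k l \<omega> \<in> {x. \<bar>x - a k l\<bar> \<le> (1 + B) * threshold \<alpha> \<beta> J k}}"
    proof (rule indep_levels_lower_bound[OF P ind, where h = "\<lambda>k. C1 * h k"])
      show "{x. \<bar>x - a k l\<bar> \<le> (1 + B) * threshold \<alpha> \<beta> J k} \<in> sets borel" for k l by measurable
      have "(\<Sum>k<N. 2 ^ k * h k) \<le> Cs * 2 ^ J * E" for N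
        by (rule level[OF E]) (auto simp: h_def)
      then have "C1 * (\<Sum>k<N. 2 ^ k * h k) \<le> C1 * (Cs * 2 ^ J * E)" for N
        using C1 by (intro mult_left_mono) auto
      then show "(\<Sum>k<N. 2 ^ k * (C1 * h k)) \<le> C1 * (Cs * 2 ^ J * E)" for N
        by (simp add: sum_distrib_left mult_ac)
      fix k l assume l: "l \<in> {1..2^k :: nat}"
      have mxi[measurable]: "\<xi> k l \<in> borel_measurable P" using distributed_measurable[OF dist[OF l]] by simp
      show "exp (- (C1 * h k)) \<le> prob {\<omega> \<in> space P. \<xi> k l \<omega> \<in> {x. \<bar>x - a k l\<bar> \<le> (1 + B) * threshold \<alpha> \<beta> J k}}"
      proof (cases "k \<le> J")
        case True
        have le: "1 + 2 * \<alpha> * real (J - k) + \<bar>a k l\<bar> powr p \<le> (1 + 2 * \<alpha> + B powr p) * h k"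
        proof -
          have "\<bar>a k l\<bar> powr p \<le> (B * 2 powr ((\<alpha> - \<beta>) * real k)) powr p"
            using B(2)[OF l] p by (intro powr_mono2) auto
          also have "\<dots> = B powr p * 2 powr (p * (\<alpha> - \<beta>) * real k)"
            by (simp add: powr_mult powr_powr mult_ac)
          also have "\<dots> \<le> B powr p * E"
            unfolding E_def using True p ab by (intro mult_left_mono powr_mono mult_left_mono) auto
          also have "\<dots> \<le> B powr p * h k"
            using True E by (intro mult_left_mono) (auto simp: h_def)
          finally have 1: "\<bar>a k l\<bar> powr p \<le> B powr p * h k" .
          have hk: "1 + real (J - k) \<le> h k"
            using True mult_right_mono[OF E, of "1 + real (J - k)"] by (simp add: h_def)
          then have "2 * \<alpha> * real (J - k) \<le> 2 * \<alpha> * h k" using ab by (intro mult_left_mono) auto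
          moreover have "1 \<le> 1 * h k" using hk by simp
          ultimately show ?thesis using 1 unfolding distrib_right by linarith
        qed
        have "exp (- (C1 * h k)) \<le> exp (- (C0 * (1 + 2 * \<alpha> * real (J - k) + \<bar>a k l\<bar> powr p)))"
          using mult_left_mono[OF le, of C0] C0 by (simp add: C1_def mult_ac)
        also have "\<dots> \<le> prob {\<omega> \<in> space P. \<bar>\<xi> k l \<omega> - a k l\<bar> \<le> threshold \<alpha> \<beta> J k}"
          using ab threshold_low[OF ab True] by (intro interval dist l) auto
        also have "\<dots> \<le> prob {\<omega> \<in> space P. \<bar>\<xi> k l \<omega> - a k l\<bar> \<le> (1 + B) * threshold \<alpha> \<beta> J k}"
        proof (intro finite_measure_mono)
          have "1 * threshold \<alpha> \<beta> J k \<le> (1 + B) * threshold \<alpha> \<beta> J k"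
            using B(1) threshold_pos[of \<alpha> \<beta> J k] by (intro mult_right_mono) auto
          then show "{\<omega> \<in> space P. \<bar>\<xi> k l \<omega> - a k l\<bar> \<le> threshold \<alpha> \<beta> J k} \<subseteq> 
            {\<omega> \<in> space P. \<bar>\<xi> k l \<omega> - a k l\<bar> \<le> (1 + B) * threshold \<alpha> \<beta> J k}" by auto
        qed measurable
        finally show ?thesis by simp
      next
        case False
        then have Jk: "J < k" by simp
        note th = threshold_high[OF ab Jk]
        have "exp (- threshold \<alpha> \<beta> J k) \<le> h k"
          using th(1) False threshold_pos[of \<alpha> \<beta> J k] by (simp add: h_def c_def)
        then have "C0 * exp (- threshold \<alpha> \<beta> J k) \<le> C1 * h k"
          using C0 C1 by (intro mult_mono) auto
        then have "exp (- (C1 * h k)) \<le> exp (- (C0 * exp (- threshold \<alpha> \<beta> J k)))" by simp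
        also have "\<dots> \<le> prob {\<omega> \<in> space P. \<bar>\<xi> k l \<omega>\<bar> \<le> threshold \<alpha> \<beta> J k}"
          by (intro centre dist l th)
        also have "\<dots> \<le> prob {\<omega> \<in> space P. \<bar>\<xi> k l \<omega> - a k l\<bar> \<le> (1 + B) * threshold \<alpha> \<beta> J k}"
        proof (intro finite_measure_mono)
          have "\<bar>a k l\<bar> \<le> B * threshold \<alpha> \<beta> J k"
            using B(1) B(2)[OF l] th(2) mult_left_mono[OF th(2) B(1)] by linarith
          then show "{\<omega> \<in> space P. \<bar>\<xi> k l \<omega>\<bar> \<le> threshold \<alpha> \<beta> J k} \<subseteq> 
            {\<omega> \<in> space P. \<bar>\<xi> k l \<omega> - a k l\<bar> \<le> (1 + B) * threshold \<alpha> \<beta> J k}"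
            by (auto simp: distrib_right)
        qed measurable
        finally show ?thesis by simp
      qed
    qed
    moreover have "2 ^ J * E = 2 powr (real J * (1 + p * (\<alpha> - \<beta>)))"
      by (simp add: E_def powr_add powr_realpow distrib_left mult_ac)
    ultimately show "exp (- (C1 * Cs * 2 powr (real J * (1 + p * (\<alpha> - \<beta>))))) \<le>
      measure P {\<omega> \<in> space P. \<forall>k. \<forall>l\<in>{1..2^k}. \<bar>\<xi> k l \<omega> - a k l\<bar> \<le> (1 + B) * threshold \<alpha> \<beta> J k}"
      by (simp add: mult.assoc)
  qed
qed

section \<open>Cells obtained by rounding the coordinates\<close>

text \<open>The sum over all cells of one coordinate. The central term is kept apart with weight 1
  so that the sum tends to 1 as \<open>y\<close> grows; otherwise the product over all coordinates
  would not stay bounded.\<close>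

lemma sum_two_sided_geometric_le:
  fixes a y :: real
  assumes "0 \<le> a" "0 < y"
  shows "(\<Sum>j\<in>{- int N..int N}. if j = 0 then 1 else a * exp (- (\<bar>real_of_int j\<bar> * y))) \<le> 1 + 2 * a / (exp y - 1)"
proof -
  define r where "r = exp (- y)"
  have r: "0 < r" "r < 1" using assms by (auto simp: r_def)
  have "(\<Sum>j\<in>{- int N..int N}. if j = 0 then 1 else a * exp (- (\<bar>real_of_int j\<bar> * y))) = 1 + 2 * a * (\<Sum>i<N. r ^ Suc i)"
  proof (induction N)
    case (Suc N)
    have "{- int (Suc N)..int (Suc N)} = insert (- int (Suc N)) (insert (int (Suc N)) {- int N..int N})"
      by auto
    moreover have "exp (- ((1 + real N) * y)) = r ^ Suc N"
      by (simp add: r_def exp_of_nat_mult[symmetric] algebra_simps del: power_Suc)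
    ultimately show ?case using Suc
      by (simp add: algebra_simps del: power_Suc of_nat_Suc) (simp add: algebra_simps)
  qed simp
  also have "(\<Sum>i<N. r ^ Suc i) \<le> (\<Sum>i. r ^ Suc i)"
    using r by (intro sum_le_suminf) (auto simp: summable_geometric summable_mult)
  also have "(\<Sum>i. r ^ Suc i) = r / (1 - r)"
    using r by (simp add: suminf_mult suminf_geometric summable_geometric)
  also have "\<dots> = 1 / (exp y - 1)" using assms by (simp add: r_def exp_minus field_simps)
  finally show ?thesis using assms by (simp add: mult_left_mono)
qed

lemma levels_measurable:
  assumes \<xi>: "\<And>k l. l \<in> {1..2^k} \<Longrightarrow> \<xi> k l \<in> borel_measurable P" and A: "\<And>k l. A k l \<in> sets borel"
  shows "{\<omega> \<in> space P. \<forall>k::nat. \<forall>l\<in>{1..2^k::nat}. \<xi> k l \<omega> \<in> A k l} \<in> sets P"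
proof (intro sets.sets_Collect_countable_All sets.sets_Collect_finite_All)
  show "{\<omega> \<in> space P. \<xi> k l \<omega> \<in> A k l} \<in> sets P" if "l \<in> {1..2^k}" for k l
    using measurable_sets[OF \<xi>[OF that] A] by (simp add: vimage_def Int_def conj_commute)
qed auto

lemma summable_level_tails:
  assumes "0 < \<beta>" "\<beta> \<le> \<alpha>"
  shows "summable (\<lambda>k. 2 ^ k * exp (- (threshold \<alpha> \<beta> J k / 2)))"
proof (rule summable_comparison_test_bigo)
  show "summable (\<lambda>i::nat. norm ((1/2) ^ i :: real))" by (simp add: summable_geometric)
  define c d where "c = \<alpha> - \<beta> / 2" and "d = - \<beta> * real J + \<beta> / 2 * real J"
  have c: "0 < c" using assms by (simp add: c_def)
  have "(\<lambda>k::nat. 2 ^ k * exp (- (2 powr (c * real k + d) / 2))) \<in> O(\<lambda>i. (1/2) ^ i)"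
    using c by real_asymp
  moreover have "\<forall>\<^sub>F k in sequentially. 2 ^ k * exp (- (threshold \<alpha> \<beta> J k / 2)) =
      2 ^ k * exp (- (2 powr (c * real k + d) / 2))"
    using eventually_ge_at_top[of J]
  proof eventually_elim
    case (elim k)
    then have "\<alpha> * real k - \<beta> * real J - \<beta> / 2 * \<bar>real k - real J\<bar> = c * real k + d"
      by (simp add: c_def d_def field_simps)
    then show ?case by (simp add: threshold_def)
  qed
  ultimately show "(\<lambda>k. 2 ^ k * exp (- (threshold \<alpha> \<beta> J k / 2))) \<in> O(\<lambda>i. (1/2) ^ i)"
    by (subst landau_o.big.in_cong)
qed

text \<open>Borel--Cantelli: almost surely all coordinates from some level on round to 0. Therefore
  finitely many cells capture all but an arbitrarily small part of the prior mass.\<close>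

lemma AE_eventually_below_threshold:
  fixes \<xi> :: "nat \<Rightarrow> nat \<Rightarrow> 'a \<Rightarrow> real"
  assumes ab: "0 < \<beta>" "\<beta> \<le> \<alpha>" and p: "1 \<le> p" and P: "prob_space P"
    and dist: "\<And>k l. l \<in> {1..2^k} \<Longrightarrow> distributed P lborel (\<xi> k l) (\<lambda>x. ennreal (p_exponential_density p x))"
  shows "AE \<omega> in P. \<forall>\<^sub>F k in sequentially. \<forall>l\<in>{1..2^k}. \<bar>\<xi> k l \<omega>\<bar> \<le> threshold \<alpha> \<beta> J k / 2"
proof -
  interpret prob_space P by fact
  obtain C0 where C0: "0 < C0"
    and tail: "\<And>X t. distributed P lborel X (\<lambda>x. ennreal (p_exponential_density p x)) \<Longrightarrow>
        prob {\<omega> \<in> space P. t \<le> \<bar>X \<omega>\<bar>} \<le> C0 * exp (- t)"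
    by (rule p_exponential_bounds[OF p P]) blast
  have \<xi>m: "\<xi> k l \<in> borel_measurable P" if "l \<in> {1..2^k}" for k l
    using distributed_measurable[OF dist[OF that]] by simp
  define B where "B k l = {\<omega> \<in> space P. threshold \<alpha> \<beta> J k / 2 \<le> \<bar>\<xi> k l \<omega>\<bar>}" for k l :: nat
  have B: "B k l \<in> events" if "l \<in> {1..2^k}" for k l
    unfolding B_def using \<xi>m[OF that] by measurable
  define A where "A k = (\<Union>l\<in>{1..2^k}. B k l)" for k :: nat
  have A: "A k \<in> events" for k unfolding A_def using B by auto
  have "prob (A k) \<le> C0 * (2 ^ k * exp (- (threshold \<alpha> \<beta> J k / 2)))" for k
  proof -
    have "prob (A k) \<le> (\<Sum>l=1..2^k. prob (B k l))"
      unfolding A_def using B by (intro finite_measure_subadditive_finite) auto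
    also have "\<dots> \<le> (\<Sum>l=1..2^k::nat. C0 * exp (- (threshold \<alpha> \<beta> J k / 2)))"
      unfolding B_def by (intro sum_mono tail dist) auto
    finally show ?thesis by (simp add: mult_ac)
  qed
  then have "summable (\<lambda>k. prob (A k))"
    by (intro summable_comparison_test'[OF summable_mult[OF summable_level_tails[OF ab]]]) auto
  then have "AE \<omega> in P. eventually (\<lambda>k. \<omega> \<in> space P - A k) sequentially"
    using A by (intro borel_cantelli_AE1) (auto simp: emeasure_eq_measure)
  then show ?thesis
    by eventually_elim (auto elim!: eventually_mono simp: A_def B_def not_le less_imp_le)
qed

text \<open>A cell fixes the rounded values at levels below some \<open>N\<close> and requires
  rounding to 0 from level \<open>N\<close> on; \<open>s m\<close> is a product of one-dimensional
  bounds for the square root of its probability. The decisive point is the order of quantifiers: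
  \<open>N\<close> depends on \<open>e\<close>, but the bound for the sum of \<open>s\<close> does
  not, so \<open>e\<close> may later be taken exponentially small. The \<open>s m\<close> are
  positive because they occur as divisors.\<close>

lemma coordinate_cells:
  fixes \<xi> :: "nat \<Rightarrow> nat \<Rightarrow> 'a \<Rightarrow> real"
  assumes ab: "0 < \<beta>" "\<beta> \<le> \<alpha>" and p: "1 \<le> p" and P: "prob_space P"
    and ind: "prob_space.indep_vars P (\<lambda>_. borel) (\<lambda>(k, l). \<xi> k l) (SIGMA k:UNIV. {1..2^k})"
    and dist: "\<And>k l. l \<in> {1..2^k} \<Longrightarrow> distributed P lborel (\<xi> k l) (\<lambda>x. ennreal (p_exponential_density p x))"
  obtains C where "0 < C" and "\<And>J e. 0 < e \<Longrightarrow> \<exists>(M :: (nat \<times> nat \<Rightarrow> int) set) A s E.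
      finite M \<and> E \<in> sets P \<and> measure P E \<le> e \<and> space P \<subseteq> E \<union> (\<Union>m\<in>M. A m) \<and>
      (\<forall>m\<in>M. A m \<in> sets P \<and> 0 < s m \<and> measure P (A m) \<le> (s m)\<^sup>2) \<and> (\<Sum>m\<in>M. s m) \<le> exp (C * 2 ^ J) \<and>
      (\<forall>m\<in>M. \<forall>\<omega>\<in>A m. \<forall>\<omega>'\<in>A m. \<forall>k. \<forall>l\<in>{1..2^k}. \<bar>\<xi> k l \<omega> - \<xi> k l \<omega>'\<bar> \<le> threshold \<alpha> \<beta> J k)"
proof -
  interpret prob_space P by fact
  define c where "c = \<alpha> - \<beta> / 2"
  have c: "0 < c" using ab by (simp add: c_def)
  obtain Cs where Cs: "0 < Cs" and level: "\<And>J N E h. 1 \<le> E \<Longrightarrow>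
      (\<And>k. k \<le> J \<Longrightarrow> h k \<le> E * (1 + real (J - k))) \<Longrightarrow>
      (\<And>k. J < k \<Longrightarrow> h k \<le> exp (- (2 powr (c * real (k - J))) / 4)) \<Longrightarrow>
      (\<Sum>k<N. 2 ^ k * h k) \<le> Cs * 2 ^ J * E"
    by (rule level_sum_bound[OF c]) blast
  obtain C0 where C0: "0 < C0"
    and tail: "\<And>X t. distributed P lborel X (\<lambda>x. ennreal (p_exponential_density p x)) \<Longrightarrow>
        prob {\<omega> \<in> space P. t \<le> \<bar>X \<omega>\<bar>} \<le> C0 * exp (- t)"
    by (rule p_exponential_bounds[OF p P]) blast
  have \<xi>m: "\<xi> k l \<in> borel_measurable P" if "l \<in> {1..2^k}" for k l
    using distributed_measurable[OF dist[OF that]] by simp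
  define a where "a = sqrt C0"
  have a: "0 < a" "a\<^sup>2 = C0" using C0 by (auto simp: a_def)
  \<comment> \<open>Above \<open>J\<close> a quarter \<open>y\<close> of the threshold is at least
    1/4, so that \<open>exp y - 1 \<ge> (1 - exp (- (1 / 4))) * exp y\<close> and
    \<open>K * exp (- y)\<close> bounds the noncentral weights. The other two terms of
    \<open>C1\<close> pay for the levels up to \<open>J\<close>.\<close>
  define K where "K = 2 * a / (1 - exp (- (1 / 4)))"
  have K: "0 < K" using a by (simp add: K_def)
  define C1 where "C1 = ln (1 + 8 * a) + 2 * \<alpha> + K"
  have ln0: "0 \<le> ln (1 + 8 * a)" using a by (intro ln_ge_zero) auto
  have C1: "0 < C1" unfolding C1_def using K ab ln0 by linarith
  \<comment> \<open>The noncentral cell \<open>j\<close> lies where the variable is at least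
    \<open>\<bar>j\<bar> / 2\<close> thresholds in absolute value. The tail bound there has exponent
    \<open>\<bar>j\<bar> / 2\<close> times the threshold, and its square root is the weight. The
    central cell gets the trivial bound 1.\<close>
  define w where "w J k j = (if j = 0 then 1 else a * exp (- (\<bar>real_of_int j\<bar> * (threshold \<alpha> \<beta> J k / 4))))"
    for J k and j :: int
  define h where "h J k = (if k \<le> J then 1 * (1 + real (J - k)) else exp (- (2 powr (c * real (k - J))) / 4))" for J k :: nat
  have w_pos: "0 < w J k j" for J k j using a by (simp add: w_def)
  have w_sum: "(\<Sum>j\<in>{- int N..int N}. w J k j) \<le> exp (C1 * h J k)" for J k N
  proof -
    define y where "y = threshold \<alpha> \<beta> J k / 4"
    have y: "0 < y" using threshold_pos[of \<alpha> \<beta> J k] by (simp add: y_def)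
    have "(\<Sum>j\<in>{- int N..int N}. w J k j) \<le> 1 + 2 * a / (exp y - 1)"
      unfolding w_def y_def using y a by (intro sum_two_sided_geometric_le) (auto simp: y_def)
    also have "\<dots> \<le> exp (C1 * h J k)"
    proof (cases "k \<le> J")
      case True
      define z where "z = 2 powr (2 * \<alpha> * real (J - k))"
      have z1: "1 \<le> z" unfolding z_def using ab by (intro ge_one_powr_ge_zero) auto
      have "1 / z \<le> threshold \<alpha> \<beta> J k"
        using threshold_low[OF ab True] by (simp add: z_def powr_minus divide_inverse)
      then have zy: "1 / y \<le> 4 * z" using y z1 by (simp add: y_def field_simps)
      have "y \<le> exp y - 1" using exp_ge_add_one_self[of y] by linarith
      then have "2 * a / (exp y - 1) \<le> 2 * a / y" using y a by (intro divide_left_mono) auto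
      also have "\<dots> \<le> 2 * a * (4 * z)" using zy a mult_left_mono[OF zy, of "2 * a"] by simp
      finally have "1 + 2 * a / (exp y - 1) \<le> (1 + 8 * a) * z" using z1 by (simp add: algebra_simps)
      also have "\<dots> = exp (ln (1 + 8 * a) + 2 * \<alpha> * real (J - k) * ln 2)"
        using a by (simp add: z_def exp_add powr_def)
      also have "\<dots> \<le> exp (C1 * h J k)"
      proof -
        have "2 * \<alpha> * real (J - k) * ln 2 \<le> 2 * \<alpha> * real (J - k) * 1"
          using ab ln_2_less_1 by (intro mult_left_mono) auto
        also have "\<dots> \<le> C1 * real (J - k)" unfolding mult_1_right
          using K ln0 by (intro mult_right_mono) (auto simp: C1_def)
        finally have "2 * \<alpha> * real (J - k) * ln 2 \<le> C1 * real (J - k)" .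
        moreover have "ln (1 + 8 * a) \<le> C1" using K ab by (simp add: C1_def)
        ultimately show ?thesis using True by (simp add: h_def algebra_simps)
      qed
      finally show ?thesis .
    next
      case False
      then have Jk: "J < k" by simp
      have y4: "1 / 4 \<le> y" using threshold_high(3)[OF ab Jk] by (simp add: y_def)
      have "(1 - exp (- (1 / 4))) * exp y \<le> (1 - exp (- y)) * exp y" using y4 by (intro mult_right_mono) auto
      also have "\<dots> = exp y - 1" by (simp add: algebra_simps flip: exp_add)
      finally have "2 * a / (exp y - 1) \<le> 2 * a / ((1 - exp (- (1 / 4))) * exp y)"
        using a y by (intro divide_left_mono) auto
      also have "\<dots> = K * exp (- y)" by (simp add: K_def exp_minus field_simps)
      also have "\<dots> \<le> C1 * h J k"
      proof (intro mult_mono)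
        show "exp (- y) \<le> h J k" using False threshold_high(1)[OF ab Jk] by (simp add: h_def y_def c_def)
        show "K \<le> C1" using ab ln0 by (simp add: C1_def)
      qed (use C1 in auto)
      finally have "1 + 2 * a / (exp y - 1) \<le> 1 + C1 * h J k" by simp
      also have "\<dots> \<le> exp (C1 * h J k)" by (rule exp_ge_add_one_self)
      finally show ?thesis .
    qed
    finally show ?thesis .
  qed
  have cell_prob: "prob {\<omega> \<in> space P. \<xi> k l \<omega> \<in> {x. \<bar>x - j * threshold \<alpha> \<beta> J k\<bar> \<le> threshold \<alpha> \<beta> J k / 2}} \<le> (w J k j)\<^sup>2"
    if l: "l \<in> {1..2^k}" for J k l and j :: int
  proof (cases "j = 0")
    case False
    define \<tau> where "\<tau> = threshold \<alpha> \<beta> J k"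
    have \<tau>: "0 < \<tau>" by (simp add: \<tau>_def threshold_pos)
    have j: "1 \<le> \<bar>real_of_int j\<bar>" using False by linarith
    \<comment> \<open>Because \<open>\<bar>j\<bar> \<ge> 1\<close>, the distance
      \<open>(\<bar>j\<bar> - 1 / 2) * \<tau>\<close> from the origin is at least
      \<open>\<bar>j\<bar> * \<tau> / 2\<close>.\<close>
    have sub: "\<bar>real_of_int j\<bar> * \<tau> / 2 \<le> \<bar>x\<bar>" if "\<bar>x - j * \<tau>\<bar> \<le> \<tau> / 2" for x
    proof -
      have "\<bar>j * \<tau>\<bar> = \<bar>real_of_int j\<bar> * \<tau>" using \<tau> by (simp add: abs_mult)
      moreover have "\<tau> \<le> \<bar>real_of_int j\<bar> * \<tau>" using j \<tau> by simp
      ultimately show ?thesis using that by linarith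
    qed
    have "prob {\<omega> \<in> space P. \<xi> k l \<omega> \<in> {x. \<bar>x - j * \<tau>\<bar> \<le> \<tau> / 2}} \<le> prob {\<omega> \<in> space P. \<bar>real_of_int j\<bar> * \<tau> / 2 \<le> \<bar>\<xi> k l \<omega>\<bar>}"
      using \<xi>m[OF l] sub by (intro finite_measure_mono) auto
    also have "\<dots> \<le> C0 * exp (- (\<bar>real_of_int j\<bar> * \<tau> / 2))" by (intro tail dist l)
    also have "\<dots> = (w J k j)\<^sup>2"
      using False a by (simp add: w_def \<tau>_def power_mult_distrib flip: exp_double)
    finally show ?thesis by (simp add: \<tau>_def)
  qed (simp add: w_def)
  show ?thesis
  proof (rule that[of "C1 * Cs"])
    show "0 < C1 * Cs" using C1 Cs by simp
    fix J :: nat and e :: real assume e: "0 < e"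
    define \<tau> where "\<tau> k = threshold \<alpha> \<beta> J k" for k
    have \<tau>: "0 < \<tau> k" for k by (simp add: \<tau>_def threshold_pos)
    \<comment> \<open>On \<open>G N\<close> the rounded values lie in
      \<open>{- int N..int N}\<close> below level \<open>N\<close> and may be taken to be 0 from
      there on. One parameter controls both truncations, so these sets increase to an event of
      probability one.\<close>
    define G where "G N = {\<omega> \<in> space P. \<forall>k. \<forall>l\<in>{1..2^k}. \<xi> k l \<omega> \<in> (if k < N then {x. \<bar>x\<bar> \<le> real N * \<tau> k} else {x. \<bar>x\<bar> \<le> \<tau> k / 2})}"
      for N :: nat
    have Gm: "G N \<in> events" for N unfolding G_def by (intro levels_measurable \<xi>m) auto
    have G_mono: "G N \<subseteq> G (Suc N)" for N
    proof
      fix \<omega> assume \<omega>: "\<omega> \<in> G N"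
      show "\<omega> \<in> G (Suc N)" unfolding G_def
      proof (intro CollectI conjI allI ballI)
        show "\<omega> \<in> space P" using \<omega> by (simp add: G_def)
        fix k l assume "l \<in> {1..2^k :: nat}"
        then have *: "\<xi> k l \<omega> \<in> (if k < N then {x. \<bar>x\<bar> \<le> real N * \<tau> k} else {x. \<bar>x\<bar> \<le> \<tau> k / 2})"
          using \<omega> unfolding G_def by blast
        define b where "b = real N * \<tau> k"
        have b: "0 \<le> b" "real (Suc N) * \<tau> k = \<tau> k + b" using \<tau>[of k] by (auto simp: b_def distrib_right)
        show "\<xi> k l \<omega> \<in> (if k < Suc N then {x. \<bar>x\<bar> \<le> real (Suc N) * \<tau> k} else {x. \<bar>x\<bar> \<le> \<tau> k / 2})"
          using * b(1) \<tau>[of k] unfolding b(2) b_def[symmetric] by (cases "k < N") auto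
      qed
    qed
    then have "incseq G" by (intro incseq_SucI)
    then have "(\<lambda>N. prob (G N)) \<longlonglongrightarrow> prob (\<Union>N. G N)"
      using Gm by (intro finite_Lim_measure_incseq) auto
    moreover have "prob (\<Union>N. G N) = 1"
    proof (subst prob_eq_1)
      show "(\<Union>N. G N) \<in> events" using Gm by auto
      have "AE \<omega> in P. \<forall>\<^sub>F k in sequentially. \<forall>l\<in>{1..2^k}. \<bar>\<xi> k l \<omega>\<bar> \<le> threshold \<alpha> \<beta> J k / 2"
        by (rule AE_eventually_below_threshold[OF ab p P]) (rule dist)
      then show "AE \<omega> in P. \<omega> \<in> (\<Union>N. G N)"
        using AE_space
      proof eventually_elim
        case (elim \<omega>)
        then obtain K where K: "\<And>k l. K \<le> k \<Longrightarrow> l \<in> {1..2^k} \<Longrightarrow> \<bar>\<xi> k l \<omega>\<bar> \<le> \<tau> k / 2"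
          unfolding eventually_at_top_linorder \<tau>_def by blast
        \<comment> \<open>A crude common bound for the finitely many ratios below level
          \<open>K\<close>; any finite bound is enough to choose \<open>N\<close>.\<close>
        define b where "b = (\<Sum>k<K. \<Sum>l=1..2^k. \<bar>\<xi> k l \<omega>\<bar> / \<tau> k)"
        have b: "\<bar>\<xi> k l \<omega>\<bar> / \<tau> k \<le> b" if "k < K" "l \<in> {1..2^k}" for k l
        proof -
          have "\<bar>\<xi> k l \<omega>\<bar> / \<tau> k \<le> (\<Sum>l=1..2^k. \<bar>\<xi> k l \<omega>\<bar> / \<tau> k)"
            using that \<tau>[of k] by (intro member_le_sum) auto
          also have "\<dots> \<le> b" unfolding b_def
            using that \<tau> by (intro member_le_sum[of k "{..<K}" "\<lambda>k. \<Sum>l=1..2^k. \<bar>\<xi> k l \<omega>\<bar> / \<tau> k"] sum_nonneg)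
              (auto simp: less_imp_le)
          finally show ?thesis .
        qed
        obtain N0 :: nat where N0: "b \<le> real N0" using real_arch_simple by blast
        define N where "N = max (max K N0) 1"
        have "\<omega> \<in> G N" unfolding G_def
        proof (intro CollectI conjI allI ballI)
          show "\<omega> \<in> space P" by (rule elim)
          fix k l assume l: "l \<in> {1..2^k :: nat}"
          show "\<xi> k l \<omega> \<in> (if k < N then {x. \<bar>x\<bar> \<le> real N * \<tau> k} else {x. \<bar>x\<bar> \<le> \<tau> k / 2})"
          proof (cases "k < K")
            case True
            have "\<bar>\<xi> k l \<omega>\<bar> / \<tau> k \<le> real N" using b[OF True l] N0 by (simp add: N_def)
            then have "\<bar>\<xi> k l \<omega>\<bar> \<le> real N * \<tau> k" using \<tau>[of k] by (simp add: divide_le_eq)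
            moreover have "k < N" using True by (simp add: N_def)
            ultimately show ?thesis by simp
          next
            case False
            then have *: "\<bar>\<xi> k l \<omega>\<bar> \<le> \<tau> k / 2" using K l by simp
            have "1 * \<tau> k \<le> real N * \<tau> k" using \<tau>[of k] by (intro mult_right_mono) (auto simp: N_def)
            then have "\<bar>\<xi> k l \<omega>\<bar> \<le> real N * \<tau> k" using * \<tau>[of k] by linarith
            then show ?thesis using * by simp
          qed
        qed
        then show ?case by blast
      qed
    qed
    ultimately have "(\<lambda>N. prob (G N)) \<longlonglongrightarrow> 1" by simp
    from order_tendstoD(1)[OF this, of "1 - e"] e obtain N where N: "1 - e < prob (G N)"
      by (auto simp: eventually_at_top_linorder)
    let ?S = "SIGMA k:{..<N}. {1..2^k :: nat}"
    define M where "M = PiE ?S (\<lambda>_. {- int N..int N})"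
    define A where "A m = {\<omega> \<in> space P. \<forall>k. \<forall>l\<in>{1..2^k}. \<xi> k l \<omega> \<in>
        (if k < N then {x. \<bar>x - m (k, l) * \<tau> k\<bar> \<le> \<tau> k / 2} else {x. \<bar>x\<bar> \<le> \<tau> k / 2})}" for m :: "nat \<times> nat \<Rightarrow> int"
    define s where "s m = (\<Prod>(k, l)\<in>?S. w J k (m (k, l)))" for m
    define E where "E = space P - G N"
    have Am: "A m \<in> events" for m unfolding A_def by (intro levels_measurable \<xi>m) auto
    have 1: "finite M" unfolding M_def by (intro finite_PiE) auto
    have 2: "E \<in> events" "prob E \<le> e" using Gm N by (auto simp: E_def prob_compl)
    have 3: "space P \<subseteq> E \<union> (\<Union>m\<in>M. A m)"
    proof
      fix \<omega> assume \<omega>: "\<omega> \<in> space P"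
      show "\<omega> \<in> E \<union> (\<Union>m\<in>M. A m)"
      proof (cases "\<omega> \<in> G N")
        case True
        define m where "m = (\<lambda>(k, l)\<in>?S. round (\<xi> k l \<omega> / \<tau> k))"
        have *: "\<xi> k l \<omega> \<in> (if k < N then {x. \<bar>x\<bar> \<le> real N * \<tau> k} else {x. \<bar>x\<bar> \<le> \<tau> k / 2})"
          if "l \<in> {1..2^k}" for k l using True that unfolding G_def by blast
        have "m \<in> M" unfolding M_def
        proof (intro PiE_I)
          fix i assume "i \<in> ?S"
          then obtain k l where i: "i = (k, l)" "k < N" "l \<in> {1..2^k}" by auto
          have "\<bar>\<xi> k l \<omega> / \<tau> k\<bar> \<le> real N" using *[OF i(3)] i(2) \<tau>[of k] by (simp add: abs_divide divide_le_eq)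
          then have "\<xi> k l \<omega> / \<tau> k \<le> of_int (int N)" "of_int (- int N) \<le> \<xi> k l \<omega> / \<tau> k"
            unfolding abs_le_iff of_int_minus of_int_of_nat_eq by linarith+
          then have "round (\<xi> k l \<omega> / \<tau> k) \<le> int N" "- int N \<le> round (\<xi> k l \<omega> / \<tau> k)"
            using round_mono round_of_int by metis+
          then show "m i \<in> {- int N..int N}" using i by (simp add: m_def)
        qed (auto simp: m_def)
        moreover have "\<omega> \<in> A m" unfolding A_def
        proof (intro CollectI conjI allI ballI \<omega>)
          fix k l assume l: "l \<in> {1..2^k :: nat}"
          show "\<xi> k l \<omega> \<in> (if k < N then {x. \<bar>x - m (k, l) * \<tau> k\<bar> \<le> \<tau> k / 2} else {x. \<bar>x\<bar> \<le> \<tau> k / 2})"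
          proof (cases "k < N")
            case True
            have "\<bar>\<xi> k l \<omega> - m (k, l) * \<tau> k\<bar> = \<bar>m (k, l) - \<xi> k l \<omega> / \<tau> k\<bar> * \<tau> k"
              using \<tau>[of k] by (simp add: abs_mult_pos[symmetric] abs_minus_commute field_simps)
            also have "\<dots> \<le> 1 / 2 * \<tau> k"
              using True l \<tau>[of k] of_int_round_abs_le[of "\<xi> k l \<omega> / \<tau> k"]
              by (intro mult_right_mono) (auto simp: m_def)
            finally show ?thesis using True by simp
          qed (use *[OF l] in simp)
        qed
        ultimately show ?thesis by blast
      qed (use \<omega> in \<open>auto simp: E_def\<close>)
    qed
    have 4: "0 < s m" for m unfolding s_def by (intro prod_pos) (auto simp: w_pos)
    have 5: "prob (A m) \<le> (s m)\<^sup>2" for m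
    proof -
      have "prob (A m) \<le> prob {\<omega> \<in> space P. \<forall>k\<in>{..<N}. \<forall>l\<in>{1..2^k}. \<xi> k l \<omega> \<in> {x. \<bar>x - m (k, l) * \<tau> k\<bar> \<le> \<tau> k / 2}}"
      proof (intro finite_measure_mono)
        show "A m \<subseteq> {\<omega> \<in> space P. \<forall>k\<in>{..<N}. \<forall>l\<in>{1..2^k}. \<xi> k l \<omega> \<in> {x. \<bar>x - m (k, l) * \<tau> k\<bar> \<le> \<tau> k / 2}}"
          unfolding A_def by fastforce
        have "{\<omega> \<in> space P. \<forall>k. \<forall>l\<in>{1..2^k}. \<xi> k l \<omega> \<in> (if k < N then {x. \<bar>x - m (k, l) * \<tau> k\<bar> \<le> \<tau> k / 2} else UNIV)} \<in> events"
          by (intro levels_measurable \<xi>m) auto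
        also have "{\<omega> \<in> space P. \<forall>k. \<forall>l\<in>{1..2^k}. \<xi> k l \<omega> \<in> (if k < N then {x. \<bar>x - m (k, l) * \<tau> k\<bar> \<le> \<tau> k / 2} else UNIV)} =
          {\<omega> \<in> space P. \<forall>k\<in>{..<N}. \<forall>l\<in>{1..2^k}. \<xi> k l \<omega> \<in> {x. \<bar>x - m (k, l) * \<tau> k\<bar> \<le> \<tau> k / 2}}"
          by auto
        finally show "\<dots> \<in> events" .
      qed
      also have "\<dots> = (\<Prod>(k, l)\<in>?S. prob {\<omega> \<in> space P. \<xi> k l \<omega> \<in> {x. \<bar>x - m (k, l) * \<tau> k\<bar> \<le> \<tau> k / 2}})"
        by (rule indep_levels_finite[OF P ind]) measurable
      also have "\<dots> \<le> (\<Prod>(k, l)\<in>?S. (w J k (m (k, l)))\<^sup>2)"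
        by (intro prod_mono) (use cell_prob in \<open>auto simp: \<tau>_def\<close>)
      also have "\<dots> = (s m)\<^sup>2" unfolding s_def by (simp add: prod_power_distrib split_beta')
      finally show ?thesis .
    qed
    have 6: "(\<Sum>m\<in>M. s m) \<le> exp (C1 * Cs * 2 ^ J)"
    proof -
      have "(\<Sum>m\<in>M. s m) = (\<Prod>i\<in>?S. \<Sum>j\<in>{- int N..int N}. w J (fst i) j)"
        unfolding M_def s_def by (subst prod_sum_PiE) (auto simp: split_beta')
      also have "\<dots> \<le> (\<Prod>i\<in>?S. exp (C1 * h J (fst i)))"
        by (intro prod_mono conjI w_sum sum_nonneg) (auto intro: less_imp_le w_pos)
      also have "\<dots> = exp (\<Sum>i\<in>?S. C1 * h J (fst i))" by (simp add: exp_sum)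
      also have "(\<Sum>i\<in>?S. C1 * h J (fst i)) = (\<Sum>k<N. \<Sum>l=1..2^k::nat. C1 * h J k)"
        by (subst sum.Sigma) (auto simp: split_beta')
      also have "\<dots> = C1 * (\<Sum>k<N. 2 ^ k * h J k)" by (simp add: sum_distrib_left mult_ac)
      also have "exp \<dots> \<le> exp (C1 * (Cs * 2 ^ J * 1))"
        using C1 by (intro iffD2[OF exp_le_cancel_iff] mult_left_mono level) (auto simp: h_def)
      finally show ?thesis by (simp add: mult_ac)
    qed
    have 7: "\<bar>\<xi> k l \<omega> - \<xi> k l \<omega>'\<bar> \<le> threshold \<alpha> \<beta> J k"
      if "\<omega> \<in> A m" "\<omega>' \<in> A m" "l \<in> {1..2^k}" for m \<omega> \<omega>' k l
    proof -
      have *: "\<xi> k l \<omega> \<in> (if k < N then {x. \<bar>x - m (k, l) * \<tau> k\<bar> \<le> \<tau> k / 2} else {x. \<bar>x\<bar> \<le> \<tau> k / 2})"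
        if "\<omega> \<in> A m" for \<omega> using that \<open>l \<in> {1..2^k}\<close> unfolding A_def by blast
      define z where "z = (if k < N then m (k, l) * \<tau> k else 0)"
      have "\<bar>\<xi> k l \<omega> - z\<bar> \<le> \<tau> k / 2" "\<bar>\<xi> k l \<omega>' - z\<bar> \<le> \<tau> k / 2"
        using *[OF that(1)] *[OF that(2)] by (auto simp: z_def split: if_splits)
      then show ?thesis unfolding \<tau>_def by linarith
    qed
    show "\<exists>(M :: (nat \<times> nat \<Rightarrow> int) set) A s E.
      finite M \<and> E \<in> sets P \<and> measure P E \<le> e \<and> space P \<subseteq> E \<union> (\<Union>m\<in>M. A m) \<and>
      (\<forall>m\<in>M. A m \<in> sets P \<and> 0 < s m \<and> measure P (A m) \<le> (s m)\<^sup>2) \<and> (\<Sum>m\<in>M. s m) \<le> exp (C1 * Cs * 2 ^ J) \<and>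
      (\<forall>m\<in>M. \<forall>\<omega>\<in>A m. \<forall>\<omega>'\<in>A m. \<forall>k. \<forall>l\<in>{1..2^k}. \<bar>\<xi> k l \<omega> - \<xi> k l \<omega>'\<bar> \<le> threshold \<alpha> \<beta> J k)"
      by (intro exI[of _ M] exI[of _ A] exI[of _ s] exI[of _ E] conjI ballI allI 1 2 3 4 5 6 Am) (rule 7)
  qed
qed

section \<open>Wavelet expansions\<close>

text \<open>Level \<open>k\<close> occupies the positions from \<open>2 ^ k - 1\<close> to
  \<open>2 ^ (k + 1) - 2\<close>, so the first \<open>2 ^ K - 1\<close> members are exactly the
  levels below \<open>K\<close>.\<close>

lemma sum_wav_seq:
  fixes g :: "nat \<Rightarrow> nat \<Rightarrow> 'b::comm_monoid_add"
  shows "(\<Sum>n<2 ^ K - 1. g (floor_log (Suc n)) (Suc n - 2 ^ floor_log (Suc n) + 1)) =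
    (\<Sum>k<K. \<Sum>l=1..2 ^ k. g k l)"
proof (induction K)
  case (Suc K)
  let ?f = "\<lambda>n. g (floor_log (Suc n)) (Suc n - 2 ^ floor_log (Suc n) + 1)"
  have "{..<2 ^ Suc K - 1} = {..<2 ^ K - 1} \<union> {2 ^ K - 1..<2 ^ Suc K - (1::nat)}"
    by (auto simp: le_diff_conv)
  then have "(\<Sum>n<2 ^ Suc K - 1. ?f n) = (\<Sum>n<2 ^ K - 1. ?f n) + (\<Sum>n=2 ^ K - 1..<2 ^ Suc K - 1. ?f n)"
    by (metis (no_types, lifting) finite_atLeastLessThan finite_lessThan ivl_disj_int_one(2) sum.union_disjoint)
  also have "(\<Sum>n=2 ^ K - 1..<2 ^ Suc K - 1. ?f n) = (\<Sum>l=1..2 ^ K. g K l)"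
  proof (rule sum.reindex_bij_witness[where i = "\<lambda>l. 2 ^ K - 1 + (l - 1)" and j = "\<lambda>n. n + 2 - 2 ^ K"])
    fix n assume n: "n \<in> {2 ^ K - 1..<2 ^ Suc K - (1::nat)}"
    have pos: "(0::nat) < 2 ^ K" by simp
    have fl: "floor_log (Suc n) = K" using n by (intro floor_log_eqI) auto
    show "2 ^ K - 1 + (n + 2 - 2 ^ K - 1) = n" "n + 2 - 2 ^ K \<in> {1..2 ^ K}"
      using n pos by auto
    show "g K (n + 2 - 2 ^ K) = ?f n"
      unfolding fl using n pos by (intro arg_cong[where f = "g K"]) auto
  next
    fix l assume l: "l \<in> {1..2 ^ K :: nat}"
    have pos: "(0::nat) < 2 ^ K" by simp
    show "2 ^ K - 1 + (l - 1) + 2 - 2 ^ K = l" "2 ^ K - 1 + (l - 1) \<in> {2 ^ K - 1..<2 ^ Suc K - (1::nat)}"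
      using l pos by auto
  qed
  finally show ?case using Suc by simp
qed simp

lemma inner01_eq_integral:
  assumes "continuous_on {0..1} f" "continuous_on {0..1} g"
  shows "inner01 f g = integral {0..1} (\<lambda>x. f x * g x)"
  unfolding inner01_def
  by (intro set_borel_integral_eq_integral borel_integrable_atLeastAtMost' continuous_intros assms)

text \<open>The Schauder property supplies a uniformly convergent expansion with unspecified
  coefficients. Uniform convergence permits integration against \<open>e m\<close>, and
  orthonormality then identifies the m-th coefficient. The expansion is needed at every point, since
  convergence in \<open>L_2\<close> of Lebesgue measure says nothing about a singular
  \<open>\<nu>\<close>.\<close>

lemma schauder_coefficients:
  assumes e: "orthonormal_basis_L2 e" "schauder_basis_C01 e" and f: "continuous_on {0..1} f"
  shows "uniform_limit {0..1} (\<lambda>N x. \<Sum>n<N. inner01 f (e n) * e n x) f sequentially"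
proof -
  have ec: "continuous_on {0..1} (e n)" for n using e by (auto simp: schauder_basis_C01_def)
  obtain a where a: "uniform_limit {0..1} (\<lambda>N x. \<Sum>n<N. a n * e n x) f sequentially"
    using e f unfolding schauder_basis_C01_def by blast
  have "inner01 f (e m) = a m" for m
  proof -
    have bd: "bounded (g ` {0..1})" if "continuous_on {0..1} g" for g :: "real \<Rightarrow> real"
      using that by (intro compact_imp_bounded compact_continuous_image) auto
    have "uniform_limit {0..1} (\<lambda>N x. (\<Sum>n<N. a n * e n x) * e m x) (\<lambda>x. f x * e m x) sequentially"
      by (intro uniform_lim_mult a uniform_limit_const bd f ec)
    moreover have "continuous_on {0..1} (\<lambda>x. (\<Sum>n<N. a n * e n x) * e m x)" for N
      by (intro continuous_intros ec)
    ultimately obtain I J where I: "\<And>N. ((\<lambda>x. (\<Sum>n<N. a n * e n x) * e m x) has_integral I N) {0..1}"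
      and J: "((\<lambda>x. f x * e m x) has_integral J) {0..1}" and lim: "I \<longlonglongrightarrow> J"
      by (rule uniform_limit_integral) auto
    have "I N = a m" if "m < N" for N
    proof -
      have "((\<lambda>x. \<Sum>n<N. a n * (e n x * e m x)) has_integral (\<Sum>n<N. a n * inner01 (e n) (e m))) {0..1}"
        unfolding inner01_eq_integral[OF ec ec]
        by (intro has_integral_sum has_integral_mult_right integrable_integral integrable_continuous_real
            continuous_intros ec) auto
      also have "(\<lambda>x. \<Sum>n<N. a n * (e n x * e m x)) = (\<lambda>x. (\<Sum>n<N. a n * e n x) * e m x)"
        by (simp add: sum_distrib_right mult.assoc)
      also have "(\<Sum>n<N. a n * inner01 (e n) (e m)) = (\<Sum>n<N. if n = m then a n else 0)"
        using e by (intro sum.cong) (auto simp: orthonormal_basis_L2_def)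
      also have "\<dots> = a m" using that by (simp add: sum.delta)
      finally show ?thesis using I has_integral_unique by blast
    qed
    then have "I \<longlonglongrightarrow> a m"
      by (intro tendsto_eventually) (auto simp: eventually_at_top_dense)
    then have "J = a m" using lim LIMSEQ_unique by blast
    then show ?thesis using J by (simp add: inner01_eq_integral[OF f ec] integral_unique)
  qed
  then show ?thesis using a by simp
qed

lemma wavelet_expansion:
  assumes "orthonormal_basis_L2 (wav_seq \<psi>)" "schauder_basis_C01 (wav_seq \<psi>)"
    and f: "continuous_on {0..1} f" and x: "x \<in> {0..1}"
  shows "(\<lambda>K. \<Sum>k<K. \<Sum>l=1..2 ^ k. inner01 f (\<psi> k l) * \<psi> k l x) \<longlonglongrightarrow> f x"
proof -
  have "(\<lambda>N. \<Sum>n<N. inner01 f (wav_seq \<psi> n) * wav_seq \<psi> n x) \<longlonglongrightarrow> f x"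
    by (rule tendsto_uniform_limitI[OF schauder_coefficients[OF assms(1-3)] x])
  then have "(\<lambda>K. \<Sum>n<2 ^ K - 1. inner01 f (wav_seq \<psi> n) * wav_seq \<psi> n x) \<longlonglongrightarrow> f x"
  proof (rule filterlim_compose)
    show "filterlim (\<lambda>K. 2 ^ K - 1 :: nat) sequentially sequentially"
    proof (rule filterlim_at_top_mono[OF filterlim_ident])
      show "\<forall>\<^sub>F K in sequentially. K \<le> 2 ^ K - (1::nat)"
        using less_exp by (intro always_eventually) (metis Suc_leI Suc_diff_1 pos2 less_Suc_eq_le zero_less_power)
    qed
  qed
  moreover have "(\<Sum>n<2 ^ K - 1. inner01 f (wav_seq \<psi> n) * wav_seq \<psi> n x) =
      (\<Sum>k<K. \<Sum>l=1..2 ^ k. inner01 f (\<psi> k l) * \<psi> k l x)" for K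
    unfolding wav_seq_def by (rule sum_wav_seq)
  ultimately show ?thesis by simp
qed

text \<open>The partial sums are subtracted first and estimated level by level; since that estimate
  is uniform in the number of levels, pointwise convergence of both series suffices.\<close>

lemma wavelet_sup_norm_diff:
  assumes C2: "0 < C2" "\<And>k u x. x \<in> {0..1} \<Longrightarrow>
      \<bar>\<Sum>l=1..2 ^ k. u l * \<psi> k l x\<bar> \<le> C2 * 2 powr (real k / 2) * (MAX l\<in>{1..2 ^ k}. \<bar>u l\<bar>)"
    and x: "x \<in> {0..1}"
    and f: "(\<lambda>K. \<Sum>k<K. \<Sum>l=1..2 ^ k. u k l * \<psi> k l x) \<longlonglongrightarrow> f"
    and g: "(\<lambda>K. \<Sum>k<K. \<Sum>l=1..2 ^ k. v k l * \<psi> k l x) \<longlonglongrightarrow> g"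
    and d: "\<And>k l. l \<in> {1..2 ^ k :: nat} \<Longrightarrow> \<bar>u k l - v k l\<bar> \<le> 2 powr (- real k / 2) * d k"
    and T: "\<And>K. (\<Sum>k<K. d k) \<le> T"
  shows "\<bar>f - g\<bar> \<le> C2 * T"
proof -
  have "(\<lambda>K. \<bar>\<Sum>k<K. \<Sum>l=1..2 ^ k. (u k l - v k l) * \<psi> k l x\<bar>) \<longlonglongrightarrow> \<bar>f - g\<bar>"
    using tendsto_rabs[OF tendsto_diff[OF f g]] by (simp add: left_diff_distrib sum_subtractf)
  moreover have "\<bar>\<Sum>k<K. \<Sum>l=1..2 ^ k. (u k l - v k l) * \<psi> k l x\<bar> \<le> C2 * T" for K
  proof -
    have "\<bar>\<Sum>k<K. \<Sum>l=1..2 ^ k. (u k l - v k l) * \<psi> k l x\<bar> \<le> (\<Sum>k<K. C2 * d k)"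
    proof (rule order_trans[OF sum_abs], intro sum_mono)
      fix k
      have "\<bar>\<Sum>l=1..2 ^ k. (u k l - v k l) * \<psi> k l x\<bar>
          \<le> C2 * 2 powr (real k / 2) * (MAX l\<in>{1..2 ^ k}. \<bar>u k l - v k l\<bar>)"
        using C2(2)[OF x, where u = "\<lambda>l. u k l - v k l"] .
      also have "\<dots> \<le> C2 * 2 powr (real k / 2) * (2 powr (- real k / 2) * d k)"
        using C2(1) d by (intro mult_left_mono Max.boundedI) auto
      also have "\<dots> = C2 * d k" by (simp add: mult.assoc flip: powr_add mult.assoc[of "2 powr _" "2 powr _"])
      finally show "\<bar>\<Sum>l=1..2 ^ k. (u k l - v k l) * \<psi> k l x\<bar> \<le> C2 * d k" .
    qed
    also have "\<dots> = C2 * (\<Sum>k<K. d k)" by (simp add: sum_distrib_left)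
    also have "\<dots> \<le> C2 * T" using C2 T by (intro mult_left_mono) auto
    finally show ?thesis .
  qed
  ultimately show ?thesis by (intro LIMSEQ_le_const2) auto
qed

section \<open>Normalised exponentials and Hellinger tests\<close>

text \<open>The identity \<open>1 / r = 2 - r + r * (1 / r - 1)^2\<close> and mean 1 of
  \<open>r\<close> cancel the term linear in \<open>\<eta>\<close>. The excess over 1 must be
  quadratic: with \<open>\<eta>\<close> of order \<open>\<rho>\<close>, the n-th power then stays
  below \<open>exp\<close> of a multiple of \<open>n * \<rho>^2\<close>.\<close>

lemma (in prob_space) nn_integral_inverse_le:
  fixes r :: "'a \<Rightarrow> real"
  assumes r: "integrable M r" "expectation r = 1" and "0 \<le> \<eta>"
    and bd: "\<And>x. x \<in> space M \<Longrightarrow> exp (- \<eta>) \<le> r x \<and> r x \<le> exp \<eta>"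
  shows "(\<integral>\<^sup>+x. ennreal (1 / r x) \<partial>M) \<le> ennreal (1 + (exp \<eta> - 1)\<^sup>2)"
proof -
  define \<kappa> where "\<kappa> = exp \<eta> - 1"
  have pos: "0 < r x" if "x \<in> space M" for x using bd[OF that] exp_gt_zero[of "- \<eta>"] by linarith
  have le: "1 / r x \<le> 2 + (\<kappa>\<^sup>2 - 1) * r x" if x: "x \<in> space M" for x
  proof -
    have "1 / r x \<le> exp \<eta>" "exp (- \<eta>) \<le> 1 / r x"
      using bd[OF x] pos[OF x] by (auto simp: exp_minus field_simps)
    moreover have "1 - \<kappa> \<le> exp (- \<eta>)"
    proof -
      have "2 \<le> exp \<eta> + 1 / exp \<eta>"
        using sum_squares_bound[of 1 "exp \<eta>"] by (simp add: field_simps power2_eq_square)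
      then show ?thesis by (simp add: \<kappa>_def exp_minus inverse_eq_divide)
    qed
    ultimately have "\<bar>1 / r x - 1\<bar> \<le> \<kappa>" by (simp add: \<kappa>_def abs_le_iff)
    then have "(1 / r x - 1)\<^sup>2 \<le> \<kappa>\<^sup>2" by (rule power2_le_iff_abs_le[THEN iffD2, rotated]) (use \<open>0 \<le> \<eta>\<close> in \<open>simp add: \<kappa>_def\<close>)
    then have "r x * (1 / r x - 1)\<^sup>2 \<le> r x * \<kappa>\<^sup>2" using pos[OF x] by (intro mult_left_mono) auto
    moreover have "r x * (1 / r x - 1)\<^sup>2 = 1 / r x - 2 + r x"
      using pos[OF x] by (simp add: power2_eq_square field_simps)
    ultimately show ?thesis by (simp add: algebra_simps)
  qed
  have int: "integrable M (\<lambda>x. 2 + (\<kappa>\<^sup>2 - 1) * r x)" using r by simp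
  have "(\<integral>\<^sup>+x. ennreal (1 / r x) \<partial>M) \<le> (\<integral>\<^sup>+x. ennreal (2 + (\<kappa>\<^sup>2 - 1) * r x) \<partial>M)"
    by (intro nn_integral_mono ennreal_leI le)
  also have "\<dots> = ennreal (\<integral>x. 2 + (\<kappa>\<^sup>2 - 1) * r x \<partial>M)"
  proof (rule nn_integral_eq_integral[OF int])
    show "AE x in M. 0 \<le> 2 + (\<kappa>\<^sup>2 - 1) * r x"
      using le pos by (intro AE_I2) (meson divide_nonneg_pos order_trans zero_le_one)
  qed
  also have "(\<integral>x. 2 + (\<kappa>\<^sup>2 - 1) * r x \<partial>M) = 1 + \<kappa>\<^sup>2"
    using r by (simp add: prob_space)
  finally show ?thesis by (simp add: \<kappa>_def)
qed

text \<open>With \<open>d\<close> the Hellinger distance of \<open>r\<^sub>1\<close> to the constant \<open>1\<close>, the likelihood ratio test of \<open>1\<close>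
  against \<open>r\<^sub>1\<close> retains its power under every \<open>r\<close> near \<open>r\<^sub>1\<close>: as \<open>r - r\<^sub>1\<close> has mean \<open>0\<close>, the error made
  in passing from \<open>r\<^sub>1\<close> to \<open>r\<close> is of order \<open>\<eta> d\<close> instead of \<open>\<eta>\<close>.\<close>

lemma (in prob_space) sqrt_likelihood_ratio_test:
  fixes r r1 :: "'a \<Rightarrow> real"
  assumes r1: "integrable M r1" "expectation r1 = 1" "\<And>x. x \<in> space M \<Longrightarrow> 0 < r1 x"
    and r: "integrable M r" "expectation r = 1"
    and bd: "\<And>x. x \<in> space M \<Longrightarrow> exp (- \<eta>) * r1 x \<le> r x \<and> r x \<le> exp \<eta> * r1 x"
    and d: "0 < d" "d\<^sup>2 = expectation (\<lambda>x. (sqrt (r1 x) - 1)\<^sup>2)" and \<eta>: "0 \<le> \<eta>" "exp \<eta> - 1 \<le> d / 4"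
  shows "(\<integral>\<^sup>+x. ennreal (sqrt (r1 x)) \<partial>M) \<le> ennreal (exp (- (d\<^sup>2 / 4)))"
    and "(\<integral>\<^sup>+x. ennreal (r x / sqrt (r1 x)) \<partial>M) \<le> ennreal (exp (- (d\<^sup>2 / 4)))"
proof -
  have r1m[measurable]: "r1 \<in> borel_measurable M" and rm[measurable]: "r \<in> borel_measurable M"
    using r1 r by auto
  have int_sqrt: "integrable M (\<lambda>x. sqrt (r1 x))"
  proof (rule Bochner_Integration.integrable_bound)
    show "integrable M (\<lambda>x. 1 + r1 x)" using r1 by simp
    show "AE x in M. norm (sqrt (r1 x)) \<le> norm (1 + r1 x)"
    proof (intro AE_I2)
      fix x assume "x \<in> space M"
      then have pos: "0 < r1 x" by (rule r1)
      then have "sqrt (r1 x) \<le> sqrt ((1 + r1 x)\<^sup>2)"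
        by (intro real_sqrt_le_mono) (simp add: power2_eq_square algebra_simps)
      then show "norm (sqrt (r1 x)) \<le> norm (1 + r1 x)" using pos by simp
    qed
  qed measurable
  have sq: "(sqrt (r1 x) - 1)\<^sup>2 = r1 x - 2 * sqrt (r1 x) + 1" if "x \<in> space M" for x
    using r1(3)[OF that] by (simp add: power2_eq_square algebra_simps)
  have "d\<^sup>2 = expectation (\<lambda>x. r1 x - 2 * sqrt (r1 x) + 1)"
    unfolding d using sq by (intro Bochner_Integration.integral_cong) auto
  also have "\<dots> = 2 - 2 * expectation (\<lambda>x. sqrt (r1 x))"
    using r1 int_sqrt by (simp add: prob_space)
  finally have E_sqrt: "expectation (\<lambda>x. sqrt (r1 x)) = 1 - d\<^sup>2 / 2" by linarith
  have int_sq: "integrable M (\<lambda>x. (sqrt (r1 x) - 1)\<^sup>2)"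
    using int_sqrt r1 by (subst Bochner_Integration.integrable_cong[OF refl sq]) auto
  have le1: "1 - d\<^sup>2 / 4 \<le> exp (- (d\<^sup>2 / 4))" using exp_ge_add_one_self[of "- (d\<^sup>2 / 4)"] by simp
  have "(\<integral>\<^sup>+x. ennreal (sqrt (r1 x)) \<partial>M) = ennreal (1 - d\<^sup>2 / 2)"
    unfolding E_sqrt[symmetric] using r1 int_sqrt
    by (intro nn_integral_eq_integral) (auto intro!: AE_I2 less_imp_le)
  also have "\<dots> \<le> ennreal (exp (- (d\<^sup>2 / 4)))"
  proof (intro ennreal_leI)
    have "0 \<le> d\<^sup>2" by simp
    then show "1 - d\<^sup>2 / 2 \<le> exp (- (d\<^sup>2 / 4))" using le1 by linarith
  qed
  finally show "(\<integral>\<^sup>+x. ennreal (sqrt (r1 x)) \<partial>M) \<le> ennreal (exp (- (d\<^sup>2 / 4)))" .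
  define \<kappa> where "\<kappa> = exp \<eta> - 1"
  have \<kappa>: "0 \<le> \<kappa>" "\<kappa> \<le> d / 4" using \<eta> by (auto simp: \<kappa>_def)
  \<comment> \<open>A majorant with computable mean. With \<open>y = sqrt r1\<close>, one has
    \<open>r / y = y + (r - y^2) + (r - y^2) * (1 - y) / y\<close>; the middle term has mean 0 and
    the last is at most \<open>\<kappa> * y * \<bar>y - 1\<bar>\<close>.\<close>
  define g where "g x = sqrt (r1 x) + (r x - r1 x) + \<kappa> / 2 * (d * r1 x + (sqrt (r1 x) - 1)\<^sup>2 / d)" for x
  have le: "r x / sqrt (r1 x) \<le> g x" if x: "x \<in> space M" for x
  proof -
    define y where "y = sqrt (r1 x)"
    have y: "0 < y" "r1 x = y\<^sup>2" using r1(3)[OF x] by (auto simp: y_def)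
    have "1 - \<kappa> \<le> exp (- \<eta>)"
    proof -
      have "2 \<le> exp \<eta> + 1 / exp \<eta>"
        using sum_squares_bound[of 1 "exp \<eta>"] by (simp add: field_simps power2_eq_square)
      then show ?thesis by (simp add: \<kappa>_def exp_minus inverse_eq_divide)
    qed
    then have "(1 - \<kappa>) * r1 x \<le> exp (- \<eta>) * r1 x" using r1(3)[OF x] by (intro mult_right_mono) auto
    then have "(1 - \<kappa>) * r1 x \<le> r x" using bd[OF x] by linarith
    moreover have "r x \<le> (1 + \<kappa>) * r1 x" using bd[OF x] by (simp add: \<kappa>_def)
    ultimately have dr: "\<bar>r x - y\<^sup>2\<bar> \<le> \<kappa> * y\<^sup>2" unfolding y(2) by (simp add: abs_le_iff algebra_simps)
    have "r x / y = y + (r x - y\<^sup>2) + (r x - y\<^sup>2) * ((1 - y) / y)"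
      using y by (simp add: field_simps power2_eq_square)
    also have "(r x - y\<^sup>2) * ((1 - y) / y) \<le> \<bar>r x - y\<^sup>2\<bar> * \<bar>(1 - y) / y\<bar>"
      by (metis abs_ge_self abs_mult)
    also have "\<dots> \<le> \<kappa> * y\<^sup>2 * \<bar>(1 - y) / y\<bar>" using dr by (intro mult_right_mono) auto
    also have "\<dots> = \<kappa> / 2 * (2 * (y * \<bar>y - 1\<bar>))"
      using y by (simp add: power2_eq_square abs_minus_commute)
    \<comment> \<open>The weight \<open>d\<close> balances the two means, each of which becomes
      \<open>d\<close>. The total error is thus \<open>\<kappa> * d \<le> d^2 / 4\<close>, half of
      the gain \<open>d^2 / 2\<close>.\<close>
    also have "2 * (y * \<bar>y - 1\<bar>) \<le> d * y\<^sup>2 + (y - 1)\<^sup>2 / d"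
    proof -
      have "0 \<le> (d * y - \<bar>y - 1\<bar>)\<^sup>2 / d" using d by simp
      also have "\<dots> = d * y\<^sup>2 + (y - 1)\<^sup>2 / d - 2 * (y * \<bar>y - 1\<bar>)"
        using d by (simp add: power2_diff power_mult_distrib field_simps) (simp add: power2_eq_square)
      finally show ?thesis by simp
    qed
    finally show ?thesis using \<kappa> unfolding g_def y_def[symmetric] by (simp add: y(2) mult_left_mono)
  qed
  have int: "integrable M g" unfolding g_def[abs_def] using r r1 int_sqrt int_sq by simp
  have "(\<integral>\<^sup>+x. ennreal (r x / sqrt (r1 x)) \<partial>M) \<le> (\<integral>\<^sup>+x. ennreal (g x) \<partial>M)"
    by (intro nn_integral_mono ennreal_leI le)
  also have "\<dots> = ennreal (expectation g)"
  proof (rule nn_integral_eq_integral[OF int], intro AE_I2)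
    fix x assume x: "x \<in> space M"
    have "0 \<le> exp (- \<eta>) * r1 x" using r1(3)[OF x] by simp
    then have "0 \<le> r x" using bd[OF x] by linarith
    then have "0 \<le> r x / sqrt (r1 x)" using r1(3)[OF x] by simp
    then show "0 \<le> g x" using le[OF x] by linarith
  qed
  also have "expectation g = 1 - d\<^sup>2 / 2 + \<kappa> / 2 * (d + d\<^sup>2 / d)"
    unfolding g_def[abs_def] using r r1 int_sqrt int_sq by (simp add: E_sqrt d(2))
  also have "\<dots> = 1 - d\<^sup>2 / 2 + \<kappa> * d" using d(1) by (simp add: power2_eq_square)
  also have "\<dots> \<le> 1 - d\<^sup>2 / 4"
    using mult_right_mono[OF \<kappa>(2), of d] d(1) unfolding power2_eq_square by linarith
  also have "\<dots> \<le> exp (- (d\<^sup>2 / 4))" by (rule le1)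
  finally show "(\<integral>\<^sup>+x. ennreal (r x / sqrt (r1 x)) \<partial>M) \<le> ennreal (exp (- (d\<^sup>2 / 4)))"
    by (simp add: ennreal_leI)
qed

definition gibbs :: "real measure \<Rightarrow> (real \<Rightarrow> real) \<Rightarrow> real \<Rightarrow> real" where
  "gibbs D v x = exp (v x) / (\<integral>y. exp (v y) \<partial>D)"

lemma space_unit_interval:
  assumes "sets D = sets (restrict_space borel {0..1::real})"
  shows "space D = {0..1}"
  using sets_eq_imp_space_eq[OF assms] by (simp add: space_restrict_space)

lemma continuous_measurable_unit_interval:
  fixes v :: "real \<Rightarrow> real"
  assumes "sets D = sets (restrict_space borel {0..1::real})" "continuous_on {0..1} v"
  shows "v \<in> borel_measurable D"
  using borel_measurable_continuous_on_restrict[OF assms(2)] measurable_cong_sets[OF assms(1) refl] by blast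

lemma integrable_exp_continuous:
  fixes v :: "real \<Rightarrow> real"
  assumes "finite_measure D" "sets D = sets (restrict_space borel {0..1})" "continuous_on {0..1} v"
  shows "integrable D (\<lambda>x. exp (v x))"
proof -
  have c: "continuous_on {0..1} (\<lambda>x. exp (v x))" by (intro continuous_intros assms)
  then have "bounded ((\<lambda>x. exp (v x)) ` {0..1})"
    by (intro compact_imp_bounded compact_continuous_image) auto
  then obtain B where "\<forall>y\<in>(\<lambda>x. exp (v x)) ` {0..1}. norm y \<le> B" unfolding bounded_iff by blast
  then show ?thesis
    using continuous_measurable_unit_interval[OF assms(2) c] space_unit_interval[OF assms(2)]
    by (intro finite_measure.integrable_const_bound[OF assms(1)]) auto
qed

lemma gibbs_density:
  assumes D: "prob_space D" "sets D = sets (restrict_space borel {0..1})" and v: "continuous_on {0..1} v"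
  shows "0 < (\<integral>y. exp (v y) \<partial>D)" "integrable D (gibbs D v)" "(\<integral>x. gibbs D v x \<partial>D) = 1" "0 < gibbs D v x"
proof -
  interpret prob_space D by fact
  have int: "integrable D (\<lambda>x. exp (v x))"
    by (rule integrable_exp_continuous[OF finite_measure_axioms D(2) v])
  have "(\<integral>y. 0 \<partial>D) < (\<integral>y. exp (v y) \<partial>D)"
    using int by (intro integral_less_AE_space) (auto simp: emeasure_space_1)
  then show pos: "0 < (\<integral>y. exp (v y) \<partial>D)" by simp
  show "integrable D (gibbs D v)" "(\<integral>x. gibbs D v x \<partial>D) = 1" "0 < gibbs D v x"
    unfolding gibbs_def[abs_def] using int pos by auto
qed

text \<open>The exponential and its normalising constant each change by a factor of at most
  \<open>exp \<eta>\<close>, hence \<open>2 * \<eta>\<close>. The lower bound is the upper bound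
  with the two functions exchanged.\<close>

lemma gibbs_ratio_bounds:
  assumes D: "prob_space D" "sets D = sets (restrict_space borel {0..1})"
    and v: "continuous_on {0..1} v" and v': "continuous_on {0..1} v'"
    and \<eta>: "\<And>x. x \<in> {0..1} \<Longrightarrow> \<bar>v x - v' x\<bar> \<le> \<eta>" and x: "x \<in> {0..1}"
  shows "exp (- (2 * \<eta>)) * gibbs D v' x \<le> gibbs D v x" "gibbs D v x \<le> exp (2 * \<eta>) * gibbs D v' x"
proof -
  interpret prob_space D by fact
  note fin = finite_measure_axioms
  have le: "(\<integral>y. exp (v y) \<partial>D) \<le> exp \<eta> * (\<integral>y. exp (v' y) \<partial>D)"
    if "continuous_on {0..1} v" "continuous_on {0..1} v'" "\<And>x. x \<in> {0..1} \<Longrightarrow> \<bar>v x - v' x\<bar> \<le> \<eta>" for v v'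
  proof -
    have "(\<integral>y. exp (v y) \<partial>D) \<le> (\<integral>y. exp \<eta> * exp (v' y) \<partial>D)"
    proof (intro integral_mono)
      show "integrable D (\<lambda>y. exp (v y))" by (rule integrable_exp_continuous[OF fin D(2) that(1)])
      show "integrable D (\<lambda>y. exp \<eta> * exp (v' y))"
        using integrable_exp_continuous[OF fin D(2) that(2)] by simp
      fix y assume "y \<in> space D"
      then show "exp (v y) \<le> exp \<eta> * exp (v' y)"
        using that(3)[of y] space_unit_interval[OF D(2)] by (simp add: abs_le_iff flip: exp_add)
    qed
    then show ?thesis by simp
  qed
  have main: "gibbs D v x \<le> exp (2 * \<eta>) * gibbs D v' x"
    if c: "continuous_on {0..1} v" "continuous_on {0..1} v'" and \<eta>: "\<And>x. x \<in> {0..1} \<Longrightarrow> \<bar>v x - v' x\<bar> \<le> \<eta>" for v v'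
  proof -
    define Z Z' where "Z = (\<integral>y. exp (v y) \<partial>D)" and "Z' = (\<integral>y. exp (v' y) \<partial>D)"
    have Z: "0 < Z" "0 < Z'" unfolding Z_def Z'_def by (intro gibbs_density[OF D] c)+
    have "Z' \<le> exp \<eta> * Z" unfolding Z_def Z'_def using \<eta> by (intro le c) (simp add: abs_minus_commute)
    moreover have "exp (v x) \<le> exp \<eta> * exp (v' x)" using \<eta>[OF x] by (simp add: abs_le_iff flip: exp_add)
    ultimately have "exp (v x) * Z' \<le> (exp \<eta> * exp (v' x)) * (exp \<eta> * Z)"
      using Z by (intro mult_mono) auto
    also have "\<dots> = exp (2 * \<eta>) * exp (v' x) * Z" by (simp add: exp_double power2_eq_square)
    finally show ?thesis using Z by (simp add: gibbs_def field_simps flip: Z_def Z'_def)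
  qed
  show "gibbs D v x \<le> exp (2 * \<eta>) * gibbs D v' x" by (rule main[OF v v' \<eta>])
  have "gibbs D v' x \<le> exp (2 * \<eta>) * gibbs D v x"
    using \<eta> by (intro main v v') (simp add: abs_minus_commute)
  then have "exp (- (2 * \<eta>)) * gibbs D v' x \<le> exp (- (2 * \<eta>)) * (exp (2 * \<eta>) * gibbs D v x)"
    by (intro mult_left_mono) auto
  then show "exp (- (2 * \<eta>)) * gibbs D v' x \<le> gibbs D v x"
    by (simp flip: mult.assoc exp_add)
qed

lemma measurable_eval_C01:
  assumes W: "W \<in> P \<rightarrow>\<^sub>M C01" and x: "x \<in> {0..1}"
  shows "(\<lambda>\<omega>. W \<omega> x) \<in> borel_measurable P"
proof -
  have "W \<in> P \<rightarrow>\<^sub>M (\<Pi>\<^sub>M x\<in>{0..1}. borel)"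
    using W unfolding C01_def by (simp add: measurable_restrict_space2_iff)
  from measurable_compose[OF this measurable_component_singleton[OF x]] show ?thesis .
qed

lemma continuous_on_C01:
  assumes W: "W \<in> P \<rightarrow>\<^sub>M C01" and \<omega>: "\<omega> \<in> space P"
  shows "continuous_on {0..1} (W \<omega>)"
  using measurable_space[OF W \<omega>] by (simp add: C01_def space_restrict_space)

text \<open>A function measurable in \<open>\<omega>\<close> and continuous in \<open>x\<close> is
  jointly measurable: it is the limit of its values at grid points, and each approximation is
  composed of countably many measurable pieces.\<close>

lemma measurable_joint_eval_C01:
  assumes W: "W \<in> P \<rightarrow>\<^sub>M C01" and D: "sets D = sets (restrict_space borel {0..1::real})"
  shows "(\<lambda>(\<omega>, x). W \<omega> x) \<in> borel_measurable (P \<Otimes>\<^sub>M D)"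
proof -
  \<comment> \<open>The pieces are indexed by all natural numbers \<open>i\<close>, including
    \<open>i > Suc j\<close>; the minimum keeps the grid point in the unit interval, where
    evaluation is known to be measurable.\<close>
  define g where "g j x = min 1 (real (nat \<lfloor>x * real (Suc j)\<rfloor>) / real (Suc j))" for j x
  have [measurable]: "(\<lambda>x. x) \<in> borel_measurable D"
    by (rule continuous_measurable_unit_interval[OF D]) (rule continuous_on_id)
  have g: "\<bar>g j x - x\<bar> \<le> 1 / real (Suc j)" if "x \<in> {0..1}" for j x
  proof -
    define y where "y = x * real (Suc j)"
    have y: "0 \<le> y" using that by (simp add: y_def)
    have 1: "real (nat \<lfloor>y\<rfloor>) \<le> y" "y < real (nat \<lfloor>y\<rfloor>) + 1" using y by linarith+
    have "real (nat \<lfloor>y\<rfloor>) / real (Suc j) \<le> y / real (Suc j)" "y / real (Suc j) \<le> (real (nat \<lfloor>y\<rfloor>) + 1) / real (Suc j)"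
      using 1 by (intro divide_right_mono; simp)+
    moreover have "y / real (Suc j) = x" by (simp add: y_def)
    ultimately have "real (nat \<lfloor>y\<rfloor>) / real (Suc j) \<le> x" "x \<le> real (nat \<lfloor>y\<rfloor>) / real (Suc j) + 1 / real (Suc j)"
      by (simp_all add: add_divide_distrib)
    moreover from this(1) have "g j x = real (nat \<lfloor>y\<rfloor>) / real (Suc j)"
      using that unfolding g_def y_def[symmetric] by (intro min.absorb2) (simp only: atLeastAtMost_iff, linarith)
    ultimately show ?thesis by (simp only: abs_le_iff) linarith
  qed
  have g01: "g j x \<in> {0..1}" for j x by (simp add: g_def)
  show ?thesis
  proof (rule borel_measurable_LIMSEQ_real[where u = "\<lambda>j z. W (fst z) (g j (snd z))"])
    fix j
    have "(\<lambda>z. W (fst z) (min 1 (real (nat \<lfloor>snd z * real (Suc j)\<rfloor>) / real (Suc j))))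
        \<in> borel_measurable (P \<Otimes>\<^sub>M D)"
    proof (rule measurable_compose_countable[where f = "\<lambda>i z. W (fst z) (min 1 (real i / real (Suc j)))"
          and g = "\<lambda>z. nat \<lfloor>snd z * real (Suc j)\<rfloor>"])
      fix i :: nat
      have "(\<lambda>\<omega>. W \<omega> (min 1 (real i / real (Suc j)))) \<in> borel_measurable P"
        by (rule measurable_eval_C01[OF W]) simp
      then show "(\<lambda>z. W (fst z) (min 1 (real i / real (Suc j)))) \<in> borel_measurable (P \<Otimes>\<^sub>M D)"
        by (rule measurable_compose[OF measurable_fst])
    qed measurable
    then show "(\<lambda>z. W (fst z) (g j (snd z))) \<in> borel_measurable (P \<Otimes>\<^sub>M D)"
      by (simp add: g_def)
  next
    fix z assume "z \<in> space (P \<Otimes>\<^sub>M D)"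
    then have z: "fst z \<in> space P" "snd z \<in> {0..1}"
      using space_unit_interval[OF D] by (auto simp: space_pair_measure)
    have "(\<lambda>j. g j (snd z) - snd z) \<longlonglongrightarrow> 0"
      by (rule Lim_null_comparison[OF always_eventually lim_1_over_n[THEN LIMSEQ_Suc]])
        (use g[OF z(2)] in auto)
    then have "(\<lambda>j. g j (snd z)) \<longlonglongrightarrow> snd z" by (rule LIM_zero_cancel)
    then have "(\<lambda>j. W (fst z) (g j (snd z))) \<longlonglongrightarrow> W (fst z) (snd z)"
      using continuous_on_C01[OF W z(1)] z(2) g01
      by (intro continuous_on_tendsto_compose[where f = "W (fst z)" and s = "{0..1}"]) auto
    then show "(\<lambda>j. W (fst z) (g j (snd z))) \<longlonglongrightarrow> (case z of (\<omega>, x) \<Rightarrow> W \<omega> x)"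
      by (simp add: split_beta')
  qed
qed

section \<open>Posterior mass under a cover of the parameter space\<close>

lemma ennreal_power_mono: "x \<le> y \<Longrightarrow> x ^ n \<le> y ^ n" for x y :: ennreal
  by (induction n) (auto intro: mult_mono)

lemma (in finite_measure) markov_inequality_real:
  assumes u: "u \<in> borel_measurable M" and le: "(\<integral>\<^sup>+x. u x \<partial>M) \<le> ennreal k" and "0 < c" "0 \<le> k"
  shows "measure M {x \<in> space M. ennreal c \<le> u x} \<le> k / c"
proof -
  have iff: "ennreal c \<le> u x \<longleftrightarrow> 1 \<le> ennreal (1 / c) * u x" for x
  proof
    assume "ennreal c \<le> u x"
    then have "ennreal (1 / c) * ennreal c \<le> ennreal (1 / c) * u x" by (intro mult_left_mono) auto
    then show "1 \<le> ennreal (1 / c) * u x" using \<open>0 < c\<close> by (simp flip: ennreal_mult)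
  next
    assume "1 \<le> ennreal (1 / c) * u x"
    then have "ennreal c * 1 \<le> ennreal c * (ennreal (1 / c) * u x)" by (intro mult_left_mono) auto
    then show "ennreal c \<le> u x" using \<open>0 < c\<close> by (simp flip: ennreal_mult mult.assoc)
  qed
  have "emeasure M {x \<in> space M. 1 \<le> ennreal (1 / c) * u x}
      \<le> ennreal (1 / c) * (\<integral>\<^sup>+x. u x * indicator (space M) x \<partial>M)"
    using u by (intro nn_integral_Markov_inequality) auto
  also have "(\<integral>\<^sup>+x. u x * indicator (space M) x \<partial>M) = (\<integral>\<^sup>+x. u x \<partial>M)"
    by (intro nn_integral_cong) auto
  also have "ennreal (1 / c) * \<dots> \<le> ennreal (1 / c) * ennreal k" by (intro mult_left_mono le) auto
  also have "\<dots> = ennreal (k / c)" using \<open>0 < c\<close> \<open>0 \<le> k\<close> by (simp flip: ennreal_mult)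
  finally show ?thesis using \<open>0 < c\<close> \<open>0 \<le> k\<close>
    unfolding iff emeasure_eq_measure by (simp add: ennreal_le_iff)
qed

text \<open>Tonelli interchanges prior and sample; for fixed \<open>\<omega>\<close> the sample
  integral factorises into one-dimensional ones. It is applied with \<open>g\<close> equal to the
  likelihood ratio, its inverse, and its quotient by a test statistic.\<close>

lemma nn_integral_prod_mixture_le:
  fixes g :: "'a \<Rightarrow> 'b \<Rightarrow> ennreal"
  assumes P: "sigma_finite_measure P" and D: "prob_space D" and "finite I"
    and g: "(\<lambda>(\<omega>, x). g \<omega> x) \<in> borel_measurable (P \<Otimes>\<^sub>M D)" and A: "A \<in> sets P"
    and q: "\<And>\<omega>. \<omega> \<in> A \<Longrightarrow> (\<integral>\<^sup>+x. g \<omega> x \<partial>D) \<le> q"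
  shows "(\<integral>\<^sup>+X. (\<integral>\<^sup>+\<omega>. (\<Prod>i\<in>I. g \<omega> (X i)) * indicator A \<omega> \<partial>P) \<partial>Pi\<^sub>M I (\<lambda>_. D))
      \<le> q ^ card I * emeasure P A"
    and "(\<lambda>X. \<integral>\<^sup>+\<omega>. (\<Prod>i\<in>I. g \<omega> (X i)) * indicator A \<omega> \<partial>P) \<in> borel_measurable (Pi\<^sub>M I (\<lambda>_. D))"
proof -
  interpret D: prob_space D by fact
  interpret P: sigma_finite_measure P by fact
  interpret S: product_sigma_finite "\<lambda>_. D" by standard
  interpret X: prob_space "Pi\<^sub>M I (\<lambda>_. D)" by (intro prob_space_PiM D)
  interpret PX: pair_sigma_finite P "Pi\<^sub>M I (\<lambda>_. D)" by standard
  note A[measurable]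
  have [measurable]: "(\<lambda>z. g (fst z) (snd z i)) \<in> borel_measurable (P \<Otimes>\<^sub>M Pi\<^sub>M I (\<lambda>_. D))"
    if "i \<in> I" for i
  proof -
    have "(\<lambda>z. (fst z, snd z i)) \<in> (P \<Otimes>\<^sub>M Pi\<^sub>M I (\<lambda>_. D)) \<rightarrow>\<^sub>M (P \<Otimes>\<^sub>M D)"
      using that by measurable
    from measurable_compose[OF this g] show ?thesis by simp
  qed
  have m: "(\<lambda>(\<omega>, X). (\<Prod>i\<in>I. g \<omega> (X i)) * indicator A \<omega>) \<in> borel_measurable (P \<Otimes>\<^sub>M Pi\<^sub>M I (\<lambda>_. D))"
    unfolding split_beta' by measurable
  then have m': "(\<lambda>(X, \<omega>). (\<Prod>i\<in>I. g \<omega> (X i)) * indicator A \<omega>) \<in> borel_measurable (Pi\<^sub>M I (\<lambda>_. D) \<Otimes>\<^sub>M P)"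
    by (subst measurable_pair_swap_iff) (simp add: split_beta')
  show "(\<lambda>X. \<integral>\<^sup>+\<omega>. (\<Prod>i\<in>I. g \<omega> (X i)) * indicator A \<omega> \<partial>P) \<in> borel_measurable (Pi\<^sub>M I (\<lambda>_. D))"
    using P.borel_measurable_nn_integral[OF m'] by simp
  have "(\<integral>\<^sup>+X. (\<integral>\<^sup>+\<omega>. (\<Prod>i\<in>I. g \<omega> (X i)) * indicator A \<omega> \<partial>P) \<partial>Pi\<^sub>M I (\<lambda>_. D))
      = (\<integral>\<^sup>+\<omega>. (\<integral>\<^sup>+X. (\<Prod>i\<in>I. g \<omega> (X i)) * indicator A \<omega> \<partial>Pi\<^sub>M I (\<lambda>_. D)) \<partial>P)"
    using PX.Fubini'[OF m] by simp
  also have "\<dots> \<le> (\<integral>\<^sup>+\<omega>. q ^ card I * indicator A \<omega> \<partial>P)"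
  proof (intro nn_integral_mono)
    fix \<omega> assume \<omega>: "\<omega> \<in> space P"
    have gm: "g \<omega> \<in> borel_measurable D"
      using measurable_Pair2[OF g \<omega>] by simp
    show "(\<integral>\<^sup>+X. (\<Prod>i\<in>I. g \<omega> (X i)) * indicator A \<omega> \<partial>Pi\<^sub>M I (\<lambda>_. D)) \<le> q ^ card I * indicator A \<omega>"
    proof (cases "\<omega> \<in> A")
      case True
      have "(\<integral>\<^sup>+X. (\<Prod>i\<in>I. g \<omega> (X i)) \<partial>Pi\<^sub>M I (\<lambda>_. D)) = (\<Prod>i\<in>I. \<integral>\<^sup>+x. g \<omega> x \<partial>D)"
        using \<open>finite I\<close> gm by (intro S.product_nn_integral_prod) auto
      also have "\<dots> \<le> q ^ card I" using q[OF True] by (simp add: ennreal_power_mono)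
      finally show ?thesis using True by simp
    qed simp
  qed
  also have "\<dots> = q ^ card I * emeasure P A"
    using A by (subst nn_integral_cmult_indicator) auto
  finally show "(\<integral>\<^sup>+X. (\<integral>\<^sup>+\<omega>. (\<Prod>i\<in>I. g \<omega> (X i)) * indicator A \<omega> \<partial>P) \<partial>Pi\<^sub>M I (\<lambda>_. D))
      \<le> q ^ card I * emeasure P A" .
qed

text \<open>The three summands are Markov bounds for three exceptional events: the denominator is
  too small (\<open>U\<close>, \<open>u\<close>, \<open>v\<close>, \<open>a\<close>), the leftover
  set \<open>E\<close> has too much likelihood (\<open>e\<close>, \<open>b1\<close>), or the cells
  have (\<open>s\<close>, \<open>q\<close>, \<open>b2\<close>). Outside them the numerator is at
  most \<open>b1 + b2^2 \<le> \<epsilon> * (u^2 / a)\<close>, which is at most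
  \<open>\<epsilon>\<close> times the denominator. The statistic \<open>t j\<close> is to separate
  the truth from the whole cell \<open>A j\<close> with error \<open>q\<close> per
  observation.\<close>

lemma posterior_mass_bound:
  fixes r :: "'a \<Rightarrow> 'b \<Rightarrow> real" and t :: "'c \<Rightarrow> 'b \<Rightarrow> real"
  assumes P: "prob_space P" and D: "prob_space D" and I: "finite I"
    and r[measurable]: "(\<lambda>(\<omega>, x). r \<omega> x) \<in> borel_measurable (P \<Otimes>\<^sub>M D)"
    and r_pos: "\<And>\<omega> x. \<omega> \<in> space P \<Longrightarrow> x \<in> space D \<Longrightarrow> 0 < r \<omega> x"
    and r_le: "\<And>\<omega>. \<omega> \<in> space P \<Longrightarrow> (\<integral>\<^sup>+x. ennreal (r \<omega> x) \<partial>D) \<le> 1"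
    and U: "U \<in> sets P" "0 < u" "u \<le> measure P U"
      "\<And>\<omega>. \<omega> \<in> U \<Longrightarrow> (\<integral>\<^sup>+x. ennreal (1 / r \<omega> x) \<partial>D) \<le> ennreal v" "0 \<le> v"
    and J: "finite J" "\<And>j. j \<in> J \<Longrightarrow> A j \<in> sets P" "\<And>j. j \<in> J \<Longrightarrow> 0 < s j"
      "\<And>j. j \<in> J \<Longrightarrow> measure P (A j) \<le> (s j)\<^sup>2"
    and t: "\<And>j. j \<in> J \<Longrightarrow> t j \<in> borel_measurable D" "\<And>j x. j \<in> J \<Longrightarrow> x \<in> space D \<Longrightarrow> 0 < t j x"
      "\<And>j. j \<in> J \<Longrightarrow> (\<integral>\<^sup>+x. ennreal (t j x) \<partial>D) \<le> ennreal q"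
      "\<And>j \<omega>. j \<in> J \<Longrightarrow> \<omega> \<in> A j \<Longrightarrow> (\<integral>\<^sup>+x. ennreal (r \<omega> x / t j x) \<partial>D) \<le> ennreal q" "0 \<le> q"
    and E: "E \<in> sets P" "measure P E \<le> e"
    and B: "B \<in> sets P" "B \<subseteq> E \<union> (\<Union>j\<in>J. A j)"
    and ab: "0 < a" "0 < b1" "0 < b2" "b1 + b2\<^sup>2 \<le> \<epsilon> * (u\<^sup>2 / a)" "0 < \<epsilon>"
    and H: "H \<subseteq> {X \<in> space (Pi\<^sub>M I (\<lambda>_. D)).
      ennreal \<epsilon> * (\<integral>\<^sup>+\<omega>. ennreal (\<Prod>i\<in>I. r \<omega> (X i)) \<partial>P)
        < (\<integral>\<^sup>+\<omega>. ennreal (\<Prod>i\<in>I. r \<omega> (X i)) * indicator B \<omega> \<partial>P)}"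
  shows "measure (Pi\<^sub>M I (\<lambda>_. D)) H
      \<le> v ^ card I / a + e / b1 + 2 * q ^ card I * (\<Sum>j\<in>J. s j) / b2"
proof -
  interpret P: prob_space P by fact
  interpret D: prob_space D by fact
  interpret S: product_sigma_finite "\<lambda>_. D" by standard
  interpret X: prob_space "Pi\<^sub>M I (\<lambda>_. D)" by (intro prob_space_PiM D)
  let ?M = "Pi\<^sub>M I (\<lambda>_. D)"
  have PX: "X i \<in> space D" if "X \<in> space ?M" "i \<in> I" for X i
    using that by (auto simp: space_PiM PiE_iff)
  define R where "R \<omega> X = (\<Prod>i\<in>I. r \<omega> (X i))" for \<omega> X
  have R_pos: "0 < R \<omega> X" if "\<omega> \<in> space P" "X \<in> space ?M" for \<omega> X
    unfolding R_def using that by (intro prod_pos r_pos PX) auto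
  have [measurable]: "(\<lambda>z. r (fst z) (snd z)) \<in> borel_measurable (P \<Otimes>\<^sub>M D)"
    using r by (simp add: split_beta')
  have r_m[measurable]: "(\<lambda>\<omega>. r \<omega> (X i)) \<in> borel_measurable P" if "X \<in> space ?M" "i \<in> I" for X i
    using measurable_Pair1[OF r PX[OF that]] by simp
  have R_m[measurable]: "(\<lambda>\<omega>. R \<omega> X) \<in> borel_measurable P" if "X \<in> space ?M" for X
    unfolding R_def using that by measurable
  note U(1)[measurable] J(2)[measurable] t(1)[measurable] E(1)[measurable] B(1)[measurable]
  define u1 where "u1 X = (\<integral>\<^sup>+\<omega>. (\<Prod>i\<in>I. ennreal (1 / r \<omega> (X i))) * indicator U \<omega> \<partial>P)" for X
  define u2 where "u2 X = (\<integral>\<^sup>+\<omega>. (\<Prod>i\<in>I. ennreal (r \<omega> (X i))) * indicator E \<omega> \<partial>P)" for X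
  define w where "w j X = (\<integral>\<^sup>+\<omega>. (\<Prod>i\<in>I. ennreal (r \<omega> (X i) / t j (X i))) * indicator (A j) \<omega> \<partial>P)" for j X
  define T where "T j X = (\<Prod>i\<in>I. ennreal (t j (X i)))" for j X
  \<comment> \<open>The means of \<open>T j\<close> and \<open>w j\<close> are at most
    \<open>q ^ n\<close> and \<open>q ^ n * (s j)^2\<close>; the factors \<open>s j\<close> and
    \<open>1 / s j\<close> bring both to \<open>q ^ n * s j\<close>. So the weight of a cell is the
    root of its prior mass, not the mass itself.\<close>
  define u3 where "u3 X = (\<Sum>j\<in>J. ennreal (s j) * T j X + ennreal (1 / s j) * w j X)" for X
  have u1: "u1 \<in> borel_measurable ?M" "(\<integral>\<^sup>+X. u1 X \<partial>?M) \<le> ennreal (v ^ card I)"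
  proof -
    have g: "(\<lambda>(\<omega>, x). ennreal (1 / r \<omega> x)) \<in> borel_measurable (P \<Otimes>\<^sub>M D)"
      unfolding split_beta' by measurable
    note * = nn_integral_prod_mixture_le[OF P.sigma_finite_measure_axioms D I g U(1) U(4)]
    show "u1 \<in> borel_measurable ?M" unfolding u1_def[abs_def] by (rule *(2))
    have "(\<integral>\<^sup>+X. u1 X \<partial>?M) \<le> ennreal v ^ card I * emeasure P U"
      unfolding u1_def by (rule *(1))
    also have "\<dots> \<le> ennreal v ^ card I * 1" by (intro mult_left_mono P.emeasure_le_1) auto
    finally show "(\<integral>\<^sup>+X. u1 X \<partial>?M) \<le> ennreal (v ^ card I)" using \<open>0 \<le> v\<close> by (simp add: ennreal_power)
  qed
  have rg: "(\<lambda>(\<omega>, x). ennreal (r \<omega> x)) \<in> borel_measurable (P \<Otimes>\<^sub>M D)"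
      unfolding split_beta' by measurable
  have u2: "u2 \<in> borel_measurable ?M" "(\<integral>\<^sup>+X. u2 X \<partial>?M) \<le> ennreal e"
  proof -
    have "(\<integral>\<^sup>+x. ennreal (r \<omega> x) \<partial>D) \<le> 1" if "\<omega> \<in> E" for \<omega>
      using that sets.sets_into_space[OF E(1)] by (intro r_le) auto
    note * = nn_integral_prod_mixture_le[OF P.sigma_finite_measure_axioms D I rg E(1) this]
    show "u2 \<in> borel_measurable ?M" unfolding u2_def[abs_def] by (rule *(2))
    have "(\<integral>\<^sup>+X. u2 X \<partial>?M) \<le> 1 ^ card I * emeasure P E"
      unfolding u2_def by (rule *(1)) auto
    also have "\<dots> \<le> ennreal e" using E by (simp add: P.emeasure_eq_measure ennreal_leI)
    finally show "(\<integral>\<^sup>+X. u2 X \<partial>?M) \<le> ennreal e" .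
  qed
  have w: "w j \<in> borel_measurable ?M" "(\<integral>\<^sup>+X. w j X \<partial>?M) \<le> ennreal (q ^ card I * (s j)\<^sup>2)" if j: "j \<in> J" for j
  proof -
    note t(1)[OF j, measurable]
    have g: "(\<lambda>(\<omega>, x). ennreal (r \<omega> x / t j x)) \<in> borel_measurable (P \<Otimes>\<^sub>M D)"
      unfolding split_beta' by measurable
    note * = nn_integral_prod_mixture_le[OF P.sigma_finite_measure_axioms D I g J(2)[OF j] t(4)[OF j]]
    show "w j \<in> borel_measurable ?M" unfolding w_def[abs_def] by (rule *(2))
    have "(\<integral>\<^sup>+X. w j X \<partial>?M) \<le> ennreal q ^ card I * emeasure P (A j)"
      unfolding w_def by (rule *(1))
    also have "\<dots> \<le> ennreal q ^ card I * ennreal ((s j)\<^sup>2)"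
      using J(4)[OF j] by (intro mult_left_mono) (auto simp: P.emeasure_eq_measure)
    finally show "(\<integral>\<^sup>+X. w j X \<partial>?M) \<le> ennreal (q ^ card I * (s j)\<^sup>2)"
      using \<open>0 \<le> q\<close> by (simp add: ennreal_power flip: ennreal_mult)
  qed
  have T: "T j \<in> borel_measurable ?M" "(\<integral>\<^sup>+X. T j X \<partial>?M) \<le> ennreal (q ^ card I)" if j: "j \<in> J" for j
  proof -
    note t(1)[OF j, measurable]
    show "T j \<in> borel_measurable ?M" unfolding T_def[abs_def] by measurable
    have "(\<integral>\<^sup>+X. T j X \<partial>?M) = (\<Prod>i\<in>I. \<integral>\<^sup>+x. ennreal (t j x) \<partial>D)"
      unfolding T_def using I by (intro S.product_nn_integral_prod) auto
    also have "\<dots> \<le> ennreal q ^ card I" using t(3)[OF j] by (simp add: ennreal_power_mono)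
    finally show "(\<integral>\<^sup>+X. T j X \<partial>?M) \<le> ennreal (q ^ card I)" using \<open>0 \<le> q\<close> by (simp add: ennreal_power)
  qed
  have u3: "u3 \<in> borel_measurable ?M" "(\<integral>\<^sup>+X. u3 X \<partial>?M) \<le> ennreal (2 * q ^ card I * (\<Sum>j\<in>J. s j))"
  proof -
    note w(1)[measurable] T(1)[measurable]
    show "u3 \<in> borel_measurable ?M" unfolding u3_def[abs_def] by measurable
    have "(\<integral>\<^sup>+X. u3 X \<partial>?M) = (\<Sum>j\<in>J. (\<integral>\<^sup>+X. ennreal (s j) * T j X + ennreal (1 / s j) * w j X \<partial>?M))"
      unfolding u3_def by (intro nn_integral_sum) measurable
    also have "\<dots> = (\<Sum>j\<in>J. ennreal (s j) * (\<integral>\<^sup>+X. T j X \<partial>?M) + ennreal (1 / s j) * (\<integral>\<^sup>+X. w j X \<partial>?M))"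
      by (intro sum.cong refl) (simp add: nn_integral_add nn_integral_cmult T w)
    also have "\<dots> \<le> (\<Sum>j\<in>J. ennreal (s j) * ennreal (q ^ card I) + ennreal (1 / s j) * ennreal (q ^ card I * (s j)\<^sup>2))"
      by (intro sum_mono add_mono mult_left_mono T w) auto
    also have "\<dots> = (\<Sum>j\<in>J. ennreal (2 * q ^ card I * s j))"
    proof (intro sum.cong refl)
      fix j assume "j \<in> J"
      then have "0 < s j" by (rule J)
      then show "ennreal (s j) * ennreal (q ^ card I) + ennreal (1 / s j) * ennreal (q ^ card I * (s j)\<^sup>2)
          = ennreal (2 * q ^ card I * s j)"
        using \<open>0 \<le> q\<close> by (simp add: power2_eq_square flip: ennreal_mult ennreal_plus)
    qed
    also have "\<dots> = ennreal (2 * q ^ card I * (\<Sum>j\<in>J. s j))"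
      using J(3) \<open>0 \<le> q\<close> by (subst sum_ennreal) (auto simp: sum_distrib_left less_imp_le)
    finally show "(\<integral>\<^sup>+X. u3 X \<partial>?M) \<le> ennreal (2 * q ^ card I * (\<Sum>j\<in>J. s j))" .
  qed
  define Den where "Den X = (\<integral>\<^sup>+\<omega>. ennreal (R \<omega> X) \<partial>P)" for X
  define Num where "Num X = (\<integral>\<^sup>+\<omega>. ennreal (R \<omega> X) * indicator B \<omega> \<partial>P)" for X
  \<comment> \<open>\<open>R + c\<^sup>2 / R \<ge> 2 c\<close> with \<open>c = u / a\<close> plays the role of the Cauchy--Schwarz inequality.\<close>
  have Den_ge: "ennreal (u\<^sup>2 / a) \<le> Den X" if X: "X \<in> space ?M" and "u1 X < ennreal a" for X
  proof -
    define c where "c = u / a"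
    have c: "0 < c" using ab U by (simp add: c_def)
    have "ennreal (2 * c * u) \<le> ennreal (2 * c) * emeasure P U"
      using U c by (simp add: ennreal_mult P.emeasure_eq_measure mult_left_mono)
    also have "\<dots> = (\<integral>\<^sup>+\<omega>. ennreal (2 * c) * indicator U \<omega> \<partial>P)"
      using U(1) by (simp add: nn_integral_cmult_indicator)
    also have "\<dots> \<le> (\<integral>\<^sup>+\<omega>. ennreal (R \<omega> X) + ennreal (c\<^sup>2) * ((\<Prod>i\<in>I. ennreal (1 / r \<omega> (X i))) * indicator U \<omega>) \<partial>P)"
    proof (intro nn_integral_mono)
      fix \<omega> assume \<omega>: "\<omega> \<in> space P"
      note Rp = R_pos[OF \<omega> X]
      have "(\<Prod>i\<in>I. ennreal (1 / r \<omega> (X i))) = ennreal (1 / R \<omega> X)"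
        by (subst prod_ennreal) (use r_pos[OF \<omega> PX[OF X]] in \<open>auto simp: R_def prod_dividef less_imp_le\<close>)
      moreover have "2 * c \<le> R \<omega> X + c\<^sup>2 * (1 / R \<omega> X)"
      proof -
        have "0 \<le> (R \<omega> X - c)\<^sup>2 / R \<omega> X" using Rp by simp
        also have "\<dots> = R \<omega> X + c\<^sup>2 * (1 / R \<omega> X) - 2 * c"
          using Rp by (simp add: field_simps power2_eq_square)
        finally show ?thesis by simp
      qed
      ultimately show "ennreal (2 * c) * indicator U \<omega> \<le>
          ennreal (R \<omega> X) + ennreal (c\<^sup>2) * ((\<Prod>i\<in>I. ennreal (1 / r \<omega> (X i))) * indicator U \<omega>)"
        using Rp c by (auto simp: indicator_def simp flip: ennreal_mult ennreal_plus intro!: ennreal_leI)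
    qed
    also have "\<dots> = Den X + ennreal (c\<^sup>2) * u1 X"
      unfolding Den_def u1_def using X
      by (subst nn_integral_add) (auto simp: nn_integral_cmult)
    also have "\<dots> \<le> Den X + ennreal (c\<^sup>2) * ennreal a"
      using that by (intro add_left_mono mult_left_mono) auto
    finally have *: "ennreal (2 * c * u) \<le> Den X + ennreal (c\<^sup>2 * a)" using ab by (simp add: ennreal_mult)
    show ?thesis
    proof (cases "Den X")
      case (real d)
      then have "2 * c * u \<le> d + c\<^sup>2 * a" using * ab by (simp flip: ennreal_plus)
      then have "u\<^sup>2 / a \<le> d" using ab by (simp add: c_def field_simps power2_eq_square)
      then show ?thesis using real by (simp add: ennreal_leI)
    qed auto
  qed
  have Num_le: "Num X \<le> u2 X + (u3 X)\<^sup>2" if X: "X \<in> space ?M" for X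
  proof -
    have RT: "ennreal (R \<omega> X) = T j X * (\<Prod>i\<in>I. ennreal (r \<omega> (X i) / t j (X i)))"
      if "\<omega> \<in> space P" "j \<in> J" for \<omega> j
      unfolding T_def R_def prod.distrib[symmetric]
    proof (subst prod_ennreal[symmetric])
      show "0 \<le> r \<omega> (X i)" if "i \<in> I" for i
        using r_pos[OF \<open>\<omega> \<in> space P\<close> PX[OF X that]] by simp
      show "(\<Prod>i\<in>I. ennreal (r \<omega> (X i))) = (\<Prod>i\<in>I. ennreal (t j (X i)) * ennreal (r \<omega> (X i) / t j (X i)))"
      proof (intro prod.cong refl)
        fix i assume "i \<in> I"
        then show "ennreal (r \<omega> (X i)) = ennreal (t j (X i)) * ennreal (r \<omega> (X i) / t j (X i))"
          using r_pos[OF \<open>\<omega> \<in> space P\<close> PX[OF X]] t(2)[OF \<open>j \<in> J\<close> PX[OF X]]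
          by (simp add: less_imp_le less_imp_neq[symmetric] flip: ennreal_mult)
      qed
    qed
    have tm: "(\<lambda>\<omega>. \<Prod>i\<in>I. ennreal (r \<omega> (X i) / t j (X i))) \<in> borel_measurable P" for j
      using X by measurable
    have "Num X \<le> (\<integral>\<^sup>+\<omega>. (\<Prod>i\<in>I. ennreal (r \<omega> (X i))) * indicator E \<omega>
        + (\<Sum>j\<in>J. T j X * ((\<Prod>i\<in>I. ennreal (r \<omega> (X i) / t j (X i))) * indicator (A j) \<omega>)) \<partial>P)"
      unfolding Num_def
    proof (intro nn_integral_mono)
      fix \<omega> assume \<omega>: "\<omega> \<in> space P"
      have "ennreal (R \<omega> X) * indicator B \<omega> \<le> ennreal (R \<omega> X) * indicator E \<omega> + (\<Sum>j\<in>J. ennreal (R \<omega> X) * indicator (A j) \<omega>)"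
      proof (cases "\<omega> \<in> B - E")
        case True
        then obtain j where "j \<in> J" "\<omega> \<in> A j" using B by auto
        then have "ennreal (R \<omega> X) \<le> (\<Sum>j\<in>J. ennreal (R \<omega> X) * indicator (A j) \<omega>)"
          using member_le_sum[of j J "\<lambda>j. ennreal (R \<omega> X) * indicator (A j) \<omega>"] J(1) by simp
        then show ?thesis using True by (simp add: add_increasing)
      qed (auto simp: indicator_def)
      also have "ennreal (R \<omega> X) * indicator E \<omega> = (\<Prod>i\<in>I. ennreal (r \<omega> (X i))) * indicator E \<omega>"
        unfolding R_def using r_pos[OF \<omega> PX[OF X]] by (simp add: prod_ennreal less_imp_le)
      also have "(\<Sum>j\<in>J. ennreal (R \<omega> X) * indicator (A j) \<omega>) =
          (\<Sum>j\<in>J. T j X * ((\<Prod>i\<in>I. ennreal (r \<omega> (X i) / t j (X i))) * indicator (A j) \<omega>))"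
        using RT[OF \<omega>] by (intro sum.cong refl) (simp add: mult_ac)
      finally show "ennreal (R \<omega> X) * indicator B \<omega> \<le> (\<Prod>i\<in>I. ennreal (r \<omega> (X i))) * indicator E \<omega>
        + (\<Sum>j\<in>J. T j X * ((\<Prod>i\<in>I. ennreal (r \<omega> (X i) / t j (X i))) * indicator (A j) \<omega>))" .
    qed
    also have "\<dots> = u2 X + (\<Sum>j\<in>J. T j X * w j X)"
      unfolding u2_def w_def using X tm
      by (subst nn_integral_add) (auto simp: nn_integral_cmult nn_integral_sum J)
    \<comment> \<open>A sum of products \<open>x * y\<close> of nonnegative terms is at most the
      square of the sum of all \<open>x + y\<close>. This replaces square roots and division by
      \<open>T j X\<close>, which may be awkward in extended reals.\<close>
    also have "(\<Sum>j\<in>J. T j X * w j X) \<le> (\<Sum>j\<in>J. (ennreal (s j) * T j X) * u3 X)"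
    proof (intro sum_mono)
      fix j assume j: "j \<in> J"
      have "T j X * w j X = (ennreal (s j) * T j X) * (ennreal (1 / s j) * w j X)"
      proof -
        have "ennreal (s j) * ennreal (1 / s j) = 1" using J(3)[OF j] by (simp flip: ennreal_mult)
        then show ?thesis by (metis mult.assoc mult.left_commute mult.right_neutral)
      qed
      also have "\<dots> \<le> (ennreal (s j) * T j X) * u3 X"
      proof (intro mult_left_mono)
        have "ennreal (1 / s j) * w j X \<le> ennreal (s j) * T j X + ennreal (1 / s j) * w j X"
          by (simp add: add_increasing)
        also have "\<dots> \<le> u3 X" unfolding u3_def by (rule member_le_sum) (use J j in auto)
        finally show "ennreal (1 / s j) * w j X \<le> u3 X" .
      qed auto
      finally show "T j X * w j X \<le> (ennreal (s j) * T j X) * u3 X" .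
    qed
    also have "\<dots> = (\<Sum>j\<in>J. ennreal (s j) * T j X) * u3 X" by (simp add: sum_distrib_right)
    also have "\<dots> \<le> u3 X * u3 X"
      by (intro mult_right_mono) (auto simp: u3_def sum.distrib add_increasing2)
    finally show ?thesis by (simp add: power2_eq_square add_left_mono)
  qed
  let ?E1 = "{X \<in> space ?M. ennreal a \<le> u1 X}" and ?E2 = "{X \<in> space ?M. ennreal b1 \<le> u2 X}"
    and ?E3 = "{X \<in> space ?M. ennreal b2 \<le> u3 X}"
  \<comment> \<open>Measurability is established for the three covering events only, and
    monotonicity of \<open>measure\<close> asks for no more.\<close>
  have "measure ?M H \<le> measure ?M (?E1 \<union> ?E2 \<union> ?E3)"
  proof (rule X.finite_measure_mono)
    show "?E1 \<union> ?E2 \<union> ?E3 \<in> sets ?M" using u1(1) u2(1) u3(1) by measurable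
    have "H \<subseteq> {X \<in> space ?M. ennreal \<epsilon> * Den X < Num X}"
      using H unfolding Den_def Num_def R_def .
    also have "\<dots> \<subseteq> ?E1 \<union> ?E2 \<union> ?E3"
    proof safe
      fix X assume X: "X \<in> space ?M" and lt: "ennreal \<epsilon> * Den X < Num X" and n3: "\<not> ennreal b2 \<le> u3 X"
        and n2: "\<not> ennreal b1 \<le> u2 X"
      show "ennreal a \<le> u1 X"
      proof (rule ccontr)
        assume "\<not> ennreal a \<le> u1 X"
        then have "ennreal (u\<^sup>2 / a) \<le> Den X" by (intro Den_ge X) auto
        then have "ennreal \<epsilon> * ennreal (u\<^sup>2 / a) \<le> ennreal \<epsilon> * Den X" by (intro mult_left_mono) auto
        moreover have "Num X \<le> ennreal b1 + (ennreal b2)\<^sup>2"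
          using n2 n3 by (intro order_trans[OF Num_le[OF X]] add_mono ennreal_power_mono) auto
        moreover have "ennreal b1 + (ennreal b2)\<^sup>2 \<le> ennreal \<epsilon> * ennreal (u\<^sup>2 / a)"
          using ab by (simp add: ennreal_power flip: ennreal_mult ennreal_plus)
        ultimately show False using lt by auto
      qed
    qed
    finally show "H \<subseteq> ?E1 \<union> ?E2 \<union> ?E3" .
  qed
  also have "\<dots> \<le> measure ?M ?E1 + measure ?M ?E2 + measure ?M ?E3"
  proof -
    have "?E1 \<in> sets ?M" "?E2 \<in> sets ?M" "?E3 \<in> sets ?M"
      using u1(1) u2(1) u3(1) by measurable
    then show ?thesis by (intro order_trans[OF measure_Un_le] add_mono measure_Un_le order_refl) auto
  qed
  also have "\<dots> \<le> v ^ card I / a + e / b1 + 2 * q ^ card I * (\<Sum>j\<in>J. s j) / b2"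
  proof -
    have "0 \<le> e" using E(2) order_trans[OF measure_nonneg] by blast
    moreover have "0 \<le> (\<Sum>j\<in>J. s j)" using J(3) by (intro sum_nonneg) (auto intro: less_imp_le)
    ultimately show ?thesis using ab U(5) t(5)
      by (intro add_mono X.markov_inequality_real u1 u2 u3) auto
  qed
  finally show ?thesis .
qed

section \<open>Posterior contraction\<close>

text \<open>Isolates the Bayesian part of the argument: only the continuity and measurability of
  \<open>W\<close> enter here, not its wavelet series.\<close>

locale density_model =
  fixes \<nu> :: "real measure" and \<pi>0 :: "real \<Rightarrow> real" and P :: "'a measure" and W :: "'a \<Rightarrow> real \<Rightarrow> real"
  assumes fin: "finite_measure \<nu>" and sets_nu: "sets \<nu> = sets (restrict_space borel {0..1})"
    and P: "prob_space P" and W: "W \<in> P \<rightarrow>\<^sub>M C01"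
    and pi0_pos: "\<And>x. x \<in> {0..1} \<Longrightarrow> 0 < \<pi>0 x" and pi0_int: "(\<integral>x. \<pi>0 x \<partial>\<nu>) = 1"
    and pi0_cont: "continuous_on {0..1} (\<lambda>x. ln (\<pi>0 x))"
begin

text \<open>\<open>F\<close> is the random density and \<open>r\<close> its ratio to \<open>\<pi>0\<close>; dividing by \<open>\<pi>0\<close> does not change the
  posterior and makes every expectation one under the true distribution \<open>D\<close>.\<close>

definition D :: "real measure" where
  "D = density \<nu> (\<lambda>x. ennreal (\<pi>0 x))"

definition r :: "'a \<Rightarrow> real \<Rightarrow> real" where
  "r \<omega> = gibbs D (\<lambda>x. W \<omega> x - ln (\<pi>0 x))"

definition F :: "'a \<Rightarrow> real \<Rightarrow> real" where
  "F \<omega> = (\<lambda>x\<in>{0..1}. exp (W \<omega> x) / (\<integral>y. exp (W \<omega> y) \<partial>\<nu>))"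

sublocale P: prob_space P by (rule P)

lemma space_nu: "space \<nu> = {0..1}"
  by (rule space_unit_interval[OF sets_nu])

lemma pi0_measurable[measurable]: "\<pi>0 \<in> borel_measurable \<nu>"
proof -
  have "(\<lambda>x. exp (ln (\<pi>0 x))) \<in> borel_measurable \<nu>"
    by (intro continuous_measurable_unit_interval[OF sets_nu] continuous_intros pi0_cont)
  then show ?thesis
    by (rule measurable_cong[THEN iffD1, rotated]) (use pi0_pos space_nu in auto)
qed

lemma sets_D: "sets D = sets (restrict_space borel {0..1})"
  by (simp add: D_def sets_nu)

lemma space_D: "space D = {0..1}"
  by (rule space_unit_interval[OF sets_D])

lemma prob_space_D: "prob_space D"
proof
  \<comment> \<open>A Bochner integral with value 1 forces integrability, because non-integrable
    functions have integral 0 by convention.\<close>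
  have "integrable \<nu> \<pi>0" using pi0_int not_integrable_integral_eq by fastforce
  then have "(\<integral>\<^sup>+x. ennreal (\<pi>0 x) \<partial>\<nu>) = ennreal 1"
    unfolding pi0_int[symmetric] using pi0_pos space_nu
    by (intro nn_integral_eq_integral) (auto intro!: AE_I2 less_imp_le)
  moreover have "emeasure D (space D) = (\<integral>\<^sup>+x. ennreal (\<pi>0 x) * indicator (space \<nu>) x \<partial>\<nu>)"
    unfolding D_def by (subst emeasure_density) auto
  moreover have "\<dots> = (\<integral>\<^sup>+x. ennreal (\<pi>0 x) \<partial>\<nu>)" by (intro nn_integral_cong) auto
  ultimately show "emeasure D (space D) = 1" by simp
qed

sublocale D: prob_space D by (rule prob_space_D)

lemma W_cont: "\<omega> \<in> space P \<Longrightarrow> continuous_on {0..1} (W \<omega>)"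
  by (rule continuous_on_C01[OF W])

lemma v_cont: "\<omega> \<in> space P \<Longrightarrow> continuous_on {0..1} (\<lambda>x. W \<omega> x - ln (\<pi>0 x))"
  by (intro continuous_intros W_cont pi0_cont)

lemma integral_D_exp:
  assumes "\<omega> \<in> space P"
  shows "(\<integral>x. exp (W \<omega> x - ln (\<pi>0 x)) \<partial>D) = (\<integral>x. exp (W \<omega> x) \<partial>\<nu>)"
proof -
  have "(\<integral>x. exp (W \<omega> x - ln (\<pi>0 x)) \<partial>D) = (\<integral>x. \<pi>0 x *\<^sub>R exp (W \<omega> x - ln (\<pi>0 x)) \<partial>\<nu>)"
    unfolding D_def
  proof (rule integral_density)
    show "(\<lambda>x. exp (W \<omega> x - ln (\<pi>0 x))) \<in> borel_measurable \<nu>"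
      by (intro continuous_measurable_unit_interval[OF sets_nu] continuous_intros v_cont assms)
  qed (use pi0_pos space_nu in \<open>auto intro!: AE_I2 less_imp_le\<close>)
  also have "\<dots> = (\<integral>x. exp (W \<omega> x) \<partial>\<nu>)"
  proof (intro Bochner_Integration.integral_cong refl)
    fix x assume "x \<in> space \<nu>"
    then have "0 < \<pi>0 x" using pi0_pos space_nu by auto
    then show "\<pi>0 x *\<^sub>R exp (W \<omega> x - ln (\<pi>0 x)) = exp (W \<omega> x)" by (simp add: exp_diff)
  qed
  finally show ?thesis .
qed

lemma F_eq:
  assumes "\<omega> \<in> space P" "x \<in> {0..1}"
  shows "F \<omega> x = r \<omega> x * \<pi>0 x"
proof -
  have "r \<omega> x = exp (W \<omega> x - ln (\<pi>0 x)) / (\<integral>y. exp (W \<omega> y) \<partial>\<nu>)"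
    by (simp only: r_def gibbs_def integral_D_exp[OF assms(1)])
  then show ?thesis using assms(2) pi0_pos[OF assms(2)] by (simp add: F_def exp_diff)
qed

lemma r_pos: "\<omega> \<in> space P \<Longrightarrow> 0 < r \<omega> x"
  unfolding r_def by (intro gibbs_density[OF D.prob_space_axioms sets_D] v_cont)

lemma r_integral: "\<omega> \<in> space P \<Longrightarrow> integrable D (r \<omega>)" "\<omega> \<in> space P \<Longrightarrow> (\<integral>x. r \<omega> x \<partial>D) = 1"
  unfolding r_def by (intro gibbs_density[OF D.prob_space_axioms sets_D] v_cont; assumption)+

lemma r_measurable: "(\<lambda>(\<omega>, x). r \<omega> x) \<in> borel_measurable (P \<Otimes>\<^sub>M D)"
proof -
  have [measurable]: "(\<lambda>z. W (fst z) (snd z)) \<in> borel_measurable (P \<Otimes>\<^sub>M D)"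
    using measurable_joint_eval_C01[OF W sets_D] by (simp add: split_beta')
  have [measurable]: "(\<lambda>x. ln (\<pi>0 x)) \<in> borel_measurable D"
    by (rule continuous_measurable_unit_interval[OF sets_D pi0_cont])
  have e: "(\<lambda>(\<omega>, x). exp (W \<omega> x - ln (\<pi>0 x))) \<in> borel_measurable (P \<Otimes>\<^sub>M D)"
    unfolding split_beta' by measurable
  have [measurable]: "(\<lambda>\<omega>. \<integral>x. exp (W \<omega> x - ln (\<pi>0 x)) \<partial>D) \<in> borel_measurable P"
    by (rule D.borel_measurable_lebesgue_integral[OF e])
  show ?thesis unfolding r_def gibbs_def split_beta' by measurable
qed

lemma F_measurable: "F \<in> P \<rightarrow>\<^sub>M C01"
  unfolding C01_def
proof (rule measurable_restrict_space2)
  have "(\<lambda>\<omega>. \<integral>y. exp (W \<omega> y) \<partial>\<nu>) \<in> borel_measurable P"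
  proof -
    have [measurable]: "(\<lambda>z. W (fst z) (snd z)) \<in> borel_measurable (P \<Otimes>\<^sub>M \<nu>)"
      using measurable_joint_eval_C01[OF W sets_nu] by (simp add: split_beta')
    have "(\<lambda>(\<omega>, x). exp (W \<omega> x)) \<in> borel_measurable (P \<Otimes>\<^sub>M \<nu>)"
      unfolding split_beta' by measurable
    then show ?thesis
      by (rule sigma_finite_measure.borel_measurable_lebesgue_integral[rotated])
        (rule finite_measure.sigma_finite_measure[OF fin])
  qed
  moreover have "(\<lambda>\<omega>. exp (W \<omega> x)) \<in> borel_measurable P" if "x \<in> {0..1}" for x
    by (rule measurable_compose[OF measurable_eval_C01[OF W that] borel_measurable_exp])
  ultimately show "F \<in> P \<rightarrow>\<^sub>M (\<Pi>\<^sub>M x\<in>{0..1}. borel)"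
    unfolding F_def[abs_def] by (intro measurable_restrict borel_measurable_divide) auto
  show "F \<in> space P \<rightarrow> {f. continuous_on {0..1} f}"
  proof
    fix \<omega> assume \<omega>: "\<omega> \<in> space P"
    have "0 < (\<integral>y. exp (W \<omega> y) \<partial>\<nu>)"
      using gibbs_density(1)[OF D.prob_space_axioms sets_D v_cont[OF \<omega>]] by (simp add: integral_D_exp[OF \<omega>])
    then have "continuous_on {0..1} (\<lambda>x. exp (W \<omega> x) / (\<integral>y. exp (W \<omega> y) \<partial>\<nu>))"
      by (intro continuous_intros W_cont \<omega>) auto
    then have "continuous_on {0..1} (F \<omega>)"
      by (rule continuous_on_cong[THEN iffD1, rotated -1]) (auto simp: F_def)
    then show "F \<omega> \<in> {f. continuous_on {0..1} f}" by simp
  qed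
qed

text \<open>Relative to the true distribution, the Hellinger distance is the \<open>L_2\<close>
  distance of \<open>sqrt r\<close> from 1, the form used by
  \<open>sqrt_likelihood_ratio_test\<close>.\<close>

lemma hellinger_F:
  assumes \<omega>: "\<omega> \<in> space P"
  shows "(hellinger \<nu> (F \<omega>) \<pi>0)\<^sup>2 = (\<integral>x. (sqrt (r \<omega> x) - 1)\<^sup>2 \<partial>D)"
proof -
  have rm: "r \<omega> \<in> borel_measurable \<nu>"
    using r_integral(1)[OF \<omega>] unfolding integrable_iff_bounded by (simp add: D_def)
  have "(\<integral>x. (sqrt (r \<omega> x) - 1)\<^sup>2 \<partial>D) = (\<integral>x. \<pi>0 x *\<^sub>R (sqrt (r \<omega> x) - 1)\<^sup>2 \<partial>\<nu>)"
    unfolding D_def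
  proof (rule integral_density)
    show "(\<lambda>x. (sqrt (r \<omega> x) - 1)\<^sup>2) \<in> borel_measurable \<nu>" using rm by measurable
  qed (use pi0_pos space_nu in \<open>auto intro!: AE_I2 less_imp_le\<close>)
  also have "\<dots> = (\<integral>x. (sqrt (F \<omega> x) - sqrt (\<pi>0 x))\<^sup>2 \<partial>\<nu>)"
  proof (intro Bochner_Integration.integral_cong refl)
    fix x assume "x \<in> space \<nu>"
    then have x: "x \<in> {0..1}" using space_nu by simp
    have "sqrt (F \<omega> x) - sqrt (\<pi>0 x) = sqrt (\<pi>0 x) * (sqrt (r \<omega> x) - 1)"
      unfolding F_eq[OF \<omega> x] by (simp add: real_sqrt_mult algebra_simps)
    then show "\<pi>0 x *\<^sub>R (sqrt (r \<omega> x) - 1)\<^sup>2 = (sqrt (F \<omega> x) - sqrt (\<pi>0 x))\<^sup>2"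
      using pi0_pos[OF x] by (simp add: power_mult_distrib)
  qed
  finally show ?thesis
    unfolding hellinger_def by (simp add: Bochner_Integration.integral_nonneg)
qed

text \<open>Measurability of \<open>B\<close> comes for free, since a non-measurable set has measure
  0 and cannot exceed \<open>\<epsilon>\<close>; that of the Hellinger distance need not be proved.
  The second claim is Bayes' formula after cancelling the likelihood of \<open>\<pi>0\<close>,
  multiplied out so that it stays meaningful for a degenerate denominator.\<close>

lemma posterior_gt_imp:
  fixes n :: nat
  assumes X: "X \<in> space (Pi\<^sub>M {1..n} (\<lambda>_. D))" and "0 < \<epsilon>"
    and gt: "\<epsilon> < measure (posterior (density_prior P \<nu> W) n X) B"
  shows "B \<in> sets C01" and "ennreal \<epsilon> * (\<integral>\<^sup>+\<omega>. ennreal (\<Prod>i\<in>{1..n}. r \<omega> (X i)) \<partial>P)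
    < (\<integral>\<^sup>+\<omega>. ennreal (\<Prod>i\<in>{1..n}. r \<omega> (X i)) * indicator {\<omega> \<in> space P. F \<omega> \<in> B} \<omega> \<partial>P)"
proof -
  have Q: "density_prior P \<nu> W = distr P C01 F"
    unfolding density_prior_def F_def[abs_def] ..
  have X01: "X i \<in> {0..1}" if "i \<in> {1..n}" for i
    using X that space_D by (auto simp: space_PiM PiE_iff)
  show B: "B \<in> sets C01"
  proof (rule ccontr)
    assume "B \<notin> sets C01"
    then have "measure (posterior (density_prior P \<nu> W) n X) B = 0"
      by (intro measure_notin_sets) (simp add: posterior_def Q)
    then show False using gt \<open>0 < \<epsilon>\<close> by simp
  qed
  define Den where "Den = (\<integral>\<^sup>+\<omega>. ennreal (\<Prod>i\<in>{1..n}. r \<omega> (X i)) \<partial>P)"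
  define Num where "Num = (\<integral>\<^sup>+\<omega>. ennreal (\<Prod>i\<in>{1..n}. r \<omega> (X i)) * indicator {\<omega> \<in> space P. F \<omega> \<in> B} \<omega> \<partial>P)"
  define L where "L = ennreal (\<Prod>i\<in>{1..n}. \<pi>0 (X i))"
  have lik: "ennreal (likelihood n X (F \<omega>)) = L * ennreal (\<Prod>i\<in>{1..n}. r \<omega> (X i))" if "\<omega> \<in> space P" for \<omega>
  proof -
    have "likelihood n X (F \<omega>) = (\<Prod>i\<in>{1..n}. \<pi>0 (X i) * r \<omega> (X i))"
      unfolding likelihood_def using F_eq[OF that X01] by (intro prod.cong) auto
    moreover have "0 \<le> (\<Prod>i\<in>{1..n}. \<pi>0 (X i))" using pi0_pos X01 by (intro prod_nonneg) (auto intro: less_imp_le)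
    ultimately show ?thesis by (simp add: L_def prod.distrib ennreal_mult')
  qed
  have C01_eval: "(\<lambda>f. f x) \<in> borel_measurable C01" if "x \<in> {0..1}" for x :: real
    using measurable_eval_C01[OF measurable_ident that] by simp
  have lik_m[measurable]: "(\<lambda>f. ennreal (likelihood n X f)) \<in> borel_measurable C01"
    unfolding likelihood_def using C01_eval X01 by (intro measurable_compose[OF _ measurable_ennreal] borel_measurable_prod) auto
  have r_m: "(\<lambda>\<omega>. r \<omega> x) \<in> borel_measurable P" if "x \<in> {0..1}" for x
    using measurable_Pair1[OF r_measurable, of x] that space_D by simp
  have R_m[measurable]: "(\<lambda>\<omega>. ennreal (\<Prod>i\<in>{1..n}. r \<omega> (X i))) \<in> borel_measurable P"
    using r_m X01 by (intro measurable_compose[OF _ measurable_ennreal] borel_measurable_prod) auto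
  note F_measurable[measurable] B[measurable]
  have c: "(\<integral>\<^sup>+g. ennreal (likelihood n X g) \<partial>distr P C01 F) = L * Den"
  proof -
    have "(\<integral>\<^sup>+g. ennreal (likelihood n X g) \<partial>distr P C01 F) = (\<integral>\<^sup>+\<omega>. ennreal (likelihood n X (F \<omega>)) \<partial>P)"
      by (rule nn_integral_distr) measurable
    also have "\<dots> = (\<integral>\<^sup>+\<omega>. L * ennreal (\<Prod>i\<in>{1..n}. r \<omega> (X i)) \<partial>P)"
      by (intro nn_integral_cong lik)
    also have "\<dots> = L * Den" unfolding Den_def by (rule nn_integral_cmult) measurable
    finally show ?thesis .
  qed
  have "emeasure (posterior (density_prior P \<nu> W) n X) B
      = (\<integral>\<^sup>+f. ennreal (likelihood n X f) / (L * Den) * indicator B f \<partial>distr P C01 F)"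
    unfolding posterior_def Q c using B by (subst emeasure_density) auto
  also have "\<dots> = (\<integral>\<^sup>+\<omega>. ennreal (likelihood n X (F \<omega>)) / (L * Den) * indicator B (F \<omega>) \<partial>P)"
    by (rule nn_integral_distr) measurable
  also have "\<dots> = (\<integral>\<^sup>+\<omega>. L * (ennreal (\<Prod>i\<in>{1..n}. r \<omega> (X i)) * indicator {\<omega> \<in> space P. F \<omega> \<in> B} \<omega>) / (L * Den) \<partial>P)"
    by (intro nn_integral_cong) (simp add: lik indicator_def)
  also have "\<dots> = (\<integral>\<^sup>+\<omega>. L * (ennreal (\<Prod>i\<in>{1..n}. r \<omega> (X i)) * indicator {\<omega> \<in> space P. F \<omega> \<in> B} \<omega>) \<partial>P) / (L * Den)"
    by (rule nn_integral_divide) measurable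
  also have "\<dots> = L * Num / (L * Den)"
    unfolding Num_def by (subst nn_integral_cmult) measurable
  finally have post: "emeasure (posterior (density_prior P \<nu> W) n X) B = L * Num / (L * Den)" .
  have "ennreal \<epsilon> * Den < Num"
  proof (rule ccontr)
    assume "\<not> ennreal \<epsilon> * Den < Num"
    then have "L * Num \<le> ennreal \<epsilon> * (L * Den)"
      by (metis mult.left_commute mult_left_mono not_less zero_le)
    then have "L * Num / (L * Den) \<le> ennreal \<epsilon> * (L * Den) / (L * Den)"
      by (rule divide_right_mono_ennreal)
    \<comment> \<open>For \<open>y = 0\<close> and \<open>y = \<top>\<close> the left side is 0, so
      no bounds on the evidence are required.\<close>
    also have "c * y / y \<le> c" for c y :: ennreal
      by (cases "y = 0 \<or> y = \<top>") (auto simp: ennreal_times_divide[symmetric] ennreal_divide_self less_top)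
    finally have "emeasure (posterior (density_prior P \<nu> W) n X) B \<le> ennreal \<epsilon>" unfolding post .
    then have "measure (posterior (density_prior P \<nu> W) n X) B \<le> \<epsilon>"
      unfolding measure_def using \<open>0 < \<epsilon>\<close> by (intro enn2real_leI) auto
    then show False using gt by simp
  qed
  then show "ennreal \<epsilon> * (\<integral>\<^sup>+\<omega>. ennreal (\<Prod>i\<in>{1..n}. r \<omega> (X i)) \<partial>P)
    < (\<integral>\<^sup>+\<omega>. ennreal (\<Prod>i\<in>{1..n}. r \<omega> (X i)) * indicator {\<omega> \<in> space P. F \<omega> \<in> B} \<omega> \<partial>P)"
    unfolding Den_def Num_def .
qed

end

context density_model begin

text \<open>Instance of \<open>posterior_mass_bound\<close> in which the test statistic of a cell is
  the root of the density ratio at one of its points. A variation \<open>\<zeta>\<close> of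
  \<open>W\<close> over the cell changes that ratio by at most \<open>exp (2 * \<zeta>)\<close>,
  which the test tolerates as long as \<open>exp (2 * \<zeta>) - 1\<close> is at most a quarter of
  the distance.\<close>

lemma posterior_contraction_bound:
  fixes n :: nat
  assumes U: "U \<in> sets P" "0 < u" "u \<le> measure P U" "0 \<le> \<eta>"
      "\<And>\<omega> x. \<omega> \<in> U \<Longrightarrow> x \<in> {0..1} \<Longrightarrow> \<bar>W \<omega> x - ln (\<pi>0 x)\<bar> \<le> \<eta>"
    and M: "finite M" "\<And>m. m \<in> M \<Longrightarrow> A m \<in> sets P" "\<And>m. m \<in> M \<Longrightarrow> 0 < s m"
      "\<And>m. m \<in> M \<Longrightarrow> measure P (A m) \<le> (s m)\<^sup>2"
    and osc: "0 \<le> \<zeta>" "exp (2 * \<zeta>) - 1 \<le> \<delta> / 4" "0 < \<delta>"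
      "\<And>m \<omega> \<omega>' x. m \<in> M \<Longrightarrow> \<omega> \<in> A m \<Longrightarrow> \<omega>' \<in> A m \<Longrightarrow> x \<in> {0..1} \<Longrightarrow> \<bar>W \<omega> x - W \<omega>' x\<bar> \<le> \<zeta>"
    and E: "E \<in> sets P" "measure P E \<le> e" "space P \<subseteq> E \<union> (\<Union>m\<in>M. A m)"
    and B: "\<And>f. f \<in> B \<Longrightarrow> \<delta> < hellinger \<nu> f \<pi>0"
    and ab: "0 < a" "0 < b1" "0 < b2" "b1 + b2\<^sup>2 \<le> \<epsilon> * (u\<^sup>2 / a)" "0 < \<epsilon>"
  shows "measure (sample_distribution \<nu> \<pi>0 n) {X \<in> space (sample_distribution \<nu> \<pi>0 n).
      \<epsilon> < measure (posterior (density_prior P \<nu> W) n X) B}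
    \<le> (1 + (exp (2 * \<eta>) - 1)\<^sup>2) ^ n / a + e / b1 + 2 * exp (- (\<delta>\<^sup>2 / 4)) ^ n * (\<Sum>m\<in>M. s m) / b2"
    (is "?lhs \<le> ?rhs")
proof -
  have sd: "sample_distribution \<nu> \<pi>0 n = Pi\<^sub>M {1..n} (\<lambda>_. D)"
    by (simp add: sample_distribution_def D_def)
  have e: "0 \<le> e" using E(2) order_trans[OF measure_nonneg] by blast
  have sum_s: "0 \<le> (\<Sum>m\<in>M'. s m)" if "M' \<subseteq> M" for M'
    using M(3) that by (intro sum_nonneg) (auto intro: less_imp_le)
  show ?thesis
  proof (cases "B \<in> sets C01")
    case False
    then have "{X \<in> space (sample_distribution \<nu> \<pi>0 n).
      \<epsilon> < measure (posterior (density_prior P \<nu> W) n X) B} = {}"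
      using posterior_gt_imp(1)[OF _ ab(5)] by (auto simp: sd)
    then have "?lhs = 0" by (simp only: measure_empty)
    also have "0 \<le> ?rhs" using e sum_s[OF order_refl] ab by simp
    finally show ?thesis .
  next
    case True
    define B0 where "B0 = {\<omega> \<in> space P. F \<omega> \<in> B}"
    have B0: "B0 \<in> sets P"
      using measurable_sets[OF F_measurable True] by (simp add: B0_def vimage_def Int_def conj_commute)
    \<comment> \<open>Cells that do not meet \<open>B0\<close> are discarded. The representative of
      a remaining cell is chosen inside \<open>B0\<close>, because the power of its test is governed
      by its own distance to \<open>\<pi>0\<close>.\<close>
    define M' where "M' = {m \<in> M. A m \<inter> B0 \<noteq> {}}"
    have M'M: "M' \<subseteq> M" by (auto simp: M'_def)
    define c where "c m = (SOME \<omega>. \<omega> \<in> A m \<inter> B0)" for m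
    have c: "c m \<in> A m" "c m \<in> B0" if "m \<in> M'" for m
    proof -
      have "\<exists>\<omega>. \<omega> \<in> A m \<inter> B0" using that unfolding M'_def by blast
      from someI_ex[OF this] show "c m \<in> A m" "c m \<in> B0" unfolding c_def by auto
    qed
    have cP: "c m \<in> space P" if "m \<in> M'" for m using c(2)[OF that] by (simp add: B0_def)
    have AP: "\<omega> \<in> space P" if "m \<in> M" "\<omega> \<in> A m" for m \<omega>
      using that sets.sets_into_space[OF M(2)] by blast
    have test: "(\<integral>\<^sup>+x. ennreal (sqrt (r (c m) x)) \<partial>D) \<le> ennreal (exp (- (\<delta>\<^sup>2 / 4))) \<and>
        (\<integral>\<^sup>+x. ennreal (r \<omega> x / sqrt (r (c m) x)) \<partial>D) \<le> ennreal (exp (- (\<delta>\<^sup>2 / 4)))"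
      if m: "m \<in> M'" and \<omega>: "\<omega> \<in> A m" for m \<omega>
    proof -
      have mM: "m \<in> M" using m M'M by auto
      have \<omega>P: "\<omega> \<in> space P" by (rule AP[OF mM \<omega>])
      define d where "d = hellinger \<nu> (F (c m)) \<pi>0"
      have d: "\<delta> < d" unfolding d_def using c(2)[OF m] by (intro B) (simp add: B0_def)
      have d2: "d\<^sup>2 = D.expectation (\<lambda>x. (sqrt (r (c m) x) - 1)\<^sup>2)"
        unfolding d_def by (rule hellinger_F[OF cP[OF m]])
      have bd: "exp (- (2 * \<zeta>)) * r (c m) x \<le> r \<omega> x \<and> r \<omega> x \<le> exp (2 * \<zeta>) * r (c m) x" if "x \<in> space D" for x
      proof -
        have x: "x \<in> {0..1}" using that space_D by simp
        have "\<bar>(W \<omega> y - ln (\<pi>0 y)) - (W (c m) y - ln (\<pi>0 y))\<bar> \<le> \<zeta>" if "y \<in> {0..1}" for y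
          using osc(4)[OF mM \<omega> c(1)[OF m] that] by simp
        from gibbs_ratio_bounds[OF D.prob_space_axioms sets_D v_cont[OF \<omega>P] v_cont[OF cP[OF m]] this x]
        show ?thesis unfolding r_def by simp
      qed
      have dd: "exp (- (d\<^sup>2 / 4)) \<le> exp (- (\<delta>\<^sup>2 / 4))"
        using d osc(3) by (simp add: power_mono)
      have pos: "0 < d" "0 \<le> 2 * \<zeta>" "exp (2 * \<zeta>) - 1 \<le> d / 4" using d osc by auto
      note test = D.sqrt_likelihood_ratio_test[OF r_integral[OF cP[OF m]] r_pos[OF cP[OF m]] r_integral[OF \<omega>P] _ pos(1) d2 pos(2,3)]
      have "(\<integral>\<^sup>+x. ennreal (sqrt (r (c m) x)) \<partial>D) \<le> ennreal (exp (- (d\<^sup>2 / 4)))"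
        by (rule test(1)) (rule bd)
      moreover have "(\<integral>\<^sup>+x. ennreal (r \<omega> x / sqrt (r (c m) x)) \<partial>D) \<le> ennreal (exp (- (d\<^sup>2 / 4)))"
        by (rule test(2)) (rule bd)
      ultimately show ?thesis using ennreal_leI[OF dd] by (meson order_trans)
    qed
    have "?lhs \<le> (1 + (exp (2 * \<eta>) - 1)\<^sup>2) ^ card {1..n} / a + e / b1 +
        2 * exp (- (\<delta>\<^sup>2 / 4)) ^ card {1..n} * (\<Sum>m\<in>M'. s m) / b2"
      unfolding sd
    proof (rule posterior_mass_bound[where U = U and u = u and A = A and t = "\<lambda>m x. sqrt (r (c m) x)" and E = E and B = B0 and \<epsilon> = \<epsilon> and r = r])
      show "prob_space P" "prob_space D" by (fact P, fact prob_space_D)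
      show "(\<lambda>(\<omega>, x). r \<omega> x) \<in> borel_measurable (P \<Otimes>\<^sub>M D)" by (rule r_measurable)
      show "(\<integral>\<^sup>+x. ennreal (r \<omega> x) \<partial>D) \<le> 1" if "\<omega> \<in> space P" for \<omega>
        using nn_integral_eq_integral[OF r_integral(1)[OF that]] r_integral(2)[OF that] r_pos[OF that]
        by (simp add: less_imp_le)
      show "(\<integral>\<^sup>+x. ennreal (1 / r \<omega> x) \<partial>D) \<le> ennreal (1 + (exp (2 * \<eta>) - 1)\<^sup>2)" if \<omega>: "\<omega> \<in> U" for \<omega>
      proof (rule D.nn_integral_inverse_le)
        have \<omega>P: "\<omega> \<in> space P" using \<omega> sets.sets_into_space[OF U(1)] by blast
        show "integrable D (r \<omega>)" "D.expectation (r \<omega>) = 1" by (rule r_integral[OF \<omega>P])+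
        show "0 \<le> 2 * \<eta>" using U by simp
        fix x assume "x \<in> space D"
        then have x: "x \<in> {0..1}" using space_D by simp
        have "\<bar>(W \<omega> y - ln (\<pi>0 y)) - 0\<bar> \<le> \<eta>" if "y \<in> {0..1}" for y
          using U(5)[OF \<omega> that] by simp
        \<comment> \<open>The comparison function is the constant 0, whose normalised exponential is
          1 because \<open>D\<close> is a probability measure.\<close>
        from gibbs_ratio_bounds[OF D.prob_space_axioms sets_D v_cont[OF \<omega>P] continuous_on_const this x]
        show "exp (- (2 * \<eta>)) \<le> r \<omega> x \<and> r \<omega> x \<le> exp (2 * \<eta>)"
          unfolding r_def by (simp add: gibbs_def D.prob_space)
      qed
      show "finite M'" using M(1) M'M finite_subset by blast
      show "(\<lambda>x. sqrt (r (c m) x)) \<in> borel_measurable D" if "m \<in> M'" for m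
        using r_integral(1)[OF cP[OF that]] by measurable
      show "(\<integral>\<^sup>+x. ennreal (sqrt (r (c m) x)) \<partial>D) \<le> ennreal (exp (- (\<delta>\<^sup>2 / 4)))" if "m \<in> M'" for m
        using test[OF that c(1)[OF that]] by simp
      show "(\<integral>\<^sup>+x. ennreal (r \<omega> x / sqrt (r (c m) x)) \<partial>D) \<le> ennreal (exp (- (\<delta>\<^sup>2 / 4)))" if "m \<in> M'" "\<omega> \<in> A m" for m \<omega>
        using test[OF that] by simp
      show "B0 \<subseteq> E \<union> (\<Union>m\<in>M'. A m)" using E(3) by (auto simp: M'_def B0_def)
      show "{X \<in> space (Pi\<^sub>M {1..n} (\<lambda>_. D)). \<epsilon> < measure (posterior (density_prior P \<nu> W) n X) B} \<subseteq>
        {X \<in> space (Pi\<^sub>M {1..n} (\<lambda>_. D)). ennreal \<epsilon> * (\<integral>\<^sup>+\<omega>. ennreal (\<Prod>i\<in>{1..n}. r \<omega> (X i)) \<partial>P)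
        < (\<integral>\<^sup>+\<omega>. ennreal (\<Prod>i\<in>{1..n}. r \<omega> (X i)) * indicator B0 \<omega> \<partial>P)}"
        using posterior_gt_imp(2)[OF _ ab(5)] unfolding B0_def by blast
    qed (use U M M'M B0 E ab r_pos cP in auto)
    also have "\<dots> \<le> ?rhs"
    proof -
      have "(\<Sum>m\<in>M'. s m) \<le> (\<Sum>m\<in>M. s m)"
        using M M'M by (intro sum_mono2) (auto intro: less_imp_le)
      then show ?thesis using ab by (intro add_mono divide_right_mono mult_left_mono) auto
    qed
    finally show ?thesis .
  qed
qed

end

section \<open>Choice of the resolution level and of the constants\<close>

text \<open>The factor \<open>2 powr (- real k / 2)\<close> on the right cancels the growth of the
  wavelets at level \<open>k\<close> in the supremum norm; what is left sums over \<open>k\<close>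
  to order \<open>2 powr (- \<beta> * J)\<close>.\<close>

lemma threshold_rescaled:
  "2 powr (- (1/2 + \<alpha>) * real k) * threshold \<alpha> \<beta> J k =
    2 powr (- real k / 2) * (2 powr (- \<beta> * real J) * 2 powr (- (\<beta> / 2) * \<bar>real k - real J\<bar>))"
  unfolding threshold_def powr_add[symmetric]
  by (rule arg_cong[where f = "\<lambda>z. 2 powr z"]) (simp add: field_simps)

lemma besov_norm_finite_imp:
  assumes "besov_norm \<psi> s u < \<infinity>"
  obtains B where "0 \<le> B" "\<And>k l. l \<in> {1..2^k} \<Longrightarrow> \<bar>inner01 u (\<psi> k l)\<bar> \<le> B * 2 powr (- (real k * (1/2 + s)))"
proof -
  obtain n :: nat where n: "besov_norm \<psi> s u < ereal (real n)" using less_PInf_Ex_of_nat assms by auto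
  show ?thesis
  proof (rule that[of "real n"])
    fix k l assume l: "l \<in> {1..2^k :: nat}"
    have "ereal (2 powr (real k * (1/2 + s)) * \<bar>inner01 u (\<psi> k l)\<bar>) \<le> besov_norm \<psi> s u"
      unfolding besov_norm_def by (rule SUP_upper2[of "(k, l)"]) (use l in auto)
    then have "ereal (2 powr (real k * (1/2 + s)) * \<bar>inner01 u (\<psi> k l)\<bar>) \<le> ereal (real n)" using n by order
    then have "2 powr (real k * (1/2 + s)) * \<bar>inner01 u (\<psi> k l)\<bar> \<le> real n" by simp
    then show "\<bar>inner01 u (\<psi> k l)\<bar> \<le> real n * 2 powr (- (real k * (1/2 + s)))"
      by (simp add: powr_minus field_simps)
  qed simp
qed

lemma rho_eq:
  "rho \<alpha> \<beta> p n = real n powr (- (min \<alpha> \<beta> / (1 + 2 * min \<alpha> \<beta> + p * (\<alpha> - min \<alpha> \<beta>))))"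
  by (auto simp: rho_def min_def)

text \<open>\<open>J\<close> is \<open>log 2 n / m\<close> rounded down: the costs then stay below
  powers of \<open>n\<close> without a constant, and the approximation error loses at most the
  factor \<open>2 powr b\<close>.\<close>

lemma resolution_level:
  fixes b m :: real
  assumes "0 < b" "0 < m" "1 \<le> n"
  obtains J where "2 powr (- b * real J) \<le> 2 powr b * real n powr (- (b / m))"
    and "\<And>t. 0 \<le> t \<Longrightarrow> 2 powr (real J * t) \<le> real n powr (t / m)"
proof
  define L where "L = log 2 (real n) / m"
  define J where "J = nat \<lfloor>L\<rfloor>"
  have L: "0 \<le> L" using assms by (simp add: L_def)
  then have J: "real J \<le> L" "L < real J + 1" unfolding J_def by linarith+
  have n: "real n = 2 powr (L * m)" using assms by (simp add: L_def)
  have "- b * real J \<le> b - b * L" using mult_strict_left_mono[OF J(2) assms(1)] by (simp add: distrib_left)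
  then have "2 powr (- b * real J) \<le> 2 powr (b - b * L)" by (intro powr_mono) auto
  also have "\<dots> = 2 powr b * real n powr (- (b / m))"
    unfolding n powr_powr using assms by (simp add: mult_ac flip: powr_add)
  finally show "2 powr (- b * real J) \<le> 2 powr b * real n powr (- (b / m))" .
  fix t :: real assume "0 \<le> t"
  then have "real J * t \<le> L * t" using J by (intro mult_right_mono) auto
  then have "2 powr (real J * t) \<le> 2 powr (L * t)" by (intro powr_mono) auto
  also have "\<dots> = real n powr (t / m)" unfolding n powr_powr using assms by simp
  finally show "2 powr (real J * t) \<le> real n powr (t / m)" .
qed

lemma exp_minus_one_le:
  fixes x :: real
  assumes "0 \<le> x" "x \<le> 1"
  shows "exp x - 1 \<le> 2 * x"
proof -
  have "exp x \<le> 1 + x + x\<^sup>2" using assms by (intro exp_bound) auto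
  moreover have "x\<^sup>2 \<le> x" using assms by (simp add: power2_eq_square mult_left_le)
  ultimately show ?thesis by linarith
qed

theorem theorem6p7:
  fixes \<alpha> \<beta> p S :: real
    and \<psi> :: "nat \<Rightarrow> nat \<Rightarrow> real \<Rightarrow> real"
    and \<nu> :: "real measure"
    and P :: "'a measure"
    and W :: "'a \<Rightarrow> real \<Rightarrow> real"
    and \<pi>0 :: "real \<Rightarrow> real"
  assumes "0 < \<alpha>" "0 < \<beta>" "1 \<le> p" "p \<le> 2"
    and "max \<alpha> \<beta> < S"
    and "CDV_wavelet_basis S \<psi>"
    and "finite_measure \<nu>" "sets \<nu> = sets (restrict_space borel {0..1})"
    and "p_exponential_element P \<alpha> p \<psi> W"
    and "\<And>x. x \<in> {0..1} \<Longrightarrow> 0 < \<pi>0 x" "(\<integral>x. \<pi>0 x \<partial>\<nu>) = 1"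
    and "(\<lambda>x. ln (\<pi>0 x)) \<in> besov_space \<psi> \<beta>"
  shows "\<exists>M0>0. \<forall>M\<ge>M0. \<forall>\<epsilon>>0.
           (\<lambda>n. measure (sample_distribution \<nu> \<pi>0 n)
                  {X \<in> space (sample_distribution \<nu> \<pi>0 n).
                     measure (posterior (density_prior P \<nu> W) n X)
                       {f \<in> space C01. hellinger \<nu> f \<pi>0 > M * max (rho \<alpha> \<beta> p n) (rho_tilde \<alpha> \<beta> p n)}
                     > \<epsilon>}) \<longlonglongrightarrow> 0"
proof -
  define w0 where "w0 x = ln (\<pi>0 x)" for x
  have w0: "continuous_on {0..1} w0" "besov_norm \<psi> \<beta> w0 < \<infinity>"
    using assms(12) by (auto simp: besov_space_def w0_def[abs_def])
  define b where "b = min \<alpha> \<beta>"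
  have b: "0 < b" "b \<le> \<alpha>" "b \<le> \<beta>" using assms by (auto simp: b_def)
  obtain \<xi> where P: "prob_space P" and W: "W \<in> P \<rightarrow>\<^sub>M C01"
    and ind: "prob_space.indep_vars P (\<lambda>_. borel) (\<lambda>(k, l). \<xi> k l) (SIGMA k:UNIV. {1..2^k})"
    and dist: "\<And>k l. l \<in> {1..2^k} \<Longrightarrow> distributed P lborel (\<xi> k l) (\<lambda>x. ennreal (p_exponential_density p x))"
    and ae: "AE \<omega> in P. uniform_limit {0..1}
           (\<lambda>K x. \<Sum>k<K. \<Sum>l=1..2^k. 2 powr (- (1/2 + \<alpha>) * real k) * \<xi> k l \<omega> * \<psi> k l x) (W \<omega>) sequentially"
    using assms(9) unfolding p_exponential_element_def by blast
  interpret density_model \<nu> \<pi>0 P W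
  proof (rule density_model.intro)
    show "continuous_on {0..1} (\<lambda>x. ln (\<pi>0 x))" using assms(12) by (simp add: besov_space_def)
    show "0 < \<pi>0 x" if "x \<in> {0..1}" for x by (rule assms(10)[OF that])
  qed (fact assms(7) assms(8) P W assms(11))+
  obtain C2 where C2: "0 < C2" "\<And>k (u :: nat \<Rightarrow> real) x. x \<in> {0..1} \<Longrightarrow>
      \<bar>\<Sum>l=1..2^k. u l * \<psi> k l x\<bar> \<le> C2 * 2 powr (real k / 2) * (MAX l\<in>{1..2^k}. \<bar>u l\<bar>)"
    using assms(6) unfolding CDV_wavelet_basis_def by blast
  have basis: "orthonormal_basis_L2 (wav_seq \<psi>)" "schauder_basis_C01 (wav_seq \<psi>)"
    using assms(6) unfolding CDV_wavelet_basis_def by auto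
  obtain B where B: "0 \<le> B" "\<And>k l. l \<in> {1..2^k} \<Longrightarrow> \<bar>inner01 w0 (\<psi> k l)\<bar> \<le> B * 2 powr (- (real k * (1/2 + \<beta>)))"
    by (rule besov_norm_finite_imp[OF w0(2)]) blast
  \<comment> \<open>The coefficients of \<open>ln \<pi>0\<close> in the scale of the
    \<open>\<xi> k l\<close>, so that \<open>W\<close> and \<open>w0\<close> have series of the same
    shape.\<close>
  define a where "a k l = 2 powr ((1/2 + \<alpha>) * real k) * inner01 w0 (\<psi> k l)" for k l
  have a_bound: "\<bar>a k l\<bar> \<le> B * 2 powr ((\<alpha> - b) * real k)" if l: "l \<in> {1..2^k}" for k l
  proof -
    have "\<bar>a k l\<bar> = 2 powr ((1/2 + \<alpha>) * real k) * \<bar>inner01 w0 (\<psi> k l)\<bar>" by (simp add: a_def abs_mult)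
    also have "\<dots> \<le> 2 powr ((1/2 + \<alpha>) * real k) * (B * 2 powr (- (real k * (1/2 + \<beta>))))"
      by (intro mult_left_mono B l) auto
    also have "\<dots> = B * 2 powr ((\<alpha> - \<beta>) * real k)" by (simp add: algebra_simps flip: powr_add)
    also have "\<dots> \<le> B * 2 powr ((\<alpha> - b) * real k)"
      using B b by (intro mult_left_mono powr_mono mult_right_mono) auto
    finally show ?thesis .
  qed
  \<comment> \<open>The series represents \<open>W\<close> only almost surely, whereas the
    oscillation bounds are required at every point of the cells and of the small ball. The null set
    \<open>N\<close> is therefore removed from them and added to the leftover set.\<close>
  obtain N where N: "N \<in> sets P" "emeasure P N = 0" and sub: "{\<omega> \<in> space P. \<not> uniform_limit {0..1}
           (\<lambda>K x. \<Sum>k<K. \<Sum>l=1..2^k. 2 powr (- (1/2 + \<alpha>) * real k) * \<xi> k l \<omega> * \<psi> k l x) (W \<omega>) sequentially} \<subseteq> N"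
    by (rule AE_E[OF ae])
  have good: "uniform_limit {0..1}
           (\<lambda>K x. \<Sum>k<K. \<Sum>l=1..2^k. 2 powr (- (1/2 + \<alpha>) * real k) * \<xi> k l \<omega> * \<psi> k l x) (W \<omega>) sequentially"
    if "\<omega> \<in> space P - N" for \<omega>
    by (rule ccontr) (use that sub in blast)
  have Nnull: "N \<in> null_sets P" using N by auto
  have b2: "0 < b / 2" using b by simp
  obtain Tw where Tw: "0 < Tw" "\<And>J K. (\<Sum>k<K. 2 powr (- (b / 2) * \<bar>real k - real J\<bar>)) \<le> Tw"
    by (rule geometric_level_sum_bound[OF b2]) blast
  have sup_bound: "\<bar>f - g\<bar> \<le> C2 * (c * 2 powr (- b * real J) * Tw)"
    if x: "x \<in> {0..1}" and c: "0 \<le> c"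
      and f: "(\<lambda>K. \<Sum>k<K. \<Sum>l=1..2^k. 2 powr (- (1/2 + \<alpha>) * real k) * y k l * \<psi> k l x) \<longlonglongrightarrow> f"
      and g: "(\<lambda>K. \<Sum>k<K. \<Sum>l=1..2^k. 2 powr (- (1/2 + \<alpha>) * real k) * z k l * \<psi> k l x) \<longlonglongrightarrow> g"
      and d: "\<And>k l. l \<in> {1..2^k} \<Longrightarrow> \<bar>y k l - z k l\<bar> \<le> c * threshold \<alpha> b J k"
    for x f g c J and y z :: "nat \<Rightarrow> nat \<Rightarrow> real"
  proof (rule wavelet_sup_norm_diff[where \<psi> = \<psi> and u = "\<lambda>k l. 2 powr (- (1/2 + \<alpha>) * real k) * y k l"
        and v = "\<lambda>k l. 2 powr (- (1/2 + \<alpha>) * real k) * z k l"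
        and d = "\<lambda>k. c * 2 powr (- b * real J) * 2 powr (- (b / 2) * \<bar>real k - real J\<bar>)", OF C2 x f g])
    fix k l assume l: "l \<in> {1..2^k :: nat}"
    have "\<bar>2 powr (- (1/2 + \<alpha>) * real k) * y k l - 2 powr (- (1/2 + \<alpha>) * real k) * z k l\<bar>
        = 2 powr (- (1/2 + \<alpha>) * real k) * \<bar>y k l - z k l\<bar>"
      by (simp add: abs_mult flip: right_diff_distrib)
    also have "\<dots> \<le> 2 powr (- (1/2 + \<alpha>) * real k) * (c * threshold \<alpha> b J k)"
      by (intro mult_left_mono d l) auto
    also have "\<dots> = c * (2 powr (- (1/2 + \<alpha>) * real k) * threshold \<alpha> b J k)" by simp
    also have "\<dots> = 2 powr (- real k / 2) * (c * 2 powr (- b * real J) * 2 powr (- (b / 2) * \<bar>real k - real J\<bar>))"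
      unfolding threshold_rescaled by simp
    finally show "\<bar>2 powr (- (1/2 + \<alpha>) * real k) * y k l - 2 powr (- (1/2 + \<alpha>) * real k) * z k l\<bar>
      \<le> 2 powr (- real k / 2) * (c * 2 powr (- b * real J) * 2 powr (- (b / 2) * \<bar>real k - real J\<bar>))" .
  next
    fix K
    show "(\<Sum>k<K. c * 2 powr (- b * real J) * 2 powr (- (b / 2) * \<bar>real k - real J\<bar>)) \<le> c * 2 powr (- b * real J) * Tw"
      unfolding sum_distrib_left[symmetric] using c by (intro mult_left_mono Tw) auto
  qed
  have W_lim: "(\<lambda>K. \<Sum>k<K. \<Sum>l=1..2^k. 2 powr (- (1/2 + \<alpha>) * real k) * \<xi> k l \<omega> * \<psi> k l x) \<longlonglongrightarrow> W \<omega> x"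
    if "\<omega> \<in> space P - N" "x \<in> {0..1}" for \<omega> x
    by (rule tendsto_uniform_limitI[OF good[OF that(1)] that(2)])
  have w0_lim: "(\<lambda>K. \<Sum>k<K. \<Sum>l=1..2^k. 2 powr (- (1/2 + \<alpha>) * real k) * a k l * \<psi> k l x) \<longlonglongrightarrow> w0 x"
    if "x \<in> {0..1}" for x
  proof -
    have "2 powr (- (1/2 + \<alpha>) * real k) * a k l = inner01 w0 (\<psi> k l)" for k l
      unfolding a_def mult.assoc[symmetric] powr_add[symmetric] by (simp add: algebra_simps)
    then show ?thesis using wavelet_expansion[OF basis w0(1) that] by simp
  qed
  obtain Cb where Cb: "0 < Cb" "\<And>J. exp (- (Cb * 2 powr (real J * (1 + p * (\<alpha> - b))))) \<le>
      measure P {\<omega> \<in> space P. \<forall>k. \<forall>l\<in>{1..2^k}. \<bar>\<xi> k l \<omega> - a k l\<bar> \<le> (1 + B) * threshold \<alpha> b J k}"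
    by (rule small_ball_probability[OF b(1,2) assms(3) P ind dist B(1) a_bound]) blast+
  obtain Cc where Cc: "0 < Cc" and cells: "\<And>J e. 0 < e \<Longrightarrow> \<exists>(M :: (nat \<times> nat \<Rightarrow> int) set) A s E.
      finite M \<and> E \<in> sets P \<and> measure P E \<le> e \<and> space P \<subseteq> E \<union> (\<Union>m\<in>M. A m) \<and>
      (\<forall>m\<in>M. A m \<in> sets P \<and> 0 < s m \<and> measure P (A m) \<le> (s m)\<^sup>2) \<and> (\<Sum>m\<in>M. s m) \<le> exp (Cc * 2 ^ J) \<and>
      (\<forall>m\<in>M. \<forall>\<omega>\<in>A m. \<forall>\<omega>'\<in>A m. \<forall>k. \<forall>l\<in>{1..2^k}. \<bar>\<xi> k l \<omega> - \<xi> k l \<omega>'\<bar> \<le> threshold \<alpha> b J k)"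
    by (rule coordinate_cells[OF b(1,2) assms(3) P ind dist]) blast+
  define m where "m = 1 + 2 * b + p * (\<alpha> - b)"
  have pab: "0 \<le> p * (\<alpha> - b)" using assms(3) b by auto
  have m: "0 < m" using pab b by (simp add: m_def)
  define \<rho> where "\<rho> n = real n powr (- (b / m))" for n :: nat
  define t where "t = (1 + p * (\<alpha> - b)) / m"
  have t: "0 < t" using pab m by (simp add: t_def)
  define K1 where "K1 = C2 * (2 powr b * Tw)"
  have K1: "0 < K1" using C2 Tw by (simp add: K1_def)
  define K2 where "K2 = (1 + B) * K1"
  have K2: "K1 \<le> K2" "0 < K2" using K1 B by (auto simp: K2_def mult_le_cancel_right1 add_pos_nonneg)
  \<comment> \<open>\<open>H\<close> arises from
    \<open>(exp (2 * K2 * \<rho>) - 1)^2 \<le> (4 * K2 * \<rho>)^2\<close>. In \<open>G\<close>,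
    \<open>Cc\<close> pays for the cells, \<open>Cb + H\<close> for the division by
    \<open>b2\<close>, and 1 is left over to force decay. In \<open>M0\<close>,
    \<open>16 * K1\<close> makes the cells small enough for the tests, and \<open>2 * G\<close>
    yields \<open>M^2 / 4 \<ge> G^2 \<ge> G\<close>.\<close>
  define H where "H = 16 * K2\<^sup>2"
  have H: "0 < H" using K2 by (simp add: H_def)
  define G where "G = Cc + Cb + H + 1"
  have G: "1 \<le> G" using Cc Cb H by (simp add: G_def)
  define M0 where "M0 = max (16 * K1) (2 * G)"
  have M0: "0 < M0" using G by (simp add: M0_def)
  have n_rho: "real n * (\<rho> n)\<^sup>2 = real n powr t" if "1 \<le> n" for n
  proof -
    have "(\<rho> n)\<^sup>2 = real n powr (2 * (- (b / m)))"
      by (simp add: \<rho>_def power2_eq_square flip: powr_add)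
    then have "real n * (\<rho> n)\<^sup>2 = real n powr (1 + 2 * (- (b / m)))"
      using that unfolding powr_add by simp
    also have "1 + 2 * (- (b / m)) = (m - 2 * b) / m" using m by (simp add: field_simps)
    also have "\<dots> = t" by (simp add: t_def m_def)
    finally show ?thesis .
  qed
  show ?thesis
  proof (intro exI[of _ M0] conjI allI impI M0)
    fix M \<epsilon> :: real assume M: "M0 \<le> M" and \<epsilon>: "0 < \<epsilon>"
    have M16: "16 * K1 \<le> M" "2 * G \<le> M" "0 < M" using M M0 by (auto simp: M0_def)
    define prob where "prob n = measure (sample_distribution \<nu> \<pi>0 n)
                  {X \<in> space (sample_distribution \<nu> \<pi>0 n).
                     measure (posterior (density_prior P \<nu> W) n X)
                       {f \<in> space C01. hellinger \<nu> f \<pi>0 > M * max (rho \<alpha> \<beta> p n) (rho_tilde \<alpha> \<beta> p n)}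
                     > \<epsilon>}" for n
    have bound: "prob n \<le> exp (- (H * real n powr t)) + 1 / real n + 2 / sqrt (\<epsilon> / 2) * exp (- (real n powr t))"
      if n: "1 \<le> n" and small: "2 * (K2 * \<rho> n) \<le> 1" for n
    proof -
      have \<rho>: "0 < \<rho> n" using n by (simp add: \<rho>_def)
      define X where "X = real n powr t"
      have X: "0 < X" "real n * (\<rho> n)\<^sup>2 = X" using n by (simp_all add: X_def n_rho)
      obtain J where J: "2 powr (- b * real J) \<le> 2 powr b * \<rho> n"
        and Jt: "\<And>t. 0 \<le> t \<Longrightarrow> 2 powr (real J * t) \<le> real n powr (t / m)"
        unfolding \<rho>_def by (rule resolution_level[OF b(1) m n]) blast
      have JX: "2 powr (real J * (1 + p * (\<alpha> - b))) \<le> X"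
        unfolding X_def t_def using pab by (intro Jt) auto
      have "2 ^ J = 2 powr (real J * 1)" by (simp add: powr_realpow)
      also have "\<dots> \<le> 2 powr (real J * (1 + p * (\<alpha> - b)))"
        using pab by (intro powr_mono mult_left_mono) auto
      also note JX
      finally have JX': "2 ^ J \<le> X" .
      have radius: "C2 * (c * 2 powr (- b * real J) * Tw) \<le> c * K1 * \<rho> n" if "0 \<le> c" for c
      proof -
        have "C2 * (c * 2 powr (- b * real J) * Tw) \<le> C2 * (c * (2 powr b * \<rho> n) * Tw)"
          using C2 Tw that J by (intro mult_left_mono mult_right_mono) auto
        then show ?thesis by (simp add: K1_def mult_ac)
      qed
      define U0 where "U0 = {\<omega> \<in> space P. \<forall>k. \<forall>l\<in>{1..2^k}. \<bar>\<xi> k l \<omega> - a k l\<bar> \<le> (1 + B) * threshold \<alpha> b J k}"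
      have U0: "U0 \<in> sets P"
      proof -
        have "{\<omega> \<in> space P. \<forall>k. \<forall>l\<in>{1..2^k}. \<xi> k l \<omega> \<in> {x. \<bar>x - a k l\<bar> \<le> (1 + B) * threshold \<alpha> b J k}} \<in> sets P"
        proof (rule levels_measurable)
          show "\<xi> k l \<in> borel_measurable P" if "l \<in> {1..2^k}" for k l
            using distributed_measurable[OF dist[OF that]] by simp
        qed measurable
        then show ?thesis by (simp add: U0_def)
      qed
      define u where "u = exp (- (Cb * X))"
      have u: "u \<le> measure P (U0 - N)"
      proof -
        have "u \<le> exp (- (Cb * 2 powr (real J * (1 + p * (\<alpha> - b)))))"
          unfolding u_def using Cb JX by simp
        also have "\<dots> \<le> measure P U0" unfolding U0_def by (rule Cb)
        also have "\<dots> = measure P (U0 - N)" by (rule measure_Diff_null_set[OF U0 Nnull, symmetric])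
        finally show ?thesis .
      qed
      \<comment> \<open>Twice the exponent of the mean of the inverse likelihood ratio, so that
        Markov's inequality leaves \<open>exp (- (H * X))\<close>. Then \<open>b1\<close> and
        \<open>b2^2\<close> each take half of the permitted
        \<open>\<epsilon> * (u^2 / A1)\<close>.\<close>
      define A1 where "A1 = exp (2 * H * X)"
      define b2 where "b2 = sqrt (\<epsilon> / 2) * exp (- ((Cb + H) * X))"
      define b1 where "b1 = b2\<^sup>2"
      have b2_pos: "0 < b2" using \<epsilon> by (simp add: b2_def)
      then have b1_pos: "0 < b1" by (simp add: b1_def)
      have e_pos: "0 < b1 / real n" using b1_pos n by simp
      have b2_sq: "b2\<^sup>2 = \<epsilon> / 2 * (u\<^sup>2 / A1)"
        using \<epsilon> by (simp add: b2_def u_def A1_def power_mult_distrib algebra_simps flip: exp_double exp_diff)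
      \<comment> \<open>The leftover mass \<open>b1 / n\<close> is exponentially small in
        \<open>X\<close>, chosen so that its Markov bound is \<open>1 / n\<close>.\<close>
      obtain Mc :: "(nat \<times> nat \<Rightarrow> int) set" and A s E where cells:
        "finite Mc \<and> E \<in> sets P \<and> measure P E \<le> b1 / real n \<and> space P \<subseteq> E \<union> (\<Union>m\<in>Mc. A m) \<and>
        (\<forall>m\<in>Mc. A m \<in> sets P \<and> 0 < s m \<and> measure P (A m) \<le> (s m)\<^sup>2) \<and> (\<Sum>m\<in>Mc. s m) \<le> exp (Cc * 2 ^ J) \<and>
        (\<forall>m\<in>Mc. \<forall>\<omega>\<in>A m. \<forall>\<omega>'\<in>A m. \<forall>k. \<forall>l\<in>{1..2^k}. \<bar>\<xi> k l \<omega> - \<xi> k l \<omega>'\<bar> \<le> threshold \<alpha> b J k)"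
        using cells[OF e_pos, of J] by (elim exE)
      have Mc: "finite Mc" using cells by (elim conjE)
      have E1: "E \<in> sets P" using cells by (elim conjE)
      have E2: "measure P E \<le> b1 / real n" using cells by (elim conjE)
      have E3: "space P \<subseteq> E \<union> (\<Union>m\<in>Mc. A m)" using cells by (elim conjE)
      note E = E1 E2 E3
      have "\<forall>m\<in>Mc. A m \<in> sets P \<and> 0 < s m \<and> measure P (A m) \<le> (s m)\<^sup>2" using cells by (elim conjE)
      then have A: "A m \<in> sets P" "0 < s m" "measure P (A m) \<le> (s m)\<^sup>2" if "m \<in> Mc" for m
        using that by auto
      have s: "(\<Sum>m\<in>Mc. s m) \<le> exp (Cc * 2 ^ J)" using cells by (elim conjE)
      have "\<forall>m\<in>Mc. \<forall>\<omega>\<in>A m. \<forall>\<omega>'\<in>A m. \<forall>k. \<forall>l\<in>{1..2^k}. \<bar>\<xi> k l \<omega> - \<xi> k l \<omega>'\<bar> \<le> threshold \<alpha> b J k"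
        using cells by (elim conjE)
      then have close: "\<bar>\<xi> k l \<omega> - \<xi> k l \<omega>'\<bar> \<le> threshold \<alpha> b J k"
        if "m \<in> Mc" "\<omega> \<in> A m" "\<omega>' \<in> A m" "l \<in> {1..2^k}" for m \<omega> \<omega>' k l
        using that by blast
      have "prob n \<le> (1 + (exp (2 * (K2 * \<rho> n)) - 1)\<^sup>2) ^ n / A1 + b1 / real n / b1 +
          2 * exp (- ((M * \<rho> n)\<^sup>2 / 4)) ^ n * (\<Sum>m\<in>Mc. s m) / b2"
        unfolding prob_def
      proof (rule posterior_contraction_bound[where U = "U0 - N" and u = u and A = "\<lambda>m. A m - N" and E = "E \<union> N" and \<zeta> = "K1 * \<rho> n" and \<epsilon> = \<epsilon>])
        show "U0 - N \<in> sets P" using U0 N by auto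
        show "0 < u" by (simp add: u_def)
        show "0 \<le> K2 * \<rho> n" "0 \<le> K1 * \<rho> n" using K1 K2 \<rho> by auto
        show "\<bar>W \<omega> x - ln (\<pi>0 x)\<bar> \<le> K2 * \<rho> n" if "\<omega> \<in> U0 - N" "x \<in> {0..1}" for \<omega> x
        proof -
          have "\<bar>W \<omega> x - w0 x\<bar> \<le> C2 * ((1 + B) * 2 powr (- b * real J) * Tw)"
            using that B by (intro sup_bound[OF that(2) _ W_lim w0_lim]) (auto simp: U0_def)
          also have "\<dots> \<le> (1 + B) * K1 * \<rho> n" using B by (intro radius) auto
          finally show ?thesis by (simp add: w0_def K2_def)
        qed
        show "\<bar>W \<omega> x - W \<omega>' x\<bar> \<le> K1 * \<rho> n" if "m \<in> Mc" "\<omega> \<in> A m - N" "\<omega>' \<in> A m - N" "x \<in> {0..1}" for m \<omega> \<omega>' x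
        proof -
          have "\<omega> \<in> space P - N" "\<omega>' \<in> space P - N" using that sets.sets_into_space[OF A(1)[OF that(1)]] by auto
          then have "\<bar>W \<omega> x - W \<omega>' x\<bar> \<le> C2 * (1 * 2 powr (- b * real J) * Tw)"
            using that close by (intro sup_bound[OF that(4) _ W_lim W_lim]) auto
          also have "\<dots> \<le> 1 * K1 * \<rho> n" by (intro radius) auto
          finally show ?thesis by simp
        qed
        show "finite Mc" by fact
        show "A m - N \<in> sets P" "0 < s m" "measure P (A m - N) \<le> (s m)\<^sup>2" if "m \<in> Mc" for m
          using A[OF that] N measure_Diff_null_set[OF A(1)[OF that] Nnull] by auto
        show "E \<union> N \<in> sets P" "measure P (E \<union> N) \<le> b1 / real n" "space P \<subseteq> E \<union> N \<union> (\<Union>m\<in>Mc. A m - N)"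
          using E N measure_Un_null_set[OF E(1) Nnull] by auto
        show "0 < M * \<rho> n" using M16 \<rho> by simp
        have "K1 * \<rho> n \<le> K2 * \<rho> n" using K2 \<rho> by (intro mult_right_mono) auto
        then have "2 * (K1 * \<rho> n) \<le> 1" using small by linarith
        then have "exp (2 * (K1 * \<rho> n)) - 1 \<le> 2 * (2 * (K1 * \<rho> n))"
          using K1 \<rho> by (intro exp_minus_one_le) auto
        also have "\<dots> \<le> M * \<rho> n / 4" using mult_right_mono[OF M16(1), of "\<rho> n"] \<rho> by simp
        finally show "exp (2 * (K1 * \<rho> n)) - 1 \<le> M * \<rho> n / 4" .
        show "M * \<rho> n < hellinger \<nu> f \<pi>0"
          if "f \<in> {f \<in> space C01. hellinger \<nu> f \<pi>0 > M * max (rho \<alpha> \<beta> p n) (rho_tilde \<alpha> \<beta> p n)}" for f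
        proof -
          have "rho \<alpha> \<beta> p n = \<rho> n" by (simp add: rho_eq \<rho>_def m_def b_def)
          then have "M * \<rho> n \<le> M * max (rho \<alpha> \<beta> p n) (rho_tilde \<alpha> \<beta> p n)" using M16 by (intro mult_left_mono) auto
          then show ?thesis using that by auto
        qed
        show "b1 + b2\<^sup>2 \<le> \<epsilon> * (u\<^sup>2 / A1)" unfolding b1_def b2_sq by simp
        show "0 < A1" by (simp add: A1_def)
      qed (use u b1_pos b2_pos \<epsilon> in auto)
      also have "(1 + (exp (2 * (K2 * \<rho> n)) - 1)\<^sup>2) ^ n / A1 \<le> exp (- (H * X))"
      proof -
        have "exp (2 * (K2 * \<rho> n)) - 1 \<le> 2 * (2 * (K2 * \<rho> n))"
          using small K2 \<rho> by (intro exp_minus_one_le) auto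
        then have "(exp (2 * (K2 * \<rho> n)) - 1)\<^sup>2 \<le> (4 * (K2 * \<rho> n))\<^sup>2"
          using K2 \<rho> by (intro power_mono) auto
        also have "\<dots> = H * (\<rho> n)\<^sup>2" by (simp add: H_def power_mult_distrib)
        finally have "1 + (exp (2 * (K2 * \<rho> n)) - 1)\<^sup>2 \<le> exp (H * (\<rho> n)\<^sup>2)"
          using exp_ge_add_one_self[of "H * (\<rho> n)\<^sup>2"] by linarith
        then have "(1 + (exp (2 * (K2 * \<rho> n)) - 1)\<^sup>2) ^ n \<le> exp (H * (\<rho> n)\<^sup>2) ^ n"
          by (intro power_mono) auto
        also have "\<dots> = exp (H * X)" unfolding X(2)[symmetric] by (simp add: mult_ac flip: exp_of_nat_mult)
        finally have "(1 + (exp (2 * (K2 * \<rho> n)) - 1)\<^sup>2) ^ n / A1 \<le> exp (H * X) / A1"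
          by (intro divide_right_mono) (auto simp: A1_def)
        also have "\<dots> = exp (- (H * X))" by (simp add: A1_def flip: exp_diff)
        finally show ?thesis .
      qed
      also have "b1 / real n / b1 = 1 / real n" using b1_pos by simp
      also have "2 * exp (- ((M * \<rho> n)\<^sup>2 / 4)) ^ n * (\<Sum>m\<in>Mc. s m) / b2 \<le> 2 / sqrt (\<epsilon> / 2) * exp (- X)"
      proof -
        have "exp (- ((M * \<rho> n)\<^sup>2 / 4)) ^ n = exp (- (M\<^sup>2 / 4 * X))"
          unfolding X(2)[symmetric] by (simp add: power_mult_distrib mult_ac flip: exp_of_nat_mult)
        also have "\<dots> \<le> exp (- (G * X))"
        proof -
          have "(2 * G)\<^sup>2 \<le> M\<^sup>2" using M16 G by (intro power_mono) auto
          moreover have "G * 1 \<le> G * G" using G by (intro mult_left_mono) auto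
          ultimately have "G \<le> M\<^sup>2 / 4" by (simp add: power_mult_distrib power2_eq_square)
          then show ?thesis using X(1) by (simp add: mult_right_mono)
        qed
        finally have 1: "exp (- ((M * \<rho> n)\<^sup>2 / 4)) ^ n \<le> exp (- (G * X))" .
        have 2: "(\<Sum>m\<in>Mc. s m) \<le> exp (Cc * X)"
        proof -
          have "Cc * 2 ^ J \<le> Cc * X" using JX' Cc by (intro mult_left_mono) auto
          then show ?thesis using s by (meson exp_le_cancel_iff order_trans)
        qed
        have "2 * exp (- ((M * \<rho> n)\<^sup>2 / 4)) ^ n * (\<Sum>m\<in>Mc. s m) \<le> 2 * exp (- (G * X)) * exp (Cc * X)"
          using A(2) by (intro mult_mono mult_left_mono 1 2 sum_nonneg) (auto intro: less_imp_le)
        then have "2 * exp (- ((M * \<rho> n)\<^sup>2 / 4)) ^ n * (\<Sum>m\<in>Mc. s m) / b2 \<le> 2 * exp (- (G * X)) * exp (Cc * X) / b2"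
          using b2_pos by (intro divide_right_mono) auto
        also have "\<dots> = 2 / sqrt (\<epsilon> / 2) * (exp (- (G * X)) * exp (Cc * X) / exp (- ((Cb + H) * X)))"
          by (simp add: b2_def)
        also have "exp (- (G * X)) * exp (Cc * X) / exp (- ((Cb + H) * X)) = exp (- X)"
          by (simp add: G_def algebra_simps flip: exp_add exp_diff)
        finally show ?thesis .
      qed
      finally show ?thesis by (simp add: X_def)
    qed
    show "(\<lambda>n. measure (sample_distribution \<nu> \<pi>0 n)
                  {X \<in> space (sample_distribution \<nu> \<pi>0 n).
                     measure (posterior (density_prior P \<nu> W) n X)
                       {f \<in> space C01. hellinger \<nu> f \<pi>0 > M * max (rho \<alpha> \<beta> p n) (rho_tilde \<alpha> \<beta> p n)}
                     > \<epsilon>}) \<longlonglongrightarrow> 0"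
      unfolding prob_def[symmetric]
    proof (rule tendsto_sandwich)
      show "\<forall>\<^sub>F n in sequentially. 0 \<le> prob n" by (simp add: prob_def)
      have "0 < b / m" using b m by simp
      then have "(\<lambda>n::nat. 2 * (K2 * real n powr (- (b / m)))) \<longlonglongrightarrow> 0" by real_asymp
      then have "\<forall>\<^sub>F n in sequentially. 2 * (K2 * \<rho> n) < 1"
        unfolding \<rho>_def by (rule order_tendstoD) simp
      then show "\<forall>\<^sub>F n in sequentially. prob n \<le>
          exp (- (H * real n powr t)) + 1 / real n + 2 / sqrt (\<epsilon> / 2) * exp (- (real n powr t))"
        using eventually_ge_at_top[of 1] by eventually_elim (rule bound; simp)
      show "(\<lambda>n. exp (- (H * real n powr t)) + 1 / real n + 2 / sqrt (\<epsilon> / 2) * exp (- (real n powr t))) \<longlonglongrightarrow> 0"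
        using H t by real_asymp
      show "(\<lambda>n. 0::real) \<longlonglongrightarrow> 0" by simp
    qed
  qed
qed

end
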